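(* For all partitions $\lambda=(\lambda_1,\lambda_2,\dots)$ and $\mu=(\mu_1,\mu_2,\dots)$ (padded with zeros), the polynomial $$s_{\lambda\mid\mu}(p,q)=s_\lambda\Bigl(\frac{p+q}{2}\Bigr)s_\mu\Bigl(\frac{p-q}{2}\Bigr)$$ is an eigenvector of $\mathcal{CJ}_1$ with eigenvalue $\sum_{i\ge1}\bigl(\lambda_i(\lambda_i-2i+1)+\mu_i(\mu_i-2i+1)\bigr)$ and an eigenvector of $\mathcal{CJ}_2$ with eigenvalue $\sum_{i\ge1}(\lambda_i-\mu_i)$.
   Context: $s_\lambda$ denotes the Schur polynomial written as a polynomial in the power-sum variables, and $s_\lambda\bigl(\frac{p+q}{2}\bigr)$ means $s_\lambda$ with the $k$-th power-sum variable replaced by $(p_k+q_k)/2$ for every $k$ (similarly for $(p-q)/2$). Setting of $\mathcal{CJ}_1,\mathcal{CJ}_2$: for $n\ge1$ let $\tau=(1,n+1)\cdots(n,2n)\in S_{2n}$, identify $B_n$ with $\{\sigma\in S_{2n}\mid\sigma\tau=\tau\sigma\}$, indices mod $2n$; reflections $r_{ij}=(i,j)(i+n,j+n)$ ($i\ne j$, $i\ne j\pm n$; $r_{ij}=r_{i+n,j+n}$) and $l_i=(i,i+n)$ ($l_i=l_{i+n}$). For $\sigma\in B_n$, each cycle $c$ either forms with $\tau(c)\ne c$ an "$\alpha$-pair", or satisfies $\tau(c)=c$ and has even length ("$\beta$-cycle"). For partitions $\lambda,\mu$ with $|\lambda|+|\mu|=n$, $C_{\lambda\mid\mu}$ is the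 set of $\sigma\in B_n$ with $\alpha$-pairs of lengths $\lambda_1,\lambda_2,\dots$ and $\beta$-cycles of lengths $2\mu_1,2\mu_2,\dots$. $\mathbb{C}[p,q]$ is the polynomial ring in $p_k,q_k$ with $\deg p_k=\deg q_k=k$; $\Psi:Z[B_n]\to\mathbb{C}[p,q]_n$ is the linear isomorphism $\frac1{\#C_{\lambda\mid\mu}}\sum_{x\in C_{\lambda\mid\mu}}x\mapsto\prod_ip_{\lambda_i}\prod_jq_{\mu_j}$; and $\mathcal{CJ}_i=\Psi\circ(x\mapsto\mathcal T_ix)\circ\Psi^{-1}$ on each $\mathbb{C}[p,q]_n$ ($0$ on constants), where $\mathcal T_1$ (resp. $\mathcal T_2$) is the sum of all distinct elements of the form $r_{ij}$ (resp. $l_i$). *)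

theory Defs
  imports
    Complex_Main
    "HOL-Library.Poly_Mapping"
    "HOL-Library.Multiset"
    "HOL-Library.FuncSet"
    "HOL-Library.Indicator_Function"
    "HOL-Combinatorics.Permutations"
    "HOL-Combinatorics.Transposition"
    "HOL-Combinatorics.Orbits"
    "Jordan_Normal_Form.Determinant"
begin

definition is_partition :: "nat list \<Rightarrow> bool" where
  "is_partition lam \<longleftrightarrow> sorted_wrt (\<ge>) lam \<and> 0 \<notin> set lam"

text \<open>The parts are numbered from 1 and padded with zeros.\<close>

definition part :: "nat list \<Rightarrow> nat \<Rightarrow> nat" where
  "part lam i = (if 1 \<le> i \<and> i \<le> length lam then lam ! (i - 1) else 0)"

text \<open>Monomials over \<open>'v\<close> are finitely supported exponent functions; the product of
  \<open>\<Rightarrow>\<^sub>0\<close> is convolution, so this is the polynomial ring over the complex numbers in the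
  variables \<open>'v\<close>.\<close>

type_synonym 'v cpoly = "('v \<Rightarrow>\<^sub>0 nat) \<Rightarrow>\<^sub>0 complex"

definition Const :: "complex \<Rightarrow> 'v cpoly" where
  "Const c = Poly_Mapping.single 0 c"

definition Var :: "'v \<Rightarrow> 'v cpoly" where
  "Var v = Poly_Mapping.single (Poly_Mapping.single v 1) 1"

definition poly_subst :: "('v \<Rightarrow> 'w cpoly) \<Rightarrow> 'v cpoly \<Rightarrow> 'w cpoly" where
  "poly_subst \<phi> f =
     (\<Sum>m\<in>Poly_Mapping.keys f. Const (Poly_Mapping.lookup f m) *
        (\<Prod>v\<in>Poly_Mapping.keys m. \<phi> v ^ Poly_Mapping.lookup m v))"

text \<open>The \<open>N\<close> variables \<open>x\<^sub>1, \<dots>, x\<^sub>N\<close> are \<open>Var 0, \<dots>, Var (N - 1)\<close>.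
  For \<open>N \<ge> length lam\<close>, \<open>alternant N lam\<close> is
  \<open>det (x\<^sub>i ^ (lam\<^sub>j + N - j))\<close> with \<open>1 \<le> i, j \<le> N\<close>, and \<open>alternant N []\<close>
  is the Vandermonde determinant. The matrix indices start at 0.\<close>

definition alternant :: "nat \<Rightarrow> nat list \<Rightarrow> nat cpoly" where
  "alternant N lam =
     Determinant.det (mat N N (\<lambda>(i, j). Var i ^ (part lam (j + 1) + (N - 1 - j))))"

definition schur_x :: "nat \<Rightarrow> nat list \<Rightarrow> nat cpoly" where
  "schur_x N lam = (THE s. s * alternant N [] = alternant N lam)"

definition power_sum :: "nat \<Rightarrow> nat \<Rightarrow> nat cpoly" where
  "power_sum N k = (\<Sum>i<N. Var i ^ k)"

text \<open>The Schur polynomial written as a polynomial in the power sums. In the result,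
  \<open>Var i\<close> stands for the power-sum variable of index \<open>i + 1\<close>, so that the
  variables are exactly those of index \<open>k \<ge> 1\<close>.\<close>

definition schur :: "nat list \<Rightarrow> nat cpoly" where
  "schur lam =
     (THE f. \<forall>N \<ge> length lam. poly_subst (\<lambda>i. power_sum N (i + 1)) f = schur_x N lam)"

text \<open>Again indices are shifted: \<open>PVar i\<close> and \<open>QVar i\<close> name the variables
  \<open>p\<^sub>k\<close> and \<open>q\<^sub>k\<close> with \<open>k = i + 1\<close>.\<close>

datatype pq_var = PVar nat | QVar nat

type_synonym pq_poly = "pq_var cpoly"

definition p_var :: "nat \<Rightarrow> pq_poly" where "p_var k = Var (PVar (k - 1))"
definition q_var :: "nat \<Rightarrow> pq_poly" where "q_var k = Var (QVar (k - 1))"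

fun var_deg :: "pq_var \<Rightarrow> nat" where
  "var_deg (PVar i) = i + 1"
| "var_deg (QVar i) = i + 1"

definition mono_deg :: "(pq_var \<Rightarrow>\<^sub>0 nat) \<Rightarrow> nat" where
  "mono_deg m = (\<Sum>v\<in>Poly_Mapping.keys m. Poly_Mapping.lookup m v * var_deg v)"

definition hom_component :: "nat \<Rightarrow> pq_poly \<Rightarrow> pq_poly" where
  "hom_component n f =
     (\<Sum>m\<in>{m \<in> Poly_Mapping.keys f. mono_deg m = n}.
        Poly_Mapping.single m (Poly_Mapping.lookup f m))"

definition schur_pq :: "nat list \<Rightarrow> nat list \<Rightarrow> pq_poly" where
  "schur_pq lam mu =
     poly_subst (\<lambda>i. Const (1/2) * (p_var (i + 1) + q_var (i + 1))) (schur lam) *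
     poly_subst (\<lambda>i. Const (1/2) * (p_var (i + 1) - q_var (i + 1))) (schur mu)"

definition tau :: "nat \<Rightarrow> nat \<Rightarrow> nat" where
  "tau n i = (if i \<in> {1..n} then i + n else if i \<in> {n+1..2*n} then i - n else i)"

definition hyperoct :: "nat \<Rightarrow> (nat \<Rightarrow> nat) set" where
  "hyperoct n = {\<sigma>. \<sigma> permutes {1..2*n} \<and> \<sigma> \<circ> tau n = tau n \<circ> \<sigma>}"

text \<open>Cycles, including those of length 1, are represented by their underlying sets. As
  \<open>\<sigma>\<close> commutes with \<open>\<tau>\<close>, the cycle \<open>\<tau>(c)\<close> is the one with underlying
  set \<open>tau n ` c\<close>.\<close>

definition cycles :: "nat \<Rightarrow> (nat \<Rightarrow> nat) \<Rightarrow> nat set set" where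
  "cycles n \<sigma> = orbit \<sigma> ` {1..2*n}"

definition alpha_pairs :: "nat \<Rightarrow> (nat \<Rightarrow> nat) \<Rightarrow> nat set set set" where
  "alpha_pairs n \<sigma> = {{c, tau n ` c} |c. c \<in> cycles n \<sigma> \<and> tau n ` c \<noteq> c}"

definition beta_cycles :: "nat \<Rightarrow> (nat \<Rightarrow> nat) \<Rightarrow> nat set set" where
  "beta_cycles n \<sigma> = {c \<in> cycles n \<sigma>. tau n ` c = c}"

text \<open>The length of an alpha-pair is the common length of its two disjoint cycles, hence
  half the number of points that they cover.\<close>

definition bip_class :: "nat \<Rightarrow> nat list \<Rightarrow> nat list \<Rightarrow> (nat \<Rightarrow> nat) set" where
  "bip_class n lam mu =
     {\<sigma> \<in> hyperoct n.
        image_mset (\<lambda>pr. card (\<Union>pr) div 2) (mset_set (alpha_pairs n \<sigma>)) = mset lam \<and>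
        image_mset card (mset_set (beta_cycles n \<sigma>)) = mset (map (\<lambda>m. 2 * m) mu)}"

definition r_refl :: "nat \<Rightarrow> nat \<Rightarrow> nat \<Rightarrow> nat \<Rightarrow> nat" where
  "r_refl n i j = transpose i j \<circ> transpose (tau n i) (tau n j)"

definition l_refl :: "nat \<Rightarrow> nat \<Rightarrow> nat \<Rightarrow> nat" where
  "l_refl n i = transpose i (tau n i)"

text \<open>Elements of the group algebra are coefficient functions vanishing outside \<open>hyperoct n\<close>.\<close>

type_synonym galg = "(nat \<Rightarrow> nat) \<Rightarrow> complex"

definition group_algebra :: "nat \<Rightarrow> galg set" where
  "group_algebra n = {x. \<forall>\<sigma>. \<sigma> \<notin> hyperoct n \<longrightarrow> x \<sigma> = 0}"

definition conv :: "nat \<Rightarrow> galg \<Rightarrow> galg \<Rightarrow> galg" where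
  "conv n x y = (\<lambda>g. \<Sum>h\<in>hyperoct n. x h * y (inv_into UNIV h \<circ> g))"

definition centre :: "nat \<Rightarrow> galg set" where
  "centre n = {z \<in> group_algebra n. \<forall>x\<in>group_algebra n. conv n x z = conv n z x}"

definition class_average :: "nat \<Rightarrow> nat list \<Rightarrow> nat list \<Rightarrow> galg" where
  "class_average n lam mu =
     (\<lambda>\<sigma>. indicator (bip_class n lam mu) \<sigma> / of_nat (card (bip_class n lam mu)))"

definition T1 :: "nat \<Rightarrow> galg" where
  "T1 n = indicator {r_refl n i j |i j. i \<in> {1..2*n} \<and> j \<in> {1..2*n} \<and> i \<noteq> j \<and> j \<noteq> tau n i}"

definition T2 :: "nat \<Rightarrow> galg" where
  "T2 n = indicator {l_refl n i |i. i \<in> {1..2*n}}"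

definition Psi :: "nat \<Rightarrow> galg \<Rightarrow> pq_poly" where
  "Psi n = (THE F. F \<in> extensional (centre n) \<and>
     (\<forall>x\<in>centre n. \<forall>y\<in>centre n. \<forall>a b.
        F (\<lambda>\<sigma>. a * x \<sigma> + b * y \<sigma>) = Const a * F x + Const b * F y) \<and>
     (\<forall>lam mu. is_partition lam \<and> is_partition mu \<and> sum_list lam + sum_list mu = n \<longrightarrow>
        F (class_average n lam mu) = prod_list (map p_var lam) * prod_list (map q_var mu)))"

text \<open>The operator on C[p,q] that is \<open>\<Psi> \<circ> (x \<mapsto> T x) \<circ> \<Psi>\<^sup>-\<^sup>1\<close> on each
  homogeneous component of degree \<open>n \<ge> 1\<close> and zero on constants.\<close>

definition transported :: "(nat \<Rightarrow> galg) \<Rightarrow> pq_poly \<Rightarrow> pq_poly" where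
  "transported T f =
     (\<Sum>n\<in>mono_deg ` Poly_Mapping.keys f - {0}.
        Psi n (conv n (T n) (inv_into (centre n) (Psi n) (hom_component n f))))"

definition CJ1 :: "pq_poly \<Rightarrow> pq_poly" where "CJ1 = transported T1"
definition CJ2 :: "pq_poly \<Rightarrow> pq_poly" where "CJ2 = transported T2"

definition eigenvector :: "(pq_poly \<Rightarrow> pq_poly) \<Rightarrow> pq_poly \<Rightarrow> complex \<Rightarrow> bool" where
  "eigenvector A f c \<longleftrightarrow> f \<noteq> 0 \<and> A f = Const c * f"

end

theory Submission
  imports Defs "HOL-Computational_Algebra.Formal_Power_Series"
begin

text \<open>
  Write \<open>u = (p + q)/2\<close>, \<open>v = (p - q)/2\<close> and let \<open>u\<close>, \<open>v\<close> be the power sums of two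
  independent sets of variables \<open>x\<^sub>1, \<dots>, x\<^sub>N\<close> and \<open>y\<^sub>1, \<dots>, y\<^sub>N\<close>. For large \<open>N\<close> nothing
  is lost, since power sums are algebraically independent (Jacobian criterion). On the centre of
  the group algebra, \<open>\<Psi>\<close> is the sum of \<open>z \<sigma> * \<Psi> \<sigma>\<close>, where \<open>\<Psi> \<sigma>\<close> is the monomial of the
  cycle type of \<open>\<sigma>\<close>. Regarding \<open>\<sigma>\<close> as a signed permutation of \<open>{1..n}\<close>, multiplication by
  \<open>r\<^sub>i\<^sub>j\<close> and \<open>r\<^sub>i\<^sub>,\<^sub>j\<^sub>+\<^sub>n\<close> cuts or joins cycles. Let \<open>D\<close> denote the operators \<open>x d/dx\<close>,
  and let \<open>a = a\<^sub>\<delta>(x) a\<^sub>\<delta>(y)\<close> be the product of the two Vandermonde determinants. The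
  effect of all these cuts and joins on the evaluated monomials, multiplied by \<open>a\<close>, is that of
  \<open>\<Sum> D\<^sup>2 - (2N - 1) \<Sum> D - const\<close>: the second derivative of two factors gives the joins, and the
  logarithmic derivative of \<open>a\<close> the cuts. Likewise \<open>\<T>\<^sub>2\<close> becomes \<open>\<Sum> D\<^sub>x - \<Sum> D\<^sub>y\<close>.
  As \<open>a s\<^sub>\<lambda>(x) s\<^sub>\<mu>(y)\<close> is the product of the alternants of \<open>\<lambda>\<close> and \<open>\<mu>\<close>, all of its monomials have
  the same eigenvalue under these operators.
\<close>

section \<open>Polynomials and derivations\<close>

text \<open>The combinations \<open>u\<close> and \<open>v\<close> are forced by the signs.
  Multiplying by \<open>l_i\<close> reverses the sign of one cycle, which exchanges
  \<open>p_k\<close> and \<open>q_k\<close> and so negates \<open>v_k\<close>. Summed over both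
  reflections for a pair of points, a cut yields
  \<open>p_d p_e + q_d q_e = 2 (u_d u_e + v_d v_e)\<close> or
  \<open>p_d q_e + q_d p_e = 2 (u_d u_e - v_d v_e)\<close>: no term mixes \<open>u\<close> and
  \<open>v\<close>. Several definitions are descriptions whose solution must first be shown to exist
  and to be unique. For \<open>schur\<close>, existence comes from Newton's identities and the
  Jacobi-Trudi determinant, uniqueness from algebraic independence. For \<open>Psi\<close>,
  uniqueness needs conjugacy of elements with equal signed cycle type, so that the class averages
  span the centre; existence needs every class to be nonempty, since an empty class has average 0.
  As \<open>transported\<close> picks preimages under \<open>Psi\<close>, surjectivity onto each
  degree is needed as well. The Vandermonde determinant is never factored: its square is, up to an
  integer, a product over ordered pairs, and this is enough for logarithmic derivatives.\<close>

abbreviation "keys \<equiv> Poly_Mapping.keys"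
abbreviation "lookup \<equiv> Poly_Mapping.lookup"
abbreviation "single \<equiv> Poly_Mapping.single"

lemma Const_0 [simp]: "Const 0 = 0" by (simp add: Const_def)
lemma Const_1 [simp]: "Const 1 = 1" by (simp add: Const_def)
lemma Const_add: "Const (a + b) = Const a + Const b" by (simp add: Const_def single_add)
lemma Const_mult: "Const (a * b) = Const a * Const b" by (simp add: Const_def mult_single)
lemma Const_of_nat [simp]: "Const (of_nat n) = of_nat n" by (simp add: Const_def)
lemma Const_of_int [simp]: "Const (of_int n) = of_int n" by (simp add: Const_def)
lemma Const_numeral [simp]: "Const (numeral n) = numeral n" by (simp add: Const_def)
lemma Const_sum: "Const (sum f A) = (\<Sum>x\<in>A. Const (f x))"
  by (induction A rule: infinite_finite_induct) (simp_all add: Const_add)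
lemma Const_mult_inverse: "c \<noteq> 0 \<Longrightarrow> Const c * Const (1 / c) = 1"
  by (simp flip: Const_mult)

lemma lookup_Const_mult: "lookup (Const c * f) m = c * lookup f m"
  for f :: "'v cpoly"
  by (simp add: Const_def lookup_mult lookup_single when_mult mult_when)

lemma cpoly_sum_monomials: "(\<Sum>m\<in>keys f. single m (lookup f m)) = f" for f :: "'v cpoly"
  by (rule poly_mapping_eqI)
     (simp add: lookup_sum lookup_single when_def not_in_keys_iff_lookup_eq_zero)

lemma cpoly_induct [case_names single add]:
  fixes f :: "'v cpoly"
  assumes "\<And>m c. P (single m c)" and "\<And>f g. P f \<Longrightarrow> P g \<Longrightarrow> P (f + g)"
  shows "P f"
proof -
  have "P (\<Sum>m\<in>S. single m (lookup f m))" if "finite S" for S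
    using that by induction (use assms(1)[of 0 0] in \<open>auto intro: assms\<close>)
  from this[of "keys f"] show ?thesis by (simp add: cpoly_sum_monomials)
qed

lemma single_conv_Const: "single m c = Const c * single m (1::complex)"
  by (simp add: Const_def mult_single)

section \<open>Substitution as a ring homomorphism\<close>

definition monom_subst :: "('v \<Rightarrow> 'w cpoly) \<Rightarrow> ('v \<Rightarrow>\<^sub>0 nat) \<Rightarrow> 'w cpoly" where
  "monom_subst \<phi> m = (\<Prod>v\<in>keys m. \<phi> v ^ lookup m v)"

lemma monom_subst_superset:
  "finite S \<Longrightarrow> keys m \<subseteq> S \<Longrightarrow> monom_subst \<phi> m = (\<Prod>v\<in>S. \<phi> v ^ lookup m v)"
  unfolding monom_subst_def
  by (rule prod.mono_neutral_left) (auto simp: in_keys_iff)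

lemma monom_subst_0 [simp]: "monom_subst \<phi> 0 = 1"
  by (simp add: monom_subst_def)

lemma monom_subst_single [simp]: "monom_subst \<phi> (single v k) = \<phi> v ^ k"
  by (simp add: monom_subst_def)

lemma monom_subst_add: "monom_subst \<phi> (m + m') = monom_subst \<phi> m * monom_subst \<phi> m'"
proof -
  have "keys (m + m') \<subseteq> keys m \<union> keys m'" by (rule keys_add)
  then show ?thesis
    by (simp add: monom_subst_superset[of "keys m \<union> keys m'"] lookup_add power_add prod.distrib)
qed

lemma poly_subst_superset:
  assumes "finite S" "keys f \<subseteq> S"
  shows "poly_subst \<phi> f = (\<Sum>m\<in>S. Const (lookup f m) * monom_subst \<phi> m)"
  unfolding poly_subst_def monom_subst_def[symmetric]
  by (rule sum.mono_neutral_left) (use assms in \<open>auto simp: in_keys_iff\<close>)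

lemma poly_subst_single [simp]: "poly_subst \<phi> (single m c) = Const c * monom_subst \<phi> m"
  by (subst poly_subst_superset[of "{m}"]) auto

lemma poly_subst_add: "poly_subst \<phi> (f + g) = poly_subst \<phi> f + poly_subst \<phi> g"
proof -
  have "keys (f + g) \<subseteq> keys f \<union> keys g" by (rule keys_add)
  then show ?thesis
    by (simp add: poly_subst_superset[of "keys f \<union> keys g"] lookup_add Const_add
        distrib_right sum.distrib)
qed

lemma poly_subst_mult: "poly_subst \<phi> (f * g) = poly_subst \<phi> f * poly_subst \<phi> g"
proof (induction f rule: cpoly_induct)
  case (single m c)
  show ?case
    by (induction g rule: cpoly_induct)
       (simp_all add: mult_single Const_mult monom_subst_add poly_subst_add distrib_left
         mult.assoc mult.left_commute)
next
  case (add f f')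
  then show ?case by (simp add: poly_subst_add distrib_right)
qed

lemma poly_subst_Const [simp]: "poly_subst \<phi> (Const c) = Const c"
  using poly_subst_single[of \<phi> 0 c] by (simp add: Const_def)

lemma poly_subst_Var [simp]: "poly_subst \<phi> (Var v) = \<phi> v"
  by (simp add: Var_def)

lemma poly_subst_0 [simp]: "poly_subst \<phi> 0 = 0"
  by (simp add: poly_subst_def)

lemma poly_subst_1 [simp]: "poly_subst \<phi> 1 = 1"
  using poly_subst_Const[of \<phi> 1] by simp

lemma poly_subst_uminus: "poly_subst \<phi> (- f) = - poly_subst \<phi> f"
  using poly_subst_add[of \<phi> f "- f"] by (simp add: eq_neg_iff_add_eq_0 add.commute)

lemma poly_subst_diff: "poly_subst \<phi> (f - g) = poly_subst \<phi> f - poly_subst \<phi> g"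
  using poly_subst_add[of \<phi> f "- g"] by (simp add: poly_subst_uminus)

lemma poly_subst_sum: "poly_subst \<phi> (sum f A) = (\<Sum>x\<in>A. poly_subst \<phi> (f x))"
  by (induction A rule: infinite_finite_induct) (simp_all add: poly_subst_add)

lemma poly_subst_prod: "poly_subst \<phi> (prod f A) = (\<Prod>x\<in>A. poly_subst \<phi> (f x))"
  by (induction A rule: infinite_finite_induct) (simp_all add: poly_subst_mult)

lemma poly_subst_power: "poly_subst \<phi> (f ^ n) = poly_subst \<phi> f ^ n"
  by (induction n) (simp_all add: poly_subst_mult)

lemma poly_subst_of_int [simp]: "poly_subst \<phi> (of_int n) = of_int n"
  by (simp flip: Const_of_int)

lemma poly_subst_poly_subst:
  "poly_subst \<psi> (poly_subst \<phi> f) = poly_subst (\<lambda>v. poly_subst \<psi> (\<phi> v)) f"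
  by (induction f rule: cpoly_induct)
     (simp_all add: poly_subst_add poly_subst_mult monom_subst_def poly_subst_prod poly_subst_power)

section \<open>Derivations, Euler operators and the Jacobian criterion\<close>

locale derivation =
  fixes D :: "'v cpoly \<Rightarrow> 'v cpoly"
  assumes add: "D (f + g) = D f + D g"
    and mult: "D (f * g) = D f * g + f * D g"
    and Const [simp]: "D (Const c) = 0"
begin

lemma zero [simp]: "D 0 = 0" using Const[of 0] by simp
lemma one [simp]: "D 1 = 0" using Const[of 1] by simp
lemma of_nat [simp]: "D (of_nat n) = 0" using Const[of "of_nat n"] by simp
lemma of_int [simp]: "D (of_int n) = 0" using Const[of "of_int n"] by simp
lemma scale: "D (Const c * f) = Const c * D f" by (simp add: mult)
lemma of_nat_mult: "D (of_nat n * f) = of_nat n * D f" by (simp add: mult)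
lemma of_int_mult: "D (of_int n * f) = of_int n * D f" by (simp add: mult)
lemma uminus: "D (- f) = - D f" using of_int_mult[of "-1" f] by simp
lemma diff: "D (f - g) = D f - D g" using add[of f "- g"] by (simp add: uminus)
lemma sum: "D (sum f A) = (\<Sum>x\<in>A. D (f x))"
  by (induction A rule: infinite_finite_induct) (simp_all add: add)
lemma power: "D (f ^ n) = of_nat n * f ^ (n - 1) * D f"
proof (induction n)
  case (Suc n)
  then show ?case by (cases n) (simp_all add: mult algebra_simps)
qed simp
lemma prod: "finite A \<Longrightarrow> D (prod f A) = (\<Sum>x\<in>A. D (f x) * prod f (A - {x}))"
proof (induction A rule: finite_induct)
  case (insert a A)
  have "(\<Sum>x\<in>A. D (f x) * prod f (insert a A - {x})) = (\<Sum>x\<in>A. f a * (D (f x) * prod f (A - {x})))"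
  proof (rule sum.cong)
    fix x assume "x \<in> A"
    then have "insert a A - {x} = insert a (A - {x})" using insert.hyps by auto
    then show "D (f x) * prod f (insert a A - {x}) = f a * (D (f x) * prod f (A - {x}))"
      using insert.hyps by (simp add: mult_ac)
  qed simp
  then show ?case using insert by (simp add: mult sum_distrib_left)
qed simp

end

definition euler :: "'v \<Rightarrow> 'v cpoly \<Rightarrow> 'v cpoly" where
  "euler v f = (\<Sum>m\<in>keys f. single m (of_nat (lookup m v) * lookup f m))"

lemma lookup_euler: "lookup (euler v f) m = of_nat (lookup m v) * lookup f m"
  by (simp add: euler_def lookup_sum lookup_single when_def not_in_keys_iff_lookup_eq_zero)

lemma euler_add: "euler v (f + g) = euler v f + euler v g"
  by (rule poly_mapping_eqI) (simp add: lookup_euler lookup_add distrib_left)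

lemma euler_single: "euler v (single m c) = single m (of_nat (lookup m v) * c)"
  by (rule poly_mapping_eqI) (simp add: lookup_euler lookup_single when_def)

interpretation euler: derivation "euler v" for v
proof
  show "euler v (f * g) = euler v f * g + f * euler v g" for f g
  proof (induction f rule: cpoly_induct)
    case (single m c)
    show ?case
      by (induction g rule: cpoly_induct)
         (simp_all add: mult_single euler_single euler_add lookup_add algebra_simps
           flip: single_add)
  next
    case (add f f')
    then show ?case by (simp add: euler_add distrib_right)
  qed
qed (simp_all add: euler_add euler_single Const_def)

lemma euler_Var: "euler v (Var w) = (if v = w then Var v else 0)"
  by (simp add: Var_def euler_single lookup_single)

text \<open>The truncated difference \<open>m - single v 1\<close> is harmless: where it truncates,
  \<open>v\<close> does not occur in \<open>m\<close> and the coefficient is 0.\<close>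

definition pdiff :: "'v \<Rightarrow> 'v cpoly \<Rightarrow> 'v cpoly" where
  "pdiff v f = (\<Sum>m\<in>keys f. single (m - single v 1) (of_nat (lookup m v) * lookup f m))"

lemma lookup_pdiff: "lookup (pdiff v f) m = of_nat (lookup m v + 1) * lookup f (m + single v 1)"
proof -
  have "lookup (single (n - single v 1) (of_nat (lookup n v) * lookup f n)) m =
      (if n = m + single v 1 then of_nat (lookup n v) * lookup f n else 0)" for n
  proof (cases "lookup n v = 0")
    case True
    then show ?thesis by auto
  next
    case False
    then have "n - single v 1 = m \<longleftrightarrow> n = m + single v 1"
      unfolding poly_mapping_eq_iff fun_eq_iff lookup_minus lookup_add lookup_single
      by (intro iff_allI) (auto simp: when_def)
    then show ?thesis by (simp add: lookup_single when_def)
  qed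
  then have "lookup (pdiff v f) m =
      (\<Sum>n\<in>keys f. if n = m + single v 1 then of_nat (lookup n v) * lookup f n else 0)"
    unfolding pdiff_def lookup_sum by simp
  then show ?thesis
    by (simp add: lookup_add not_in_keys_iff_lookup_eq_zero)
qed

lemma monom_subst_diff:
  assumes "finite V" "keys m \<subseteq> V" "v \<in> V"
  shows "monom_subst \<phi> (m - single v 1) =
    \<phi> v ^ (lookup m v - 1) * (\<Prod>w\<in>V - {v}. \<phi> w ^ lookup m w)"
proof -
  have "keys (m - single v 1) \<subseteq> V"
    using assms by (auto simp: in_keys_iff lookup_minus)
  then have "monom_subst \<phi> (m - single v 1) = (\<Prod>w\<in>V. \<phi> w ^ lookup (m - single v 1) w)"
    using assms(1) by (rule monom_subst_superset[rotated])
  also have "\<dots> = \<phi> v ^ lookup (m - single v 1) v *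
      (\<Prod>w\<in>V - {v}. \<phi> w ^ lookup (m - single v 1) w)"
    using assms by (simp add: prod.remove)
  also have "(\<Prod>w\<in>V - {v}. \<phi> w ^ lookup (m - single v 1) w) = (\<Prod>w\<in>V - {v}. \<phi> w ^ lookup m w)"
    by (rule prod.cong) (auto simp: lookup_minus lookup_single)
  finally show ?thesis by (simp add: lookup_minus)
qed

text \<open>The Leibniz rule on each monomial, then linearity. This is how a polynomial relation
  between the \<open>\<phi> v\<close> is differentiated.\<close>

lemma (in derivation) chain_rule:
  assumes V: "finite V" "\<forall>m\<in>keys f. keys m \<subseteq> V"
  shows "D (poly_subst \<phi> f) = (\<Sum>v\<in>V. poly_subst \<phi> (pdiff v f) * D (\<phi> v))"
proof -
  have 1: "D (monom_subst \<phi> m) =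
      (\<Sum>v\<in>V. of_nat (lookup m v) * monom_subst \<phi> (m - single v 1) * D (\<phi> v))"
    if "m \<in> keys f" for m
  proof -
    have m: "keys m \<subseteq> V" using V that by auto
    show ?thesis
      unfolding monom_subst_superset[OF V(1) m] prod[OF V(1)]
      by (rule sum.cong[OF refl], subst monom_subst_diff[OF V(1) m])
         (simp_all add: power mult_ac)
  qed
  have "D (poly_subst \<phi> f) = (\<Sum>m\<in>keys f. Const (lookup f m) * D (monom_subst \<phi> m))"
    by (simp add: poly_subst_superset[OF _ order.refl] sum scale)
  also have "\<dots> = (\<Sum>m\<in>keys f. \<Sum>v\<in>V. Const (of_nat (lookup m v) * lookup f m) *
      monom_subst \<phi> (m - single v 1) * D (\<phi> v))"
    by (simp add: 1 sum_distrib_left Const_mult mult_ac)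
  also have "\<dots> = (\<Sum>v\<in>V. poly_subst \<phi> (pdiff v f) * D (\<phi> v))"
    by (subst sum.swap) (simp add: pdiff_def poly_subst_sum sum_distrib_right)
  finally show ?thesis .
qed

text \<open>Induction on the degree: if \<open>\<phi>\<close> satisfies a polynomial relation, then applying the
  derivations \<open>D i\<close> to it shows that \<open>\<phi>\<close> also satisfies all partial derivatives of the
  relation.\<close>

lemma poly_subst_inj_jacobian:
  fixes \<phi> :: "'v \<Rightarrow> 'w cpoly"
  assumes V: "finite V" and D: "\<And>i. i \<in> I \<Longrightarrow> derivation (D i)"
    and nondeg: "\<And>c. (\<And>i. i \<in> I \<Longrightarrow> (\<Sum>v\<in>V. c v * D i (\<phi> v)) = 0) \<Longrightarrow> \<forall>v\<in>V. c v = 0"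
    and f: "\<forall>m\<in>keys f. keys m \<subseteq> V" "poly_subst \<phi> f = 0"
  shows "f = 0"
proof -
  define deg where "deg m = (\<Sum>v\<in>V. lookup m v)" for m :: "'v \<Rightarrow>\<^sub>0 nat"
  have "f = 0" if "\<forall>m\<in>keys f. keys m \<subseteq> V \<and> deg m \<le> d" "poly_subst \<phi> f = 0" for d f
    using that
  proof (induction d arbitrary: f)
    case 0
    have "m = 0" if "m \<in> keys f" for m
      using 0(1) V that by (fastforce simp: deg_def in_keys_iff intro!: poly_mapping_eqI)
    then have "keys f \<subseteq> {0}" by auto
    then have "Const (lookup f 0) = (0 :: 'w cpoly)"
      using 0(2) by (simp add: poly_subst_superset[of "{0}"])
    then have "lookup f 0 = 0" unfolding Const_def
      by (metis lookup_single_eq lookup_zero)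
    then have "0 \<notin> keys f" by (simp add: in_keys_iff)
    then have "keys f = {}" using \<open>keys f \<subseteq> {0}\<close> by blast
    then show ?case using cpoly_sum_monomials[of f] by simp
  next
    case (Suc d)
    have "pdiff v f = 0" if v: "v \<in> V" for v
    proof (rule Suc.IH)
      show "\<forall>m\<in>keys (pdiff v f). keys m \<subseteq> V \<and> deg m \<le> d"
      proof
        fix m assume "m \<in> keys (pdiff v f)"
        then have m: "m + single v 1 \<in> keys f" by (auto simp: in_keys_iff lookup_pdiff)
        then have "keys (m + single v 1) \<subseteq> V" and *: "deg (m + single v 1) \<le> Suc d"
          using Suc.prems by auto
        then have "keys m \<subseteq> V" by (auto simp: in_keys_iff lookup_add)
        moreover have "deg (m + single v 1) = Suc (deg m)"
          using v V by (simp add: deg_def lookup_add sum.distrib lookup_single when_def)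
        ultimately show "keys m \<subseteq> V \<and> deg m \<le> d" using * by simp
      qed
      have "\<forall>v\<in>V. poly_subst \<phi> (pdiff v f) = 0"
      proof (rule nondeg)
        fix i assume i: "i \<in> I"
        show "(\<Sum>v\<in>V. poly_subst \<phi> (pdiff v f) * D i (\<phi> v)) = 0"
          using derivation.chain_rule[OF D[OF i] V, of f \<phi>] derivation.zero[OF D[OF i]] Suc.prems
          by simp
      qed
      then show "poly_subst \<phi> (pdiff v f) = 0" using v by simp
    qed
    \<comment> \<open>In characteristic 0 the vanishing of all partial derivatives leaves only the
      constant term, so the degree bound \<open>d\<close> holds for \<open>f\<close> itself and the
      induction hypothesis applies to it.\<close>
    then have "lookup f m = 0" if "v \<in> V" "v \<in> keys m" for v m
    proof -
      have "m - single v 1 + single v 1 = m"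
        using that by (auto simp: poly_mapping_eq_iff fun_eq_iff lookup_minus lookup_add
            lookup_single when_def in_keys_iff)
      then show ?thesis
        using lookup_pdiff[of v f "m - single v 1"] \<open>\<And>v. v \<in> V \<Longrightarrow> pdiff v f = 0\<close>[OF that(1)]
        by (simp add: of_nat_Suc[symmetric] del: of_nat_Suc)
    qed
    then have "\<forall>m\<in>keys f. keys m = {}" using Suc.prems(1)
      by (meson all_not_in_conv in_keys_iff subsetD)
    then have "\<forall>m\<in>keys f. keys m \<subseteq> V \<and> deg m \<le> d"
      by (auto simp: deg_def in_keys_iff)
    then show ?case using Suc.IH Suc.prems(2) by blast
  qed
  from this[of f "\<Sum>m\<in>keys f. deg m"] show ?thesis
    using f by (simp add: member_le_sum)
qed

section \<open>Alternants and the Jacobi--Trudi formula\<close>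

text \<open>Over an arbitrary commutative ring and at arbitrary points, so that the same results
  serve both sets of variables.\<close>

definition alt :: "(nat \<Rightarrow> 'a::comm_ring_1) \<Rightarrow> nat \<Rightarrow> nat list \<Rightarrow> 'a" where
  "alt x N lam = Determinant.det (mat N N (\<lambda>(i, j). x i ^ (part lam (j + 1) + (N - 1 - j))))"

lemma alternant_eq_alt: "alternant N lam = alt Var N lam"
  by (simp add: alternant_def alt_def)

text \<open>The guard encodes the convention that \<open>h\<close> vanishes at negative
  indices.\<close>

definition jacobi_trudi :: "(nat \<Rightarrow> 'a::comm_ring_1) \<Rightarrow> nat \<Rightarrow> nat list \<Rightarrow> 'a" where
  "jacobi_trudi h N lam = Determinant.det (mat N N (\<lambda>(r, j).
     if j \<le> part lam (j + 1) + r then h (part lam (j + 1) + r - j) else 0))"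

text \<open>Generating function of the complete homogeneous symmetric polynomials. The factors
  \<open>1 / (1 - x i X)\<close> are written as geometric series, which makes sense over every
  commutative ring.\<close>

definition h_gf :: "(nat \<Rightarrow> 'a::comm_ring_1) \<Rightarrow> nat \<Rightarrow> 'a fps" where
  "h_gf x N = (\<Prod>i<N. Abs_fps (\<lambda>n. x i ^ n))"

text \<open>Generating function of the elementary symmetric polynomials with alternating
  signs.\<close>

definition e_gf :: "(nat \<Rightarrow> 'a::comm_ring_1) \<Rightarrow> nat set \<Rightarrow> 'a fps" where
  "e_gf x S = (\<Prod>i\<in>S. 1 - fps_const (x i) * fps_X)"

lemma fps_geometric: "(1 - fps_const c * fps_X) * Abs_fps (\<lambda>n. c ^ n) = (1 :: 'a::comm_ring_1 fps)"
proof (rule fps_ext)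
  fix n
  show "fps_nth ((1 - fps_const c * fps_X) * Abs_fps (\<lambda>n. c ^ n)) n = fps_nth (1 :: 'a fps) n"
    by (cases n) (simp_all add: left_diff_distrib mult.assoc fps_X_mult_nth)
qed

lemma e_gf_mult_h_gf:
  assumes "k < N"
  shows "e_gf x ({..<N} - {k}) * h_gf x N = Abs_fps (\<lambda>n. x k ^ n)"
proof -
  have "h_gf x N = Abs_fps (\<lambda>n. x k ^ n) * (\<Prod>i\<in>{..<N} - {k}. Abs_fps (\<lambda>n. x i ^ n))"
    using assms by (simp add: h_gf_def prod.remove)
  then have "e_gf x ({..<N} - {k}) * h_gf x N = Abs_fps (\<lambda>n. x k ^ n) *
      (\<Prod>i\<in>{..<N} - {k}. (1 - fps_const (x i) * fps_X) * Abs_fps (\<lambda>n. x i ^ n))"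
    by (simp add: e_gf_def prod.distrib mult_ac)
  then show ?thesis by (simp add: fps_geometric)
qed

lemma e_gf_insert_nth:
  assumes "finite S" "k \<notin> S"
  shows "fps_nth (e_gf x (insert k S)) n =
    fps_nth (e_gf x S) n - x k * (if n = 0 then 0 else fps_nth (e_gf x S) (n - 1))"
  using assms by (simp add: e_gf_def left_diff_distrib mult.assoc fps_X_mult_nth)

lemma e_gf_nth_eq_0: "finite S \<Longrightarrow> card S < n \<Longrightarrow> fps_nth (e_gf x S) n = 0"
proof (induction S arbitrary: n rule: finite_induct)
  case empty
  then show ?case by (simp add: e_gf_def)
qed (simp add: e_gf_insert_nth)

text \<open>The left side is the coefficient reversal of the product of the
  \<open>1 - x i X\<close>, evaluated at \<open>y\<close>. It serves to multiply a Vandermonde row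
  with the coefficients of \<open>e_gf\<close>.\<close>

lemma sum_e_gf:
  "finite S \<Longrightarrow> (\<Sum>r\<le>card S. fps_nth (e_gf x S) r * y ^ (card S - r)) = (\<Prod>i\<in>S. y - x i)"
proof (induction S rule: finite_induct)
  case empty
  then show ?case by (simp add: e_gf_def)
next
  case (insert k S)
  let ?e = "\<lambda>r. fps_nth (e_gf x S) r"
  have "(\<Sum>r\<le>Suc (card S). fps_nth (e_gf x (insert k S)) r * y ^ (Suc (card S) - r)) =
      (\<Sum>r\<le>Suc (card S). ?e r * y ^ (Suc (card S) - r)) -
      (\<Sum>r\<le>Suc (card S). x k * (if r = 0 then 0 else ?e (r - 1)) * y ^ (Suc (card S) - r))"
    using insert.hyps by (simp add: e_gf_insert_nth left_diff_distrib sum_subtractf)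
  also have "(\<Sum>r\<le>Suc (card S). ?e r * y ^ (Suc (card S) - r)) = y * (\<Sum>r\<le>card S. ?e r * y ^ (card S - r))"
    using insert.hyps by (simp add: e_gf_nth_eq_0 sum_distrib_left Suc_diff_le mult_ac)
  also have "(\<Sum>r\<le>Suc (card S). x k * (if r = 0 then 0 else ?e (r - 1)) * y ^ (Suc (card S) - r)) =
      x k * (\<Sum>r\<le>card S. ?e r * y ^ (card S - r))"
    by (subst sum.atMost_Suc_shift) (simp add: sum_distrib_left mult_ac)
  finally show ?case using insert by (simp add: left_diff_distrib)
qed

definition e_mat :: "(nat \<Rightarrow> 'a::comm_ring_1) \<Rightarrow> nat \<Rightarrow> 'a mat" where
  "e_mat x N = mat N N (\<lambda>(k, r). fps_nth (e_gf x ({..<N} - {k})) (N - 1 - r))"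

text \<open>The generating function \<open>1 / (1 - x\<^sub>k X)\<close> of the powers of \<open>x\<^sub>k\<close> is \<open>h_gf\<close> times
  \<open>e_gf\<close> over the other variables.\<close>

lemma alt_eq_e_mat: "alt x N lam = Determinant.det (e_mat x N) * jacobi_trudi (fps_nth (h_gf x N)) N lam"
proof -
  define M where "M = mat N N (\<lambda>(r, j). if j \<le> part lam (j + 1) + r
     then fps_nth (h_gf x N) (part lam (j + 1) + r - j) else 0)"
  have "mat N N (\<lambda>(i, j). x i ^ (part lam (j + 1) + (N - 1 - j))) = e_mat x N * M"
  proof (rule eq_matI)
    fix k j assume kj: "k < dim_row (e_mat x N * M)" "j < dim_col (e_mat x N * M)"
    then have k: "k < N" and j: "j < N" by (simp_all add: e_mat_def M_def)
    let ?a = "part lam (j + 1) + (N - 1 - j)"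
    let ?e = "\<lambda>s. fps_nth (e_gf x ({..<N} - {k})) s"
    let ?f = "\<lambda>s. if s \<le> ?a then ?e s * fps_nth (h_gf x N) (?a - s) else 0"
    have "x k ^ ?a = fps_nth (e_gf x ({..<N} - {k}) * h_gf x N) ?a"
      by (simp add: e_gf_mult_h_gf[OF k])
    also have "\<dots> = (\<Sum>s\<le>?a. ?f s)"
      by (simp add: fps_mult_nth atLeast0AtMost)
    \<comment> \<open>The range is enlarged and then cut down to \<open>{..<N}\<close>: terms with
      \<open>s > ?a\<close> vanish by the guard, those with \<open>s \<ge> N\<close> because
      \<open>e_gf\<close> over \<open>N - 1\<close> points has degree at most
      \<open>N - 1\<close>.\<close>
    also have "\<dots> = (\<Sum>s\<in>{..?a} \<union> {..<N}. ?f s)"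
      by (rule sum.mono_neutral_left) auto
    also have "\<dots> = (\<Sum>s<N. ?f s)"
      by (rule sum.mono_neutral_right) (use k in \<open>auto simp: e_gf_nth_eq_0\<close>)
    \<comment> \<open>The columns of \<open>e_mat\<close> are in reverse order of the
      coefficients.\<close>
    also have "\<dots> = (\<Sum>r<N. ?f (N - Suc r))"
      by (rule sum.nat_diff_reindex[symmetric])
    also have "\<dots> = (\<Sum>r<N. e_mat x N $$ (k, r) * M $$ (r, j))"
    proof (rule sum.cong)
      fix r assume "r \<in> {..<N}"
      then have r: "r < N" by simp
      have "N - Suc r \<le> ?a \<longleftrightarrow> j \<le> part lam (j + 1) + r" using j r by auto
      moreover have "j \<le> part lam (j + 1) + r \<Longrightarrow> ?a - (N - Suc r) = part lam (j + 1) + r - j"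
        using j r by auto
      ultimately show "?f (N - Suc r) = e_mat x N $$ (k, r) * M $$ (r, j)"
        using k j r by (simp add: e_mat_def M_def)
    qed simp
    finally show "mat N N (\<lambda>(i, j). x i ^ (part lam (j + 1) + (N - 1 - j))) $$ (k, j) =
        (e_mat x N * M) $$ (k, j)"
      using k j by (simp add: e_mat_def M_def scalar_prod_def atLeast0LessThan)
  qed (simp_all add: e_mat_def M_def)
  then show ?thesis
    unfolding alt_def jacobi_trudi_def M_def[symmetric]
    by (simp add: det_mult[of _ N] e_mat_def M_def)
qed

lemma jacobi_trudi_Nil:
  assumes "h 0 = 1"
  shows "jacobi_trudi h N [] = 1"
proof -
  let ?A = "mat N N (\<lambda>(r, j). if j \<le> part [] (j + 1) + r then h (part [] (j + 1) + r - j) else 0)"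
  have "Determinant.det ?A = prod_list (diag_mat ?A)"
    by (rule det_lower_triangular[of N]) (auto simp: part_def)
  also have "diag_mat ?A = map (\<lambda>i. 1) [0..<N]"
    using assms by (auto simp: diag_mat_def part_def)
  finally show ?thesis by (simp add: jacobi_trudi_def map_replicate_const)
qed

lemma h_gf_nth_0: "fps_nth (h_gf x N) 0 = 1"
  unfolding h_gf_def by (induction N) simp_all

text \<open>The empty partition, whose Jacobi-Trudi matrix is triangular with diagonal entries
  \<open>h 0 = 1\<close>, identifies the determinant of \<open>e_mat\<close> with the Vandermonde
  determinant without evaluating either.\<close>

lemma alt_Nil: "alt x N [] = Determinant.det (e_mat x N)"
  by (simp add: alt_eq_e_mat jacobi_trudi_Nil h_gf_nth_0)

lemma alt_eq_jacobi_trudi: "alt x N lam = jacobi_trudi (fps_nth (h_gf x N)) N lam * alt x N []"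
  by (subst alt_eq_e_mat) (simp add: alt_Nil mult.commute)

text \<open>The new column belongs to a zero part: it is 0 except for the corner entry
  \<open>h 0 = 1\<close>. This stability lets one polynomial in the power sums serve every number of
  variables.\<close>

lemma jacobi_trudi_Suc:
  assumes "h 0 = 1" "length lam \<le> N"
  shows "jacobi_trudi h (Suc N) lam = jacobi_trudi h N lam"
proof -
  let ?f = "\<lambda>(r, j). if j \<le> part lam (j + 1) + r then h (part lam (j + 1) + r - j) else 0"
  have "mat (Suc N) (Suc N) ?f = four_block_mat (mat N N ?f) (0\<^sub>m N 1)
      (mat 1 N (\<lambda>(r, j). ?f (N, j))) (1\<^sub>m 1)"
    by (rule eq_matI) (use assms in \<open>auto simp: four_block_mat_def Let_def less_Suc_eq part_def\<close>)
  then show ?thesis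
    unfolding jacobi_trudi_def
    by (simp add: det_four_block_mat_upper_right_zero_col[of _ N])
qed

lemma jacobi_trudi_stable:
  assumes "h 0 = 1" "length lam \<le> N"
  shows "jacobi_trudi h N lam = jacobi_trudi h (length lam) lam"
  using assms(2) by (induction N rule: dec_induct) (simp_all add: assms(1) jacobi_trudi_Suc)

text \<open>Logarithmic differentiation: a factor \<open>G = 1 / (1 - c X)\<close> satisfies
  \<open>G' = G * c / (1 - c X)\<close>, and the second factors add up to the power sums.\<close>

lemma fps_deriv_h_gf:
  "fps_deriv (h_gf x N) = h_gf x N * Abs_fps (\<lambda>n. \<Sum>i<N. x i ^ Suc n)"
proof (induction N)
  case 0
  then show ?case by (simp add: h_gf_def fps_zero_def[symmetric])
next
  case (Suc N)
  let ?G = "Abs_fps (\<lambda>n. x N ^ n)"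
  have "fps_deriv ?G = ?G * Abs_fps (\<lambda>n. x N ^ Suc n)"
  proof (rule fps_ext)
    fix n
    have "(\<Sum>i=0..n. x N ^ i * x N ^ Suc (n - i)) = (\<Sum>i=0..n. x N ^ Suc n)"
      by (rule sum.cong[OF refl], subst power_add[symmetric], auto)
    then show "fps_nth (fps_deriv ?G) n = fps_nth (?G * Abs_fps (\<lambda>n. x N ^ Suc n)) n"
      by (simp add: fps_mult_nth)
  qed
  moreover have "Abs_fps (\<lambda>n. \<Sum>i<Suc N. x i ^ Suc n) =
      Abs_fps (\<lambda>n. \<Sum>i<N. x i ^ Suc n) + Abs_fps (\<lambda>n. x N ^ Suc n)"
    by (rule fps_ext) simp
  moreover have "h_gf x (Suc N) = h_gf x N * ?G" by (simp add: h_gf_def)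
  ultimately show ?case using Suc.IH by (simp only: fps_deriv_mult) (simp add: algebra_simps)
qed

text \<open>Newton's identities, read off from the coefficients of the logarithmic
  derivative.\<close>

lemma newton_h_gf:
  "of_nat (Suc n) * fps_nth (h_gf x N) (Suc n) =
    (\<Sum>r<Suc n. (\<Sum>i<N. x i ^ Suc r) * fps_nth (h_gf x N) (n - r))"
proof -
  have "of_nat (Suc n) * fps_nth (h_gf x N) (Suc n) = fps_nth (fps_deriv (h_gf x N)) n"
    by simp
  also have "\<dots> = (\<Sum>r<Suc n. fps_nth (h_gf x N) r * (\<Sum>i<N. x i ^ Suc (n - r)))"
    unfolding fps_deriv_h_gf by (simp add: fps_mult_nth atLeast0AtMost lessThan_Suc_atMost)
  also have "\<dots> = (\<Sum>r<Suc n. (\<Sum>i<N. x i ^ Suc r) * fps_nth (h_gf x N) (n - r))"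
    by (subst sum.nat_diff_reindex[symmetric]) (auto intro!: sum.cong simp: mult.commute)
  finally show ?thesis .
qed

text \<open>Newton's identities solved for the complete homogeneous polynomial of degree
  \<open>n\<close>, with \<open>Var r\<close> as the power sum of index
  \<open>r + 1\<close>.\<close>

fun h_poly :: "nat \<Rightarrow> nat cpoly" where
  "h_poly 0 = 1"
| "h_poly (Suc n) = Const (1 / of_nat (Suc n)) * (\<Sum>r<Suc n. Var r * h_poly (n - r))"

lemma poly_subst_h_poly:
  "poly_subst (\<lambda>i. \<Sum>j<N. x j ^ (i + 1)) (h_poly n) = fps_nth (h_gf x N) n"
  for x :: "nat \<Rightarrow> 'w cpoly"
proof (induction n rule: less_induct)
  case (less n)
  show ?case
  proof (cases n)
    case 0
    then show ?thesis by (simp add: h_gf_nth_0)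
  next
    case (Suc k)
    have "poly_subst (\<lambda>i. \<Sum>j<N. x j ^ (i + 1)) (h_poly n) = Const (1 / of_nat (Suc k)) *
        (\<Sum>r<Suc k. (\<Sum>j<N. x j ^ Suc r) * fps_nth (h_gf x N) (k - r))"
      by (simp only: Suc h_poly.simps poly_subst_mult poly_subst_sum poly_subst_Const poly_subst_Var)
         (use less Suc in \<open>simp del: sum.lessThan_Suc\<close>)
    also have "\<dots> = Const (1 / of_nat (Suc k)) * (Const (of_nat (Suc k)) * fps_nth (h_gf x N) (Suc k))"
      by (simp only: newton_h_gf[symmetric] Const_of_nat)
    also have "\<dots> = fps_nth (h_gf x N) n"
      unfolding mult.assoc[symmetric] Const_mult[symmetric] Suc
      by (simp del: of_nat_Suc)
    finally show ?thesis .
  qed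
qed

lemma poly_subst_jacobi_trudi:
  "poly_subst \<phi> (jacobi_trudi h N lam) = jacobi_trudi (\<lambda>n. poly_subst \<phi> (h n)) N lam"
proof -
  interpret comm_ring_hom "poly_subst \<phi>"
    by unfold_locales (simp_all add: poly_subst_add poly_subst_mult)
  show ?thesis
    unfolding jacobi_trudi_def hom_det[symmetric]
    by (rule arg_cong[where f = Determinant.det]) (auto intro!: eq_matI)
qed

text \<open>The bialternant formula with its denominator cleared. The determinant of size
  \<open>length lam\<close> replaces that of size \<open>N\<close> by stability, so the polynomial
  in the power sums does not depend on \<open>N\<close>.\<close>

lemma poly_subst_jacobi_trudi_mult_alt:
  fixes x :: "nat \<Rightarrow> 'w cpoly"
  assumes "length lam \<le> N"
  shows "poly_subst (\<lambda>i. \<Sum>j<N. x j ^ (i + 1)) (jacobi_trudi h_poly (length lam) lam) * alt x N [] =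
    alt x N lam"
  using assms
  by (simp add: poly_subst_jacobi_trudi alt_eq_jacobi_trudi[of x N lam] jacobi_trudi_stable[of _ lam N] h_gf_nth_0
     poly_subst_h_poly[simplified])

lemma Var_power: "Var w ^ k = single (single w k) 1"
  by (induction k) (simp_all add: Var_def mult_single flip: single_add)

lemma prod_Var_power:
  "finite S \<Longrightarrow> (\<Prod>i\<in>S. Var (v i) ^ e i) = single (\<Sum>i\<in>S. single (v i) (e i)) 1"
proof (induction S rule: finite_induct)
  case (insert a S)
  then show ?case by (simp add: mult_single Var_power)
qed simp

lemma part_antimono: "is_partition lam \<Longrightarrow> 1 \<le> i \<Longrightarrow> i \<le> j \<Longrightarrow> part lam j \<le> part lam i"
proof -
  assume lam: "is_partition lam" and ij: "1 \<le> i" "i \<le> j"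
  show ?thesis
  proof (cases "j \<le> length lam \<and> i < j")
    case True
    then show ?thesis
      using lam ij sorted_wrt_nth_less[of "(\<ge>)" lam "i - 1" "j - 1"]
      by (auto simp: part_def is_partition_def)
  qed (use ij in \<open>auto simp: part_def\<close>)
qed

text \<open>Weakly decreasing parts plus a strictly decreasing staircase.\<close>

lemma exponent_inj:
  assumes "is_partition lam" "i < N" "j < N"
    "part lam (i + 1) + (N - 1 - i) = part lam (j + 1) + (N - 1 - j)"
  shows "i = j"
proof (rule ccontr)
  assume "i \<noteq> j"
  then consider "i < j" | "j < i" by linarith
  then show False
  proof cases
    case 1
    then show False using part_antimono[OF assms(1), of "i + 1" "j + 1"] assms by simp
  next
    case 2
    then show False using part_antimono[OF assms(1), of "j + 1" "i + 1"] assms by simp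
  qed
qed

lemma alt_Leibniz:
  "alt x N lam = (\<Sum>p | p permutes {0..<N}. of_int (sign p) *
    (\<Prod>i<N. x i ^ (part lam (p i + 1) + (N - 1 - p i))))"
  unfolding alt_def
  by (subst det_def'[of _ N])
     (auto intro!: sum.cong prod.cong simp: atLeast0LessThan permutes_in_image)

text \<open>The exponents are distinct, so in the Leibniz expansion the monomial of the identity
  permutation occurs only once, with coefficient 1.\<close>

lemma alt_Var_neq_0:
  assumes "is_partition lam" "inj v"
  shows "alt (\<lambda>i. Var (v i)) N lam \<noteq> 0"
proof -
  let ?a = "\<lambda>j. part lam (j + 1) + (N - 1 - j)"
  define m where "m p = (\<Sum>i<N. single (v i) (?a (p i)))" for p
  have lookup_m: "lookup (m p) (v i) = ?a (p i)" if "i < N" for p i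
    using that assms(2)
    by (simp add: m_def lookup_sum lookup_single when_def inj_eq)
  have m_eq: "m p = m id \<longleftrightarrow> p = id" if p: "p permutes {0..<N}" for p
  proof
    assume *: "m p = m id"
    have "p i = i" for i
    proof (cases "i < N")
      case True
      then have "p i < N" using permutes_in_image[OF p, of i] by simp
      then show ?thesis
        using lookup_m[OF True, of p] lookup_m[OF True, of id] * True
          exponent_inj[OF assms(1), of "p i" N i] by simp
    qed (use permutes_not_in[OF p] in auto)
    then show "p = id" by auto
  qed simp
  have "lookup (alt (\<lambda>i. Var (v i)) N lam) (m id) =
      (\<Sum>p | p permutes {0..<N}. of_int (sign p) * (if p = id then 1 else 0))"
    unfolding alt_Leibniz lookup_sum
  proof (rule sum.cong)
    fix p assume "p \<in> {p. p permutes {0..<N}}"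
    then have p: "p permutes {0..<N}" by simp
    have "lookup (of_int (sign p) * (\<Prod>i<N. Var (v i) ^ ?a (p i))) (m id) =
        lookup (Const (of_int (sign p)) * single (m p) 1) (m id)"
      unfolding m_def by (subst prod_Var_power) simp_all
    also have "\<dots> = of_int (sign p) * (if p = id then 1 else 0)"
      unfolding lookup_Const_mult lookup_single when_def m_eq[OF p] ..
    finally show "lookup (of_int (sign p) * (\<Prod>i<N. Var (v i) ^ ?a (p i))) (m id) =
        of_int (sign p) * (if p = id then 1 else 0)" .
  qed simp
  also have "\<dots> = (\<Sum>p | p permutes {0..<N}. if p = id then 1 else 0)"
    by (rule sum.cong) auto
  also have "\<dots> = 1" by (simp add: permutes_id finite_permutations)
  finally show ?thesis by auto
qed

lemma alternant_neq_0: "is_partition lam \<Longrightarrow> alternant N lam \<noteq> 0"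
  using alt_Var_neq_0[of lam "\<lambda>i. i" N] by (simp add: alternant_eq_alt)

lemma is_partition_Nil [simp]: "is_partition []"
  by (simp add: is_partition_def)

text \<open>The partition with \<open>N\<close> parts 1 shifts the Vandermonde exponents to
  \<open>N, ..., 1\<close>. These are the powers that occur in the Euler derivatives of the power
  sums, so this becomes the nondegeneracy of their Jacobian.\<close>

lemma vandermonde_nondegenerate:
  fixes x :: "nat \<Rightarrow> 'a::idom"
  assumes "alt x N (replicate N 1) \<noteq> 0" and "\<And>i. i < N \<Longrightarrow> (\<Sum>v<N. d v * x i ^ Suc v) = 0"
  shows "\<forall>v<N. d v = 0"
proof -
  let ?A = "mat N N (\<lambda>(i, j). x i ^ (part (replicate N 1) (j + 1) + (N - 1 - j)))"
  let ?w = "vec N (\<lambda>j. d (N - Suc j))"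
  have "?A *\<^sub>v ?w = 0\<^sub>v N"
  proof (rule eq_vecI)
    fix i assume "i < dim_vec (0\<^sub>v N)"
    then have i: "i < N" by simp
    have "(?A *\<^sub>v ?w) $ i = (\<Sum>j<N. d (N - Suc j) * x i ^ Suc (N - Suc j))"
      using i by (auto simp: scalar_prod_def part_def atLeast0LessThan mult.commute intro!: sum.cong)
    also have "\<dots> = 0"
      using assms(2)[OF i] sum.nat_diff_reindex[of "\<lambda>v. d v * x i ^ Suc v" N] by simp
    finally show "(?A *\<^sub>v ?w) $ i = 0\<^sub>v N $ i" using i by simp
  qed simp
  then have "?w \<noteq> 0\<^sub>v N \<Longrightarrow> Determinant.det ?A = 0"
    unfolding det_0_iff_vec_prod_zero[OF mat_carrier] by (intro exI[of _ ?w]) simp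
  then have "?w = 0\<^sub>v N"
    using assms(1) unfolding alt_def by blast
  then have *: "?w $ j = 0" if "j < N" for j using that by simp
  show ?thesis
  proof safe
    fix v assume "v < N"
    then show "d v = 0" using *[of "N - Suc v"] by (simp add: Suc_diff_Suc)
  qed
qed

lemma is_partition_replicate_1: "is_partition (replicate N 1)"
  by (auto simp: is_partition_def sorted_wrt_iff_nth_less)

lemma euler_Var_power: "euler i (Var j ^ k) = (if i = j then of_nat k * Var j ^ k else 0)"
  by (cases "k = 0")
    (auto simp: euler.power euler_Var mult.assoc power_minus_mult[unfolded One_nat_def])

text \<open>The derivative \<open>x d/dx\<close> of the power sum of index \<open>k\<close> is
  \<open>k x^k\<close>. The Jacobian is thus a Vandermonde matrix with columns scaled by nonzero
  integers.\<close>

lemma poly_subst_power_sum_inj: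
  assumes "\<forall>m\<in>keys f. keys m \<subseteq> {..<N}" "poly_subst (\<lambda>i. power_sum N (i + 1)) f = 0"
  shows "f = 0"
proof (rule poly_subst_inj_jacobian[where V = "{..<N}" and I = "{..<N}" and D = euler, OF _ _ _ assms])
  fix c :: "nat \<Rightarrow> nat cpoly"
  assume c: "\<And>i. i \<in> {..<N} \<Longrightarrow> (\<Sum>v<N. c v * euler i (power_sum N (v + 1))) = 0"
  have euler_p: "euler i (power_sum N k) = of_nat k * Var i ^ k" if "i < N" "0 < k" for i k
    using that by (simp add: power_sum_def euler.sum euler_Var_power)
  have "\<forall>v<N. c v * of_nat (Suc v) = 0"
  proof (rule vandermonde_nondegenerate)
    show "alt Var N (replicate N 1) \<noteq> (0 :: nat cpoly)"
      using alternant_neq_0[OF is_partition_replicate_1] by (simp add: alternant_eq_alt)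
    show "(\<Sum>v<N. c v * of_nat (Suc v) * Var i ^ Suc v) = 0" if "i < N" for i
      using c[of i] that by (simp add: euler_p mult.assoc)
  qed
  then show "\<forall>v\<in>{..<N}. c v = 0"
    by (metis lessThan_iff mult_eq_0_iff of_nat_eq_0_iff nat.distinct(1))
qed (simp_all add: euler.derivation_axioms)

text \<open>The quotient of alternants is unique because the polynomial ring is an integral domain
  and the Vandermonde determinant is nonzero.\<close>

lemma schur_x_eq:
  assumes "length lam \<le> N"
  shows "schur_x N lam =
    poly_subst (\<lambda>i. power_sum N (i + 1)) (jacobi_trudi h_poly (length lam) lam)"
proof -
  have *: "poly_subst (\<lambda>i. power_sum N (i + 1)) (jacobi_trudi h_poly (length lam) lam) *
      alternant N [] = alternant N lam"
    using poly_subst_jacobi_trudi_mult_alt[OF assms, of Var]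
    by (simp add: power_sum_def alternant_eq_alt)
  show ?thesis unfolding schur_x_def
    by (rule the_equality)
       (use * alternant_neq_0[of "[]" N] in \<open>auto simp flip: * \<close>)
qed

text \<open>Two candidates agree after substitution of power sums for every large \<open>N\<close>.
  Once \<open>N\<close> also exceeds every variable index in their difference, algebraic
  independence makes the difference 0.\<close>

lemma schur_eq_jacobi_trudi: "schur lam = jacobi_trudi h_poly (length lam) lam"
  unfolding schur_def
proof (rule the_equality)
  fix f assume f: "\<forall>N\<ge>length lam. poly_subst (\<lambda>i. power_sum N (i + 1)) f = schur_x N lam"
  define g where "g = f - jacobi_trudi h_poly (length lam) lam"
  have "finite (\<Union>m\<in>keys g. keys m)" by simp
  then obtain N where N: "(\<Union>m\<in>keys g. keys m) \<subseteq> {..<N}"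
    by (meson finite_nat_bounded)
  have "g = 0"
    by (rule poly_subst_power_sum_inj[where N = "max N (length lam)"])
       (use N f in \<open>force simp: g_def poly_subst_diff schur_x_eq\<close>)+
  then show "f = jacobi_trudi h_poly (length lam) lam" by (simp add: g_def)
qed (simp add: schur_x_eq)

lemma poly_subst_schur_mult_alt:
  fixes x :: "nat \<Rightarrow> 'w cpoly"
  assumes "length lam \<le> N"
  shows "poly_subst (\<lambda>i. \<Sum>j<N. x j ^ (i + 1)) (schur lam) * alt x N [] = alt x N lam"
  using poly_subst_jacobi_trudi_mult_alt[OF assms] by (simp only: schur_eq_jacobi_trudi)

section \<open>The logarithmic derivative of the Vandermonde determinant\<close>

lemma sum_add_lessThan: "sum f {..<N + M} = sum f {..<N} + (\<Sum>i<M. f (N + i))"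
  for f :: "nat \<Rightarrow> 'a::comm_monoid_add"
  by (induction M) (simp_all add: add.assoc)

text \<open>The product of the Vandermonde matrix and the transpose of \<open>e_mat\<close>, up to the order of the
  rows, is diagonal. The sign \<open>z\<close> does not matter for logarithmic derivatives.\<close>

lemma alt_Nil_sq:
  fixes x :: "nat \<Rightarrow> 'a::comm_ring_1"
  obtains z :: int where "of_int z * (alt x N [] * alt x N []) =
    (\<Prod>k<N. \<Prod>i\<in>{..<N} - {k}. x k - x i)"
proof -
  define V where "V = mat N N (\<lambda>(i, j). x i ^ (part [] (j + 1) + (N - 1 - j)))"
  define B where "B = mat N N (\<lambda>(r, k). fps_nth (e_gf x ({..<N} - {k})) r)"
  \<comment> \<open>Reversal of the rows, taken as an integer matrix so that its determinant is an
    integer and every derivation kills it.\<close>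
  define J where "J = mat N N (\<lambda>(r, s). if s = N - 1 - r then 1 else 0 :: int)"
  have "V * B = mat N N (\<lambda>(m, k). \<Prod>i\<in>{..<N} - {k}. x m - x i)"
  proof (rule eq_matI)
    fix m k assume "m < dim_row (mat N N (\<lambda>(m, k). \<Prod>i\<in>{..<N} - {k}. x m - x i))"
      "k < dim_col (mat N N (\<lambda>(m, k). \<Prod>i\<in>{..<N} - {k}. x m - x i))"
    then have mk: "m < N" "k < N" by simp_all
    have "card ({..<N} - {k}) = N - 1" using mk by simp
    moreover have "{..N - 1} = {..<N}" using mk by auto
    ultimately have "(\<Sum>r<N. fps_nth (e_gf x ({..<N} - {k})) r * x m ^ (N - 1 - r)) =
        (\<Prod>i\<in>{..<N} - {k}. x m - x i)"
      using sum_e_gf[of "{..<N} - {k}" x "x m"] by simp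
    then show "(V * B) $$ (m, k) = mat N N (\<lambda>(m, k). \<Prod>i\<in>{..<N} - {k}. x m - x i) $$ (m, k)"
      using mk by (simp add: V_def B_def scalar_prod_def atLeast0LessThan part_def mult.commute)
  qed (simp_all add: V_def B_def)
  also have "Determinant.det \<dots> = (\<Prod>k<N. \<Prod>i\<in>{..<N} - {k}. x k - x i)"
  proof -
    have "(\<Prod>l\<in>{..<N} - {j}. x i - x l) = 0" if "i < j" "j < N" for i j
      by (rule prod_zero) (use that in \<open>auto intro!: bexI[of _ i]\<close>)
    then show ?thesis
      by (subst det_lower_triangular[of N]) (auto simp: prod_list_diag_prod atLeast0LessThan)
  qed
  finally have "Determinant.det V * Determinant.det B = (\<Prod>k<N. \<Prod>i\<in>{..<N} - {k}. x k - x i)"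
    by (simp add: det_mult[of _ N] V_def B_def)
  moreover have "B = map_mat of_int J * transpose_mat (e_mat x N)"
  proof (rule eq_matI)
    fix r k assume rk: "r < dim_row (map_mat of_int J * transpose_mat (e_mat x N))"
      "k < dim_col (map_mat of_int J * transpose_mat (e_mat x N))"
    then have rk: "r < N" "k < N" by (simp_all add: J_def e_mat_def)
    have "(map_mat of_int J * transpose_mat (e_mat x N)) $$ (r, k) =
        (\<Sum>s<N. of_int (if s = N - 1 - r then 1 else 0) * fps_nth (e_gf x ({..<N} - {k})) (N - 1 - s))"
      using rk by (simp add: J_def e_mat_def scalar_prod_def atLeast0LessThan)
    also have "\<dots> = (\<Sum>s<N. if s = N - 1 - r then fps_nth (e_gf x ({..<N} - {k})) (N - 1 - s) else 0)"
      by (rule sum.cong) auto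
    also have "\<dots> = B $$ (r, k)" using rk by (simp add: B_def)
    finally show "B $$ (r, k) = (map_mat of_int J * transpose_mat (e_mat x N)) $$ (r, k)" ..
  qed (simp_all add: B_def J_def e_mat_def)
  then have "Determinant.det B = of_int (Determinant.det J) * Determinant.det (e_mat x N)"
    using of_int_hom.hom_det[of J, where 'a = 'a]
      det_mult[of "map_mat of_int J" N "transpose_mat (e_mat x N)"] det_transpose[of "e_mat x N" N]
    by (simp add: J_def e_mat_def)
  moreover have "Determinant.det V = alt x N []" by (simp add: V_def alt_def)
  ultimately show ?thesis using that[of "Determinant.det J"] by (simp add: alt_Nil[symmetric] mult_ac)
qed

lemma derivation_weighted_sum:
  "(\<And>i. i \<in> I \<Longrightarrow> derivation (D i)) \<Longrightarrow> derivation (\<lambda>f. \<Sum>i\<in>I. c i * D i f)"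
  by unfold_locales
     (simp_all add: derivation.add derivation.mult derivation.Const sum.distrib sum_distrib_left
       sum_distrib_right algebra_simps)

text \<open>Over all pairs, the inner sum gives the products \<open>X a * X (e - a)\<close>. The two
  end terms \<open>a = 0\<close> and \<open>a = e\<close> account for \<open>2 N X e\<close>, and
  removing the diagonal \<open>i = k\<close> subtracts \<open>(e + 1) X e\<close>.\<close>

lemma sum_pairs_powers:
  fixes x :: "nat \<Rightarrow> 'a::comm_ring_1" and N :: nat
  assumes "0 < e"
  defines "X \<equiv> \<lambda>k. \<Sum>i<N. x i ^ k"
  shows "(\<Sum>k<N. \<Sum>i\<in>{..<N} - {k}. \<Sum>a<Suc e. x k ^ a * x i ^ (e - a)) =
    (\<Sum>a\<in>{1..<e}. X a * X (e - a)) + (2 * of_nat N - 1 - of_nat e) * X e"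
proof -
  have "(\<Sum>k<N. \<Sum>i\<in>{..<N} - {k}. \<Sum>a<Suc e. x k ^ a * x i ^ (e - a)) =
      (\<Sum>k<N. (\<Sum>i<N. \<Sum>a<Suc e. x k ^ a * x i ^ (e - a)) - (\<Sum>a<Suc e. x k ^ a * x k ^ (e - a)))"
    by (simp add: sum_diff1 del: sum.lessThan_Suc)
  also have "\<dots> = (\<Sum>k<N. \<Sum>i<N. \<Sum>a<Suc e. x k ^ a * x i ^ (e - a)) -
      (\<Sum>k<N. \<Sum>a<Suc e. x k ^ e)"
    unfolding sum_subtractf
    by (intro arg_cong2[where f = minus] refl sum.cong) (simp flip: power_add)
  also have "(\<Sum>k<N. \<Sum>i<N. \<Sum>a<Suc e. x k ^ a * x i ^ (e - a)) =
      (\<Sum>k<N. \<Sum>a<Suc e. \<Sum>i<N. x k ^ a * x i ^ (e - a))"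
    by (intro sum.cong refl sum.swap)
  also have "\<dots> = (\<Sum>a<Suc e. \<Sum>k<N. \<Sum>i<N. x k ^ a * x i ^ (e - a))"
    by (rule sum.swap)
  also have "\<dots> = (\<Sum>a<Suc e. X a * X (e - a))"
    by (simp only: X_def sum_product)
  also have "\<dots> = (\<Sum>a\<in>{1..<e}. X a * X (e - a)) + 2 * of_nat N * X e"
  proof -
    have "{..<Suc e} = insert 0 (insert e {1..<e})" using assms by auto
    then show ?thesis using assms(1) by (simp add: X_def algebra_simps)
  qed
  also have "(\<Sum>k<N. \<Sum>a<Suc e. x k ^ e) = of_nat (Suc e) * X e"
    by (simp add: X_def sum_distrib_left)
  finally have *: "(\<Sum>k<N. \<Sum>i\<in>{..<N} - {k}. \<Sum>a<Suc e. x k ^ a * x i ^ (e - a)) =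
    (\<Sum>a\<in>{1..<e}. X a * X (e - a)) + 2 * of_nat N * X e - of_nat (Suc e) * X e" .
  show ?thesis unfolding * by (simp add: algebra_simps)
qed

text \<open>The derivation \<open>E\<close> sends \<open>x k\<close> to its power of exponent
  \<open>e + 1\<close>, so \<open>E (x k - x i)\<close> is divisible by \<open>x k - x i\<close>
  with quotient the sum of all \<open>x k ^ a * x i ^ (e - a)\<close>. Differentiating
  \<open>G = z A^2\<close> and cancelling \<open>z A\<close> gives the logarithmic derivative of
  \<open>A\<close>. The factor 2 comes from the square, that is, from counting ordered
  pairs.\<close>

lemma sum_power_euler_alt_Nil:
  fixes v :: "nat \<Rightarrow> nat" and N :: nat
  assumes "inj v" "0 < e"
  defines "x \<equiv> \<lambda>i. Var (v i)"
  defines "X \<equiv> \<lambda>k. \<Sum>i<N. x i ^ k"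
  shows "2 * (\<Sum>l<N. x l ^ e * euler (v l) (alt x N [])) =
    ((\<Sum>a\<in>{1..<e}. X a * X (e - a)) + (2 * of_nat N - 1 - of_nat e) * X e) * alt x N []"
proof -
  define E where "E f = (\<Sum>l<N. x l ^ e * euler (v l) f)" for f
  interpret E: derivation E
    unfolding E_def by (rule derivation_weighted_sum) (rule euler.derivation_axioms)
  define P where "P = (SIGMA k:{..<N}. {..<N} - {k})"
  define G where "G = (\<Prod>(k, i)\<in>P. x k - x i)"
  define A where "A = alt x N []"
  define R where "R = (\<Sum>(k, i)\<in>P. \<Sum>a<Suc e. x k ^ a * x i ^ (e - a))"
  have "G = (\<Prod>k<N. \<Prod>i\<in>{..<N} - {k}. x k - x i)"
    unfolding G_def P_def by (rule prod.Sigma[symmetric]) auto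
  then obtain z :: int where z: "of_int z * (A * A) = G"
    unfolding A_def using alt_Nil_sq[of x N] by metis
  have Var_neq: "x k - x i \<noteq> 0" if "k \<noteq> i" for k i
  proof -
    have "lookup (single (v k) (1::nat)) (v k) \<noteq> lookup (single (v i) 1) (v k)"
      using that assms(1) by (simp add: lookup_single inj_eq)
    then have "single (v k) (1::nat) \<noteq> single (v i) 1" by metis
    then have "lookup (x k) (single (v k) 1) \<noteq> lookup (x i) (single (v k) 1)"
      by (simp add: x_def Var_def lookup_single)
    then show ?thesis by auto
  qed
  have finP: "finite P" by (simp add: P_def)
  have "G \<noteq> 0" using finP Var_neq by (auto simp: G_def P_def)
  have Ex: "E (x k) = x k ^ Suc e" if "k < N" for k
    using that assms(1) by (simp add: E_def x_def euler_Var inj_eq if_distrib mult.commute cong: if_cong)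
  have "E G = (\<Sum>p\<in>P. E (case p of (k, i) \<Rightarrow> x k - x i) * (\<Prod>(k, i)\<in>P - {p}. x k - x i))"
    unfolding G_def by (rule E.prod[OF finP])
  also have "\<dots> = (\<Sum>p\<in>P. (case p of (k, i) \<Rightarrow> \<Sum>a<Suc e. x k ^ a * x i ^ (e - a)) * G)"
  proof (rule sum.cong)
    fix p assume p: "p \<in> P"
    obtain k i where ki: "p = (k, i)" by fastforce
    have "E (x k - x i) = x k ^ Suc e - x i ^ Suc e"
      using p by (simp add: ki P_def E.diff Ex)
    also have "\<dots> = (\<Sum>a<Suc e. x k ^ a * x i ^ (e - a)) * (x k - x i)"
      by (simp only: diff_power_eq_sum mult.commute)
    finally show "E (case p of (k, i) \<Rightarrow> x k - x i) * (\<Prod>(k, i)\<in>P - {p}. x k - x i) =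
        (case p of (k, i) \<Rightarrow> \<Sum>a<Suc e. x k ^ a * x i ^ (e - a)) * G"
      unfolding G_def using p finP by (simp add: ki prod.remove mult.assoc)
  qed simp
  also have "\<dots> = R * G" by (simp add: R_def sum_distrib_right case_prod_unfold)
  finally have "E G = R * G" .
  moreover have "E G = of_int z * (2 * A * E A)"
    by (simp add: z[symmetric] E.of_int_mult E.mult algebra_simps)
  ultimately have "of_int z * A * (2 * E A) = of_int z * A * (R * A)"
    using z by (simp add: mult_ac)
  moreover have "of_int z * A \<noteq> 0" using \<open>G \<noteq> 0\<close> z by auto
  ultimately have "2 * E A = R * A" by (metis mult_left_cancel)
  moreover have "R = (\<Sum>k<N. \<Sum>i\<in>{..<N} - {k}. \<Sum>a<Suc e. x k ^ a * x i ^ (e - a))"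
    unfolding R_def P_def by (rule sum.Sigma[symmetric]) auto
  ultimately show ?thesis
    using sum_pairs_powers[OF assms(2), of x N] by (simp add: E_def A_def X_def)
qed

lemma euler_prod_Var_power:
  fixes v :: "nat \<Rightarrow> nat"
  assumes "inj v" "l < N"
  shows "euler (v l) (\<Prod>i<N. Var (v i) ^ e i) = of_nat (e l) * (\<Prod>i<N. Var (v i) ^ e i)"
proof -
  have "lookup (\<Sum>i<N. single (v i) (e i)) (v l) = e l"
    using assms by (simp add: lookup_sum lookup_single when_def inj_eq)
  then show ?thesis
    by (simp add: prod_Var_power euler_single single_conv_Const[of _ "of_nat (e l)"])
qed

text \<open>The exponents of every monomial are a rearrangement of the numbers \<open>a j\<close>,
  so their sum and their sum of squares are the same for all permutations.\<close>

lemma sum_euler_alt: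
  fixes v :: "nat \<Rightarrow> nat" and N :: nat and lam :: "nat list"
  assumes "inj v"
  defines "a \<equiv> \<lambda>j. part lam (j + 1) + (N - 1 - j)"
  shows "(\<Sum>l<N. euler (v l) (alt (\<lambda>i. Var (v i)) N lam)) =
      of_nat (\<Sum>j<N. a j) * alt (\<lambda>i. Var (v i)) N lam"
    and "(\<Sum>l<N. euler (v l) (euler (v l) (alt (\<lambda>i. Var (v i)) N lam))) =
      of_nat (\<Sum>j<N. a j * a j) * alt (\<lambda>i. Var (v i)) N lam"
proof -
  define t where "t p = (\<Prod>i<N. Var (v i) ^ a (p i))" for p
  have alt: "alt (\<lambda>i. Var (v i)) N lam = (\<Sum>p | p permutes {0..<N}. of_int (sign p) * t p)"
    unfolding alt_Leibniz t_def a_def ..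
  have e: "euler (v l) (t p) = of_nat (a (p l)) * t p" if "l < N" for l p
    using euler_prod_Var_power[OF assms(1) that] unfolding t_def .
  have e2: "euler (v l) (euler (v l) (t p)) = of_nat (a (p l) * a (p l)) * t p" if "l < N" for l p
    using that by (simp add: e euler.of_nat_mult mult.assoc)
  have perm: "(\<Sum>l<N. f (p l)) = (\<Sum>j<N. f j)" if "p permutes {0..<N}" for p and f :: "nat \<Rightarrow> nat"
    using sum.permute[OF that, of f] by (simp add: atLeast0LessThan o_def)
  show "(\<Sum>l<N. euler (v l) (alt (\<lambda>i. Var (v i)) N lam)) =
      of_nat (\<Sum>j<N. a j) * alt (\<lambda>i. Var (v i)) N lam"
    unfolding alt euler.sum euler.of_int_mult sum_distrib_left
    by (subst sum.swap, rule sum.cong)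
       (simp_all add: e perm[of _ a, symmetric] sum_distrib_left sum_distrib_right mult_ac)
  show "(\<Sum>l<N. euler (v l) (euler (v l) (alt (\<lambda>i. Var (v i)) N lam))) =
      of_nat (\<Sum>j<N. a j * a j) * alt (\<lambda>i. Var (v i)) N lam"
    unfolding alt euler.sum euler.of_int_mult sum_distrib_left
    by (subst sum.swap, rule sum.cong)
       (simp_all add: e2 perm[of _ "\<lambda>j. a j * a j", symmetric] sum_distrib_left
         sum_distrib_right mult_ac)
qed

lemma euler_alt_0:
  assumes "w \<notin> v ` {..<N}"
  shows "euler w (alt (\<lambda>i. Var (v i)) N lam) = 0"
proof -
  have "euler w (\<Prod>i<N. Var (v i) ^ e i) = 0" for e
    unfolding euler.prod[OF finite_lessThan]
    by (rule sum.neutral) (use assms in \<open>auto simp: euler_Var_power\<close>)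
  then show ?thesis unfolding alt_Leibniz euler.sum euler.of_int_mult by simp
qed

section \<open>The Calogero--Sutherland operator\<close>

text \<open>The variables \<open>x\<^sub>i\<close> are \<open>Var i\<close> and the \<open>y\<^sub>i\<close> are \<open>Var (N + i)\<close> for \<open>i < N\<close>. The value
  of \<open>p\<^sub>k\<close> is \<open>psum N k 1\<close> and that of \<open>q\<^sub>k\<close> is \<open>psum N k (-1)\<close>.\<close>

definition psum_x :: "nat \<Rightarrow> nat \<Rightarrow> nat cpoly" where
  "psum_x N k = (\<Sum>i<N. Var i ^ k)"
definition psum_y :: "nat \<Rightarrow> nat \<Rightarrow> nat cpoly" where
  "psum_y N k = (\<Sum>i<N. Var (N + i) ^ k)"

definition psum :: "nat \<Rightarrow> nat \<Rightarrow> int \<Rightarrow> nat cpoly" where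
  "psum N k s = psum_x N k + of_int s * psum_y N k"

definition alt2 :: "nat \<Rightarrow> nat list \<Rightarrow> nat list \<Rightarrow> nat cpoly" where
  "alt2 N lam mu = alt Var N lam * alt (\<lambda>i. Var (N + i)) N mu"

text \<open>The constant makes \<open>cs_op N\<close> annihilate \<open>alt2 N [] []\<close>.\<close>

definition cs_const :: "nat \<Rightarrow> int" where
  "cs_const N = 2 * (\<Sum>j<N. int (N - 1 - j) * int (N - 1 - j) - (2 * int N - 1) * int (N - 1 - j))"

definition cs_op :: "nat \<Rightarrow> nat cpoly \<Rightarrow> nat cpoly" where
  "cs_op N g = (\<Sum>i<N + N. euler i (euler i g)) - of_int (2 * int N - 1) * (\<Sum>i<N + N. euler i g)
     - of_int (cs_const N) * g"

definition signed_euler :: "nat \<Rightarrow> nat cpoly \<Rightarrow> nat cpoly" where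
  "signed_euler N g = (\<Sum>i<N + N. (if i < N then 1 else - 1) * euler i g)"

lemma sum_euler_alt2:
  "(\<Sum>l<N. euler l (alt2 N lam mu)) = of_nat (\<Sum>j<N. part lam (j + 1) + (N - 1 - j)) * alt2 N lam mu"
  "(\<Sum>l<N. euler l (euler l (alt2 N lam mu))) =
     of_nat (\<Sum>j<N. (part lam (j + 1) + (N - 1 - j)) * (part lam (j + 1) + (N - 1 - j))) * alt2 N lam mu"
  "(\<Sum>l<N. euler (N + l) (alt2 N lam mu)) = of_nat (\<Sum>j<N. part mu (j + 1) + (N - 1 - j)) * alt2 N lam mu"
  "(\<Sum>l<N. euler (N + l) (euler (N + l) (alt2 N lam mu))) =
     of_nat (\<Sum>j<N. (part mu (j + 1) + (N - 1 - j)) * (part mu (j + 1) + (N - 1 - j))) * alt2 N lam mu"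
proof -
  let ?A = "alt Var N lam" and ?B = "alt (\<lambda>i. Var (N + i)) N mu"
  have B: "euler l ?B = 0" if "l < N" for l
    by (rule euler_alt_0) (use that in auto)
  have A: "euler (N + l) ?A = 0" for l
    using euler_alt_0[of "N + l" "\<lambda>i. i" N lam] by auto
  have inj: "inj ((+) N)" and inj0: "inj (\<lambda>i::nat. i)" by simp_all
  have 1: "euler l (alt2 N lam mu) = euler l ?A * ?B" if "l < N" for l
    using B[OF that] by (simp add: alt2_def euler.mult)
  have 2: "euler (N + l) (alt2 N lam mu) = ?A * euler (N + l) ?B" for l
    using A by (simp add: alt2_def euler.mult)
  show "(\<Sum>l<N. euler l (alt2 N lam mu)) = of_nat (\<Sum>j<N. part lam (j + 1) + (N - 1 - j)) * alt2 N lam mu"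
  proof -
    have "(\<Sum>l<N. euler l (alt2 N lam mu)) = (\<Sum>l<N. euler l ?A) * ?B"
      by (simp add: 1 sum_distrib_right)
    then show ?thesis using sum_euler_alt(1)[OF inj0, of N lam]
      by (simp only: alt2_def mult.assoc)
  qed
  show "(\<Sum>l<N. euler l (euler l (alt2 N lam mu))) =
     of_nat (\<Sum>j<N. (part lam (j + 1) + (N - 1 - j)) * (part lam (j + 1) + (N - 1 - j))) * alt2 N lam mu"
  proof -
    have "(\<Sum>l<N. euler l (euler l (alt2 N lam mu))) = (\<Sum>l<N. euler l (euler l ?A)) * ?B"
      by (simp add: 1 B euler.mult sum_distrib_right)
    then show ?thesis using sum_euler_alt(2)[OF inj0, of N lam]
      by (simp only: alt2_def mult.assoc)
  qed
  show "(\<Sum>l<N. euler (N + l) (alt2 N lam mu)) = of_nat (\<Sum>j<N. part mu (j + 1) + (N - 1 - j)) * alt2 N lam mu"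
  proof -
    have "(\<Sum>l<N. euler (N + l) (alt2 N lam mu)) = ?A * (\<Sum>l<N. euler (N + l) ?B)"
      by (simp add: 2 sum_distrib_left)
    then show ?thesis using sum_euler_alt(1)[OF inj, of N mu]
      by (simp only: alt2_def mult.left_commute)
  qed
  show "(\<Sum>l<N. euler (N + l) (euler (N + l) (alt2 N lam mu))) =
     of_nat (\<Sum>j<N. (part mu (j + 1) + (N - 1 - j)) * (part mu (j + 1) + (N - 1 - j))) * alt2 N lam mu"
  proof -
    have "(\<Sum>l<N. euler (N + l) (euler (N + l) (alt2 N lam mu))) = ?A * (\<Sum>l<N. euler (N + l) (euler (N + l) ?B))"
      by (simp add: 2 A euler.mult sum_distrib_left)
    then show ?thesis using sum_euler_alt(2)[OF inj, of N mu]
      by (simp only: alt2_def mult.left_commute)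
  qed
qed

text \<open>With \<open>d = N - 1 - j\<close> and \<open>a = l + d\<close>, where \<open>l\<close>
  is a part, \<open>a^2 - (2 N - 1) a\<close> exceeds \<open>d^2 - (2 N - 1) d\<close> by
  \<open>l (l + 2 d - 2 N + 1) = l (l - 2 (j + 1) + 1)\<close>. The coefficient
  \<open>2 N - 1\<close> is what makes the eigenvalue independent of \<open>N\<close>.\<close>

lemma cs_op_alt2:
  "cs_op N (alt2 N lam mu) = of_int (\<Sum>j<N.
     int (part lam (j + 1)) * (int (part lam (j + 1)) - 2 * int (j + 1) + 1) +
     int (part mu (j + 1)) * (int (part mu (j + 1)) - 2 * int (j + 1) + 1)) * alt2 N lam mu"
proof -
  let ?a = "\<lambda>j. int (part lam (j + 1) + (N - 1 - j))" and ?b = "\<lambda>j. int (part mu (j + 1) + (N - 1 - j))"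
  let ?d = "\<lambda>j. int (N - 1 - j)"
  have "cs_op N (alt2 N lam mu) =
      of_int ((\<Sum>j<N. ?a j * ?a j) + (\<Sum>j<N. ?b j * ?b j) - (2 * int N - 1) * ((\<Sum>j<N. ?a j) + (\<Sum>j<N. ?b j))
        - cs_const N) * alt2 N lam mu"
  proof -
    define A1 where "A1 = (\<Sum>j<N. part lam (j + 1) + (N - 1 - j))"
    define A2 where "A2 = (\<Sum>j<N. (part lam (j + 1) + (N - 1 - j)) * (part lam (j + 1) + (N - 1 - j)))"
    define B1 where "B1 = (\<Sum>j<N. part mu (j + 1) + (N - 1 - j))"
    define B2 where "B2 = (\<Sum>j<N. (part mu (j + 1) + (N - 1 - j)) * (part mu (j + 1) + (N - 1 - j)))"
    have "cs_op N (alt2 N lam mu) =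
        of_int (int A2 + int B2 - (2 * int N - 1) * (int A1 + int B1) - cs_const N) * alt2 N lam mu"
      unfolding cs_op_def sum_add_lessThan sum_euler_alt2 A1_def[symmetric] A2_def[symmetric]
        B1_def[symmetric] B2_def[symmetric]
      by (simp add: algebra_simps)
    then show ?thesis
      by (simp only: A1_def A2_def B1_def B2_def of_nat_sum of_nat_mult)
  qed
  also have "(\<Sum>j<N. ?a j * ?a j) + (\<Sum>j<N. ?b j * ?b j) - (2 * int N - 1) * ((\<Sum>j<N. ?a j) + (\<Sum>j<N. ?b j))
        - cs_const N =
      (\<Sum>j<N. ?a j * ?a j + ?b j * ?b j - (2 * int N - 1) * (?a j + ?b j) -
        2 * (?d j * ?d j - (2 * int N - 1) * ?d j))"
    unfolding cs_const_def
    by (simp only: sum.distrib[symmetric] sum_subtractf[symmetric] sum_distrib_left)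
  also have "\<dots> = (\<Sum>j<N.
     int (part lam (j + 1)) * (int (part lam (j + 1)) - 2 * int (j + 1) + 1) +
     int (part mu (j + 1)) * (int (part mu (j + 1)) - 2 * int (j + 1) + 1))"
  proof (rule sum.cong)
    fix j assume "j \<in> {..<N}"
    then have "int (N - 1 - j) = int N - 1 - int j" by auto
    then show "?a j * ?a j + ?b j * ?b j - (2 * int N - 1) * (?a j + ?b j) -
        2 * (?d j * ?d j - (2 * int N - 1) * ?d j) =
      int (part lam (j + 1)) * (int (part lam (j + 1)) - 2 * int (j + 1) + 1) +
      int (part mu (j + 1)) * (int (part mu (j + 1)) - 2 * int (j + 1) + 1)"
      unfolding of_nat_add by (simp only:) (simp add: algebra_simps)
  qed simp
  finally show ?thesis .
qed

text \<open>The staircase exponents of the two alternants cancel.\<close>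

lemma signed_euler_alt2:
  "signed_euler N (alt2 N lam mu) =
     of_int (\<Sum>j<N. int (part lam (j + 1)) - int (part mu (j + 1))) * alt2 N lam mu"
proof -
  have "signed_euler N (alt2 N lam mu) = (\<Sum>l<N. euler l (alt2 N lam mu)) - (\<Sum>l<N. euler (N + l) (alt2 N lam mu))"
    unfolding signed_euler_def sum_add_lessThan by (simp add: sum_negf)
  also have "\<dots> = of_int (\<Sum>j<N. int (part lam (j + 1)) - int (part mu (j + 1))) * alt2 N lam mu"
    unfolding sum_euler_alt2 by (simp add: sum.distrib sum_subtractf algebra_simps)
  finally show ?thesis .
qed

lemma euler_psum:
  assumes "i < N + N"
  shows "euler i (psum N k s) = of_nat k * ((if i < N then 1 else of_int s) * Var i ^ k)"
proof (cases "i < N")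
  case True
  then show ?thesis
    by (simp add: psum_def psum_x_def psum_y_def euler.add euler.sum euler.of_int_mult euler_Var_power)
next
  case False
  then obtain j where j: "i = N + j" using le_Suc_ex[of N i] by auto
  then have "(\<Sum>x<N. if i = x then of_nat k * Var x ^ k else 0) = (0 :: nat cpoly)" by auto
  with j assms show ?thesis
    by (simp add: psum_def psum_x_def psum_y_def euler.add euler.sum euler.of_int_mult euler_Var_power)
qed

lemma sum_euler_euler_psum:
  "(\<Sum>i<N + N. euler i (euler i (psum N k s))) = of_nat (k * k) * psum N k s"
proof -
  have "euler i (euler i (psum N k s)) = of_nat k * (of_nat k * ((if i < N then 1 else of_int s) * Var i ^ k))"
    if "i < N + N" for i
    using that by (simp add: euler_psum euler.of_nat_mult euler.of_int_mult euler_Var_power)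
  then show ?thesis
    unfolding psum_def psum_x_def psum_y_def
    by (simp add: sum_add_lessThan sum_distrib_left distrib_left mult_ac)
qed

lemma sum_euler_psum: "(\<Sum>i<N + N. euler i (psum N k s)) = of_nat k * psum N k s"
proof -
  have "(\<Sum>i<N + N. euler i (psum N k s)) =
      (\<Sum>i<N + N. of_nat k * ((if i < N then 1 else of_int s) * Var i ^ k))"
    by (rule sum.cong) (simp_all add: euler_psum)
  then show ?thesis
    unfolding psum_def psum_x_def psum_y_def
    by (simp add: sum_add_lessThan sum_distrib_left distrib_left mult_ac)
qed

text \<open>The algebraic form of a join: lengths add and signs multiply.\<close>

lemma sum_euler_psum_mult:
  "(\<Sum>i<N + N. euler i (psum N k s) * euler i (psum N l t)) = of_nat (k * l) * psum N (k + l) (s * t)"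
proof -
  have "(\<Sum>i<N + N. euler i (psum N k s) * euler i (psum N l t)) =
      (\<Sum>i<N + N. of_nat (k * l) * ((if i < N then 1 else of_int (s * t)) * Var i ^ (k + l)))"
    by (rule sum.cong) (simp_all add: euler_psum power_add mult_ac)
  then show ?thesis
    unfolding psum_def psum_x_def psum_y_def
    by (simp add: sum_add_lessThan sum_distrib_left distrib_left mult_ac)
qed

text \<open>The Euler derivatives of \<open>psum N k s\<close> are \<open>k\<close> times a
  \<open>k\<close>-th power, up to \<open>s\<close>. Pairing them with those of
  \<open>alt2 N [] []\<close> therefore applies the derivation of
  \<open>sum_power_euler_alt_Nil\<close> with \<open>e = k\<close> to each Vandermonde
  factor.\<close>

lemma sum_euler_alt2_Nil_psum:
  assumes "0 < k"
  shows "2 * (\<Sum>i<N + N. euler i (alt2 N [] []) * euler i (psum N k s)) =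
    alt2 N [] [] * (of_nat k * ((\<Sum>d\<in>{1..<k}. psum_x N d * psum_x N (k - d) +
       of_int s * (psum_y N d * psum_y N (k - d))) + (2 * of_nat N - 1 - of_nat k) * psum N k s))"
proof -
  let ?A = "alt Var N []" and ?B = "alt (\<lambda>i. Var (N + i)) N []"
  let ?X = "psum_x N" and ?Y = "psum_y N"
  have inj: "inj ((+) N)" by simp
  have A: "2 * (\<Sum>l<N. Var l ^ k * euler l ?A) =
      ((\<Sum>a\<in>{1..<k}. ?X a * ?X (k - a)) + (2 * of_nat N - 1 - of_nat k) * ?X k) * ?A"
    using sum_power_euler_alt_Nil[of "\<lambda>i. i" k N] assms by (simp add: psum_x_def)
  have B: "2 * (\<Sum>l<N. Var (N + l) ^ k * euler (N + l) ?B) =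
      ((\<Sum>a\<in>{1..<k}. ?Y a * ?Y (k - a)) + (2 * of_nat N - 1 - of_nat k) * ?Y k) * ?B"
    using sum_power_euler_alt_Nil[OF inj assms, of N] by (simp add: psum_y_def)
  have "(\<Sum>i<N + N. euler i (alt2 N [] []) * euler i (psum N k s)) =
      (\<Sum>i<N. euler i (alt2 N [] []) * euler i (psum N k s)) +
      (\<Sum>i<N. euler (N + i) (alt2 N [] []) * euler (N + i) (psum N k s))"
    by (rule sum_add_lessThan)
  also have "(\<Sum>i<N. euler i (alt2 N [] []) * euler i (psum N k s)) =
      of_nat k * ?B * (\<Sum>l<N. Var l ^ k * euler l ?A)"
    unfolding sum_distrib_left
  proof (rule sum.cong)
    fix i assume i: "i \<in> {..<N}"
    then have "euler i ?B = 0" by (intro euler_alt_0) auto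
    then show "euler i (alt2 N [] []) * euler i (psum N k s) = of_nat k * ?B * (Var i ^ k * euler i ?A)"
      using i by (simp add: alt2_def euler.mult euler_psum mult_ac)
  qed simp
  also have "(\<Sum>i<N. euler (N + i) (alt2 N [] []) * euler (N + i) (psum N k s)) =
      of_nat k * of_int s * ?A * (\<Sum>l<N. Var (N + l) ^ k * euler (N + l) ?B)"
    unfolding sum_distrib_left
  proof (rule sum.cong)
    fix i assume i: "i \<in> {..<N}"
    have "euler (N + i) ?A = 0" using euler_alt_0[of "N + i" "\<lambda>i. i" N "[]"] by auto
    then show "euler (N + i) (alt2 N [] []) * euler (N + i) (psum N k s) =
        of_nat k * of_int s * ?A * (Var (N + i) ^ k * euler (N + i) ?B)"
      using i by (simp add: alt2_def euler.mult euler_psum mult_ac)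
  qed simp
  finally have "2 * (\<Sum>i<N + N. euler i (alt2 N [] []) * euler i (psum N k s)) =
      of_nat k * ?B * (2 * (\<Sum>l<N. Var l ^ k * euler l ?A)) +
      of_nat k * of_int s * ?A * (2 * (\<Sum>l<N. Var (N + l) ^ k * euler (N + l) ?B))"
    by (simp add: algebra_simps)
  also have "\<dots> = alt2 N [] [] * (of_nat k * (((\<Sum>a\<in>{1..<k}. ?X a * ?X (k - a)) +
      of_int s * (\<Sum>a\<in>{1..<k}. ?Y a * ?Y (k - a))) + (2 * of_nat N - 1 - of_nat k) * psum N k s))"
    unfolding A B alt2_def psum_def by (simp add: algebra_simps)
  finally show ?thesis by (simp add: sum.distrib sum_distrib_left)
qed

text \<open>The mixed second derivatives of two factors give the first double sum, the logarithmic
  derivative of \<open>alt2 N [] []\<close> the second one; the multiples of \<open>F c\<close> cancel.\<close>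

lemma cs_op_mult_alt2:
  fixes N :: nat and s :: "'c \<Rightarrow> int"
  assumes S: "finite S" and k: "\<And>c. c \<in> S \<Longrightarrow> 0 < k c"
  defines "F \<equiv> \<lambda>c. psum N (k c) (s c)"
  shows "cs_op N (alt2 N [] [] * prod F S) = alt2 N [] [] *
    ((\<Sum>c\<in>S. \<Sum>c'\<in>S - {c}. of_nat (k c * k c') * psum N (k c + k c') (s c * s c') * prod F (S - {c} - {c'})) +
     (\<Sum>c\<in>S. of_nat (k c) * (\<Sum>d\<in>{1..<k c}. psum_x N d * psum_x N (k c - d) +
        of_int (s c) * (psum_y N d * psum_y N (k c - d))) * prod F (S - {c})))"
proof -
  let ?a = "alt2 N [] []" and ?g = "prod F S" and ?I = "{..<N + N}"
  let ?G = "\<lambda>c. prod F (S - {c})" and ?H = "\<lambda>c c'. prod F (S - {c} - {c'})"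
  let ?M = "of_int (2 * int N - 1) :: nat cpoly"
  have a0: "cs_op N ?a = 0"
    unfolding cs_op_alt2 by (simp add: part_def)
  have D: "euler i ?g = (\<Sum>c\<in>S. euler i (F c) * ?G c)" for i
    by (rule euler.prod[OF S])
  have DD: "euler i (euler i ?g) = (\<Sum>c\<in>S. euler i (euler i (F c)) * ?G c) +
      (\<Sum>c\<in>S. \<Sum>c'\<in>S - {c}. euler i (F c) * euler i (F c') * ?H c c')" for i
    unfolding D euler.sum using S
    by (simp add: euler.mult euler.prod sum.distrib sum_distrib_left mult.assoc)
  \<comment> \<open>Second-order product rule; the constant term is absorbed into
    \<open>cs_op N ?a\<close>, which is 0.\<close>
  have "cs_op N (?a * ?g) = cs_op N ?a * ?g + 2 * (\<Sum>i\<in>?I. euler i ?a * euler i ?g) +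
      ?a * ((\<Sum>i\<in>?I. euler i (euler i ?g)) - ?M * (\<Sum>i\<in>?I. euler i ?g))"
    unfolding cs_op_def
    by (simp add: euler.mult euler.add sum.distrib sum_distrib_left sum_distrib_right algebra_simps)
  also have "2 * (\<Sum>i\<in>?I. euler i ?a * euler i ?g) =
      (\<Sum>c\<in>S. 2 * (\<Sum>i\<in>?I. euler i ?a * euler i (F c)) * ?G c)"
    unfolding D sum_distrib_left sum_distrib_right
    by (subst sum.swap) (simp add: mult_ac)
  also have "(\<Sum>i\<in>?I. euler i (euler i ?g)) =
      (\<Sum>c\<in>S. (\<Sum>i\<in>?I. euler i (euler i (F c))) * ?G c) +
      (\<Sum>c\<in>S. \<Sum>c'\<in>S - {c}. (\<Sum>i\<in>?I. euler i (F c) * euler i (F c')) * ?H c c')"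
    unfolding DD sum.distrib sum_distrib_right
    by (intro arg_cong2[where f = plus]) (subst sum.swap, intro sum.cong refl sum.swap | rule sum.swap)+
  also have "(\<Sum>i\<in>?I. euler i ?g) = (\<Sum>c\<in>S. (\<Sum>i\<in>?I. euler i (F c)) * ?G c)"
    unfolding D sum_distrib_right by (rule sum.swap)
  also have "cs_op N ?a * ?g + (\<Sum>c\<in>S. 2 * (\<Sum>i\<in>?I. euler i ?a * euler i (F c)) * ?G c) +
      ?a * ((\<Sum>c\<in>S. (\<Sum>i\<in>?I. euler i (euler i (F c))) * ?G c) +
      (\<Sum>c\<in>S. \<Sum>c'\<in>S - {c}. (\<Sum>i\<in>?I. euler i (F c) * euler i (F c')) * ?H c c') -
      ?M * (\<Sum>c\<in>S. (\<Sum>i\<in>?I. euler i (F c)) * ?G c)) =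
      ?a * (\<Sum>c\<in>S. \<Sum>c'\<in>S - {c}. (\<Sum>i\<in>?I. euler i (F c) * euler i (F c')) * ?H c c') +
      (\<Sum>c\<in>S. (2 * (\<Sum>i\<in>?I. euler i ?a * euler i (F c)) +
        ?a * ((\<Sum>i\<in>?I. euler i (euler i (F c))) - ?M * (\<Sum>i\<in>?I. euler i (F c)))) * ?G c)"
    unfolding a0 by (simp add: algebra_simps sum.distrib sum_subtractf sum_distrib_left)
  \<comment> \<open>For a factor of length \<open>k\<close>, the coefficients of \<open>F c\<close>
    are \<open>k (2 N - 1 - k)\<close> from the Vandermonde determinants, \<open>k^2\<close> from
    the second derivatives and \<open>- (2 N - 1) k\<close> from the first; their sum is 0.\<close>
  also have "(\<Sum>c\<in>S. (2 * (\<Sum>i\<in>?I. euler i ?a * euler i (F c)) +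
        ?a * ((\<Sum>i\<in>?I. euler i (euler i (F c))) - ?M * (\<Sum>i\<in>?I. euler i (F c)))) * ?G c) =
     (\<Sum>c\<in>S. ?a * (of_nat (k c) * (\<Sum>d\<in>{1..<k c}. psum_x N d * psum_x N (k c - d) +
        of_int (s c) * (psum_y N d * psum_y N (k c - d))) * ?G c))"
  proof (rule sum.cong)
    fix c assume c: "c \<in> S"
    show "(2 * (\<Sum>i\<in>?I. euler i ?a * euler i (F c)) +
        ?a * ((\<Sum>i\<in>?I. euler i (euler i (F c))) - ?M * (\<Sum>i\<in>?I. euler i (F c)))) * ?G c =
      ?a * (of_nat (k c) * (\<Sum>d\<in>{1..<k c}. psum_x N d * psum_x N (k c - d) +
        of_int (s c) * (psum_y N d * psum_y N (k c - d))) * ?G c)"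
      unfolding F_def sum_euler_alt2_Nil_psum[OF k[OF c]] sum_euler_euler_psum sum_euler_psum
      by (simp add: algebra_simps)
  qed simp
  finally show ?thesis
    unfolding F_def sum_euler_psum_mult by (simp add: distrib_left sum_distrib_left)
qed

lemma signed_euler_derivation: "derivation (signed_euler N)"
  unfolding signed_euler_def by (rule derivation_weighted_sum) (rule euler.derivation_axioms)

text \<open>Exchanges the values of \<open>p_k\<close> and \<open>q_k\<close> up to the factor
  \<open>k\<close>; this factor matches the \<open>k\<close> points of a cycle at which its sign can
  be reversed.\<close>

lemma signed_euler_psum: "signed_euler N (psum N k s) = of_nat k * psum N k (- s)"
  if "s = 1 \<or> s = -1"
proof -
  have "signed_euler N (psum N k s) =
      (\<Sum>i<N + N. (if i < N then 1 else - 1) * (of_nat k * ((if i < N then 1 else of_int s) * Var i ^ k)))"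
    unfolding signed_euler_def by (rule sum.cong) (simp_all add: euler_psum)
  then show ?thesis
    using that unfolding psum_def psum_x_def psum_y_def
    by (auto simp: sum_add_lessThan sum_distrib_left sum_negf algebra_simps)
qed

lemma signed_euler_prod_psum:
  fixes N :: nat and s :: "'c \<Rightarrow> int" and k :: "'c \<Rightarrow> nat"
  assumes "finite S" "\<And>c. c \<in> S \<Longrightarrow> s c = 1 \<or> s c = -1"
  defines "F \<equiv> \<lambda>c. psum N (k c) (s c)"
  shows "signed_euler N (prod F S) = (\<Sum>c\<in>S. of_nat (k c) * psum N (k c) (- s c) * prod F (S - {c}))"
  unfolding derivation.prod[OF signed_euler_derivation assms(1)]
  by (rule sum.cong) (simp_all add: F_def signed_euler_psum assms(2))

definition ev_var :: "nat \<Rightarrow> pq_var \<Rightarrow> nat cpoly" where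
  "ev_var N v = (case v of PVar i \<Rightarrow> psum N (i + 1) 1 | QVar i \<Rightarrow> psum N (i + 1) (- 1))"

text \<open>In the Jacobian, differentiation in the \<open>x\<close> variables sees only the sum of
  the coefficients of \<open>p_k\<close> and \<open>q_k\<close>, and in the \<open>y\<close>
  variables only their difference. Each half is a Vandermonde system.\<close>

lemma poly_subst_ev_var_inj:
  assumes "\<forall>m\<in>keys f. keys m \<subseteq> PVar ` {..<N} \<union> QVar ` {..<N}" "poly_subst (ev_var N) f = 0"
  shows "f = 0"
proof (rule poly_subst_inj_jacobian[where I = "{..<N + N}" and D = euler, OF _ _ _ assms])
  fix c :: "pq_var \<Rightarrow> nat cpoly"
  assume c: "\<And>i. i \<in> {..<N + N} \<Longrightarrow>
    (\<Sum>v\<in>PVar ` {..<N} \<union> QVar ` {..<N}. c v * euler i (ev_var N v)) = 0"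
  have split: "(\<Sum>v\<in>PVar ` {..<N} \<union> QVar ` {..<N}. f v) = (\<Sum>i<N. f (PVar i)) + (\<Sum>i<N. f (QVar i))"
    for f :: "pq_var \<Rightarrow> nat cpoly"
    by (subst sum.union_disjoint) (auto simp: sum.reindex inj_on_def)
  have alt_neq: "alt (\<lambda>i. Var (v i)) N (replicate N 1) \<noteq> (0 :: nat cpoly)" if "inj v" for v
    by (rule alt_Var_neq_0[OF is_partition_replicate_1 that])
  have inj: "inj ((+) N)" by simp
  have plus: "\<forall>v<N. (c (PVar v) + c (QVar v)) * of_nat (Suc v) = 0"
  proof (rule vandermonde_nondegenerate)
    show "alt (\<lambda>i. Var i) N (replicate N 1) \<noteq> (0 :: nat cpoly)" by (rule alt_neq) simp
    show "(\<Sum>v<N. (c (PVar v) + c (QVar v)) * of_nat (Suc v) * Var i ^ Suc v) = 0" if "i < N" for i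
      using c[of i] that unfolding split
      by (simp add: ev_var_def euler_psum algebra_simps sum.distrib)
  qed
  have minus: "\<forall>v<N. (c (PVar v) - c (QVar v)) * of_nat (Suc v) = 0"
  proof (rule vandermonde_nondegenerate)
    show "alt (\<lambda>i. Var (N + i)) N (replicate N 1) \<noteq> (0 :: nat cpoly)" by (rule alt_neq[OF inj])
    show "(\<Sum>v<N. (c (PVar v) - c (QVar v)) * of_nat (Suc v) * Var (N + i) ^ Suc v) = 0" if "i < N" for i
      using c[of "N + i"] that unfolding split
      by (simp add: ev_var_def euler_psum algebra_simps sum.distrib sum_subtractf sum_negf)
  qed
  have "c (PVar v) = 0 \<and> c (QVar v) = 0" if "v < N" for v
  proof -
    have "of_nat (Suc v) \<noteq> (0 :: nat cpoly)" by (rule of_nat_neq_0)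
    then have eq: "c (PVar v) + c (QVar v) = 0" "c (PVar v) - c (QVar v) = 0"
      using plus minus that by (metis mult_eq_0_iff)+
    then have "2 * c (PVar v) = 0" by (simp add: algebra_simps)
    then have "c (PVar v) = 0" by (metis mult_eq_0_iff zero_neq_numeral)
    then show ?thesis using eq by simp
  qed
  then show "\<forall>v\<in>PVar ` {..<N} \<union> QVar ` {..<N}. c v = 0" by auto
qed (simp_all add: euler.derivation_axioms)

section \<open>Cutting and joining orbits\<close>

definition orbs :: "('a \<Rightarrow> 'a) \<Rightarrow> 'a set \<Rightarrow> 'a set set" where
  "orbs \<pi> A = orbit \<pi> ` A"

locale finite_perm =
  fixes A :: "'a set" and \<pi> :: "'a \<Rightarrow> 'a"
  assumes fin: "finite A" and perm: "\<pi> permutes A"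
begin

lemma permutation: "permutation \<pi>"
  using fin perm by (auto simp: permutation_permutes)

lemma self_in_orbit [simp]: "x \<in> orbit \<pi> x"
  by (rule permutation_self_in_orbit[OF permutation])

lemma orbit_eq: "y \<in> orbit \<pi> x \<Longrightarrow> orbit \<pi> y = orbit \<pi> x"
  by (rule orbit_cyclic_eq3[OF cyclic_on_orbit'[OF permutation]])

lemma orbit_subset_A: "x \<in> A \<Longrightarrow> orbit \<pi> x \<subseteq> A"
  by (rule permutes_orbit_subset[OF perm])

lemma finite_orbit [simp]: "finite (orbit \<pi> x)"
  by (rule Orbits.finite_orbit) simp

lemma finite_orbs [simp]: "finite (orbs \<pi> A)"
  using fin by (simp add: orbs_def)

lemma orbs_eq: "U \<in> orbs \<pi> A \<Longrightarrow> x \<in> U \<Longrightarrow> orbit \<pi> x = U"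
  by (auto simp: orbs_def orbit_eq)

lemma orbs_disjoint: "U \<in> orbs \<pi> A \<Longrightarrow> U' \<in> orbs \<pi> A \<Longrightarrow> U \<noteq> U' \<Longrightarrow> U \<inter> U' = {}"
  using orbs_eq by (metis disjoint_iff)

lemma Union_orbs: "\<Union> (orbs \<pi> A) = A"
  using orbit_subset_A by (force simp: orbs_def)

lemma finite_in_orbs: "U \<in> orbs \<pi> A \<Longrightarrow> finite U"
  by (auto simp: orbs_def)

lemma card_orbit_pos: "0 < card (orbit \<pi> a)"
  using card_gt_0_iff orbit_nonempty by fastforce

lemma funpow_card_orbit: "(\<pi> ^^ card (orbit \<pi> a)) a = a"
  and inj_on_funpow: "inj_on (\<lambda>m. (\<pi> ^^ m) a) {..<card (orbit \<pi> a)}"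
  and orbit_eq_funpow: "orbit \<pi> a = (\<lambda>m. (\<pi> ^^ m) a) ` {..<card (orbit \<pi> a)}"
proof -
  have inj: "inj_on (\<lambda>m. (\<pi> ^^ m) a) {0..<funpow_dist1 \<pi> a a}"
    by (rule inj_on_funpow_dist1) simp
  have img: "orbit \<pi> a = (\<lambda>m. (\<pi> ^^ m) a) ` {0..<funpow_dist1 \<pi> a a}"
    by (rule orbit_conv_funpow_dist1) simp
  have c: "card (orbit \<pi> a) = funpow_dist1 \<pi> a a"
    by (subst img, subst card_image[OF inj]) simp
  show "(\<pi> ^^ card (orbit \<pi> a)) a = a"
    unfolding c by (rule funpow_dist1_prop) simp
  show "inj_on (\<lambda>m. (\<pi> ^^ m) a) {..<card (orbit \<pi> a)}"
    using inj by (simp add: c atLeast0LessThan)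
  show "orbit \<pi> a = (\<lambda>m. (\<pi> ^^ m) a) ` {..<card (orbit \<pi> a)}"
    by (simp only: c) (rule img[unfolded atLeast0LessThan])
qed

lemma funpow_neq_self: "0 < m \<Longrightarrow> m < card (orbit \<pi> a) \<Longrightarrow> (\<pi> ^^ m) a \<noteq> a"
  using inj_on_funpow[of a] card_orbit_pos[of a] unfolding inj_on_def
  by (metis funpow_0 lessThan_iff neq0_conv)

lemma funpow_in_orbit [simp]: "(\<pi> ^^ m) a \<in> orbit \<pi> a"
  by (rule Orbits.funpow_in_orbit) simp

lemma orbit_swap_other:
  assumes "a \<notin> orbit \<pi> x" "b \<notin> orbit \<pi> x"
  shows "orbit (transpose a b \<circ> \<pi>) x = orbit \<pi> x"
proof (rule orbit_cong)
  fix s assume "s \<in> orbit \<pi> x"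
  then have "\<pi> s \<in> orbit \<pi> x" by (rule orbit.step)
  with assms show "(transpose a b \<circ> \<pi>) s = \<pi> s" by (metis comp_apply transpose_apply_other)
qed simp

lemma funpow_swap:
  assumes "\<And>j. j < m \<Longrightarrow> (\<pi> ^^ Suc j) c \<noteq> a \<and> (\<pi> ^^ Suc j) c \<noteq> b"
  shows "((transpose a b \<circ> \<pi>) ^^ m) c = (\<pi> ^^ m) c"
  using assms
proof (induction m)
  case (Suc m)
  then show ?case using Suc.prems[of m] by simp
qed simp

lemma finite_perm_swap: "a \<in> A \<Longrightarrow> b \<in> A \<Longrightarrow> finite_perm A (transpose a b \<circ> \<pi>)"
  by unfold_locales (use fin perm in \<open>auto intro: permutes_compose permutes_swap_id\<close>)

text \<open>Starting at \<open>a\<close>, the new permutation follows the old orbit up to the step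
  that used to return to \<open>a\<close> and now goes to \<open>b\<close>. The point
  \<open>a\<close> is listed apart because positive powers come back to it only after running
  through the orbit of \<open>b\<close>.\<close>

lemma orbit_join_aux:
  assumes "orbit \<pi> a \<noteq> orbit \<pi> b"
  shows "b \<in> orbit (transpose a b \<circ> \<pi>) a" "orbit \<pi> a \<subseteq> orbit (transpose a b \<circ> \<pi>) a \<union> {a}"
proof -
  let ?k = "card (orbit \<pi> a)" and ?p = "transpose a b \<circ> \<pi>"
  have b: "b \<noteq> (\<pi> ^^ j) a" for j using assms orbit_eq by (metis funpow_in_orbit)
  have *: "(?p ^^ m) a = (\<pi> ^^ m) a" if "m < ?k" for m
    by (rule funpow_swap) (use that funpow_neq_self b in \<open>metis Suc_lessI less_trans_Suc not_less_eq zero_less_Suc\<close>)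
  obtain k where k: "?k = Suc k" using card_orbit_pos[of a] gr0_conv_Suc by metis
  have "(?p ^^ ?k) a = b"
    using *[of k] funpow_card_orbit[of a] by (simp add: k)
  then have "\<exists>n. b = (?p ^^ n) a \<and> 0 < n" using card_orbit_pos[of a] by metis
  then show "b \<in> orbit ?p a" unfolding orbit_altdef by simp
  show "orbit \<pi> a \<subseteq> orbit ?p a \<union> {a}"
  proof
    fix x assume "x \<in> orbit \<pi> a"
    then obtain m where "m < ?k" "x = (\<pi> ^^ m) a" using orbit_eq_funpow[of a] by auto
    then have "x = a \<or> (\<exists>n. x = (?p ^^ n) a \<and> 0 < n)" using *[of m] by (metis funpow_0 gr0I)
    then show "x \<in> orbit ?p a \<union> {a}" unfolding orbit_altdef by auto
  qed
qed

lemma orbit_join: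
  assumes ab: "a \<in> A" "b \<in> A" "orbit \<pi> a \<noteq> orbit \<pi> b" and x: "x \<in> orbit \<pi> a \<union> orbit \<pi> b"
  shows "orbit (transpose a b \<circ> \<pi>) x = orbit \<pi> a \<union> orbit \<pi> b"
proof -
  let ?p = "transpose a b \<circ> \<pi>"
  interpret p: finite_perm A ?p by (rule finite_perm_swap[OF ab(1,2)])
  have b: "b \<in> orbit ?p a" by (rule orbit_join_aux(1)[OF ab(3)])
  then have eq: "orbit ?p b = orbit ?p a" by (rule p.orbit_eq)
  have "orbit \<pi> a \<subseteq> orbit ?p a" using orbit_join_aux(2)[OF ab(3)] p.self_in_orbit by blast
  moreover have "orbit \<pi> b \<subseteq> orbit ?p a"
    using orbit_join_aux(2)[OF ab(3)[symmetric]] p.self_in_orbit eq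
    by (metis Un_insert_right insert_absorb sup_bot.right_neutral transpose_commute)
  moreover have "orbit ?p a \<subseteq> orbit \<pi> a \<union> orbit \<pi> b"
  proof
    fix y assume "y \<in> orbit ?p a"
    then show "y \<in> orbit \<pi> a \<union> orbit \<pi> b"
      by (induction rule: orbit.induct) (auto simp: transpose_def intro: orbit.intros)
  qed
  ultimately have *: "orbit ?p a = orbit \<pi> a \<union> orbit \<pi> b" by auto
  then show ?thesis using p.orbit_eq[of x a] x by auto
qed

lemma orbs_join:
  assumes ab: "a \<in> A" "b \<in> A" "orbit \<pi> a \<noteq> orbit \<pi> b"
  shows "orbs (transpose a b \<circ> \<pi>) A =
    insert (orbit \<pi> a \<union> orbit \<pi> b) (orbs \<pi> A - {orbit \<pi> a} - {orbit \<pi> b})"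
    and "orbit \<pi> a \<union> orbit \<pi> b \<notin> orbs \<pi> A - {orbit \<pi> a} - {orbit \<pi> b}"
proof -
  let ?p = "transpose a b \<circ> \<pi>"
  have other: "orbit ?p x = orbit \<pi> x" if "x \<notin> orbit \<pi> a \<union> orbit \<pi> b" for x
    by (rule orbit_swap_other) (use that orbit_eq self_in_orbit in blast)+
  show "orbs ?p A = insert (orbit \<pi> a \<union> orbit \<pi> b) (orbs \<pi> A - {orbit \<pi> a} - {orbit \<pi> b})"
  proof (intro equalityI subsetI)
    fix U assume "U \<in> orbs ?p A"
    then obtain x where x: "x \<in> A" "U = orbit ?p x" by (auto simp: orbs_def)
    show "U \<in> insert (orbit \<pi> a \<union> orbit \<pi> b) (orbs \<pi> A - {orbit \<pi> a} - {orbit \<pi> b})"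
    proof (cases "x \<in> orbit \<pi> a \<union> orbit \<pi> b")
      case True
      then show ?thesis using orbit_join[OF ab] x by simp
    next
      case False
      then have "U = orbit \<pi> x" "U \<noteq> orbit \<pi> a" "U \<noteq> orbit \<pi> b"
        using x other self_in_orbit[of x] by auto
      then show ?thesis using x by (auto simp: orbs_def)
    qed
  next
    fix U assume U: "U \<in> insert (orbit \<pi> a \<union> orbit \<pi> b) (orbs \<pi> A - {orbit \<pi> a} - {orbit \<pi> b})"
    show "U \<in> orbs ?p A"
    proof (cases "U = orbit \<pi> a \<union> orbit \<pi> b")
      case True
      then have "U = orbit ?p a" using orbit_join[OF ab, of a] by simp
      then show ?thesis using ab by (auto simp: orbs_def)
    next
      case False
      then obtain x where x: "x \<in> A" "U = orbit \<pi> x" "U \<noteq> orbit \<pi> a" "U \<noteq> orbit \<pi> b"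
        using U by (auto simp: orbs_def)
      then have "x \<notin> orbit \<pi> a \<union> orbit \<pi> b" using orbit_eq by blast
      then have "U = orbit ?p x" using other x by simp
      then show ?thesis using x(1) unfolding orbs_def by blast
    qed
  qed
  show "orbit \<pi> a \<union> orbit \<pi> b \<notin> orbs \<pi> A - {orbit \<pi> a} - {orbit \<pi> b}"
    using orbs_eq[of "orbit \<pi> a \<union> orbit \<pi> b" a] by auto
qed

text \<open>From \<open>a\<close> the path is unchanged until the step that would enter
  \<open>b\<close>, which now closes up at \<open>a\<close>. From \<open>b\<close> it is unchanged
  until the step that would enter \<open>a\<close>, which now closes up at \<open>b\<close>.\<close>

lemma orbit_cut:
  assumes d: "0 < d" "d < card (orbit \<pi> a)" and b: "b = (\<pi> ^^ d) a"
  shows "orbit (transpose a b \<circ> \<pi>) a = (\<lambda>m. (\<pi> ^^ m) a) ` {..<d}"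
    and "orbit (transpose a b \<circ> \<pi>) b = (\<lambda>m. (\<pi> ^^ m) a) ` {d..<card (orbit \<pi> a)}"
proof -
  let ?p = "transpose a b \<circ> \<pi>" and ?k = "card (orbit \<pi> a)"
  have neq: "(\<pi> ^^ i) a \<noteq> (\<pi> ^^ j) a" if "i < ?k" "j < ?k" "i \<noteq> j" for i j
    using inj_on_funpow[of a] that by (auto simp: inj_on_def)
  have neqa: "(\<pi> ^^ i) a \<noteq> a" if "i < ?k" "0 < i" for i
    using neq[of i 0] that by simp
  have pa: "(?p ^^ m) a = (\<pi> ^^ m) a" if "m < d" for m
  proof (rule funpow_swap)
    fix j assume "j < m"
    then show "(\<pi> ^^ Suc j) a \<noteq> a \<and> (\<pi> ^^ Suc j) a \<noteq> b"
      using that d neq[of "Suc j" d] neqa[of "Suc j"] by (simp add: b)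
  qed
  obtain d' where d': "d = Suc d'" using d(1) gr0_conv_Suc by metis
  have "(?p ^^ d) a = a" using pa[of d'] by (simp add: d' b)
  then have "orbit ?p a = {(?p ^^ m) a |m. m < d}" by (rule orbit_altdef_bounded) (rule d)
  also have "\<dots> = (\<lambda>m. (?p ^^ m) a) ` {..<d}" by auto
  also have "\<dots> = (\<lambda>m. (\<pi> ^^ m) a) ` {..<d}" by (rule image_cong) (simp_all add: pa)
  finally show "orbit ?p a = (\<lambda>m. (\<pi> ^^ m) a) ` {..<d}" .
  have add: "(\<pi> ^^ m) b = (\<pi> ^^ (m + d)) a" for m by (simp add: b funpow_add)
  have pb: "(?p ^^ m) b = (\<pi> ^^ m) b" if "m < ?k - d" for m
  proof (rule funpow_swap)
    fix j assume "j < m"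
    then show "(\<pi> ^^ Suc j) b \<noteq> a \<and> (\<pi> ^^ Suc j) b \<noteq> b"
      unfolding add using that d neq[of "Suc j + d" d] neqa[of "Suc j + d"] by (simp add: b)
  qed
  obtain e where e: "?k - d = Suc e" using d by (metis Suc_diff_Suc)
  have "(\<pi> ^^ (?k - d)) b = a" unfolding add using d funpow_card_orbit[of a] by simp
  then have "(?p ^^ (?k - d)) b = b" using pb[of e] by (simp add: e)
  then have "orbit ?p b = {(?p ^^ m) b |m. m < ?k - d}"
    by (rule orbit_altdef_bounded) (use d in simp)
  also have "\<dots> = (\<lambda>m. (?p ^^ m) b) ` {..<?k - d}" by auto
  also have "\<dots> = (\<lambda>m. (\<pi> ^^ (m + d)) a) ` {..<?k - d}"
    by (rule image_cong) (simp_all add: pb add)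
  also have "\<dots> = (\<lambda>m. (\<pi> ^^ m) a) ` ((\<lambda>m. m + d) ` {0..<?k - d})"
    by (simp add: image_image atLeast0LessThan)
  also have "(\<lambda>m. m + d) ` {0..<?k - d} = {d..<?k}"
    unfolding image_add_atLeastLessThan' using d by simp
  finally show "orbit ?p b = (\<lambda>m. (\<pi> ^^ m) a) ` {d..<?k}" .
qed

lemma orbs_cut:
  assumes a: "a \<in> A" and d: "0 < d" "d < card (orbit \<pi> a)" and b: "b = (\<pi> ^^ d) a"
  defines "C \<equiv> (\<lambda>m. (\<pi> ^^ m) a) ` {..<d}" and "C' \<equiv> (\<lambda>m. (\<pi> ^^ m) a) ` {d..<card (orbit \<pi> a)}"
  shows "orbs (transpose a b \<circ> \<pi>) A = insert C (insert C' (orbs \<pi> A - {orbit \<pi> a}))"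
    and "C \<inter> C' = {}" "C \<union> C' = orbit \<pi> a" "card C = d" "card C' = card (orbit \<pi> a) - d"
    and "C \<notin> insert C' (orbs \<pi> A - {orbit \<pi> a})" "C' \<notin> orbs \<pi> A - {orbit \<pi> a}"
proof -
  let ?p = "transpose a b \<circ> \<pi>" and ?k = "card (orbit \<pi> a)" and ?f = "\<lambda>m. (\<pi> ^^ m) a"
  have bA: "b \<in> A" using a orbit_subset_A[OF a] by (auto simp: b)
  interpret p: finite_perm A ?p by (rule finite_perm_swap[OF a bA])
  have inj: "inj_on ?f {..<?k}" by (rule inj_on_funpow)
  have pa: "orbit ?p a = C" and pb: "orbit ?p b = C'"
    unfolding C_def C'_def by (rule orbit_cut[OF d b])+
  have aC: "a \<in> C" unfolding pa[symmetric] by simp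
  have bC': "b \<in> C'" unfolding pb[symmetric] by simp
  have "{..<d} \<subseteq> {..<?k}" "{d..<?k} \<subseteq> {..<?k}" "{..<d} \<inter> {d..<?k} = {}" using d by auto
  then have dj: "C \<inter> C' = {}" unfolding C_def C'_def
    by (subst inj_on_image_Int[OF inj, symmetric]) auto
  have "{..<d} \<union> {d..<?k} = {..<?k}" using d by auto
  then have un: "C \<union> C' = orbit \<pi> a" unfolding C_def C'_def image_Un[symmetric]
    using orbit_eq_funpow[of a] by simp
  show "C \<inter> C' = {}" "C \<union> C' = orbit \<pi> a" by fact+
  show "card C = d" unfolding C_def
    by (subst card_image) (use d in \<open>auto intro: inj_on_subset[OF inj]\<close>)
  show "card C' = ?k - d" unfolding C'_def
    by (subst card_image) (use d in \<open>auto intro: inj_on_subset[OF inj]\<close>)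
  show "C \<notin> insert C' (orbs \<pi> A - {orbit \<pi> a})"
    using orbs_eq[of C a] aC dj by auto
  show "C' \<notin> orbs \<pi> A - {orbit \<pi> a}"
    using orbs_eq[of C' b] orbit_eq[of b a] bC' by (auto simp: b)
  have other: "orbit ?p x = orbit \<pi> x" if "x \<notin> orbit \<pi> a" for x
  proof (rule orbit_swap_other)
    show "a \<notin> orbit \<pi> x" using that orbit_eq self_in_orbit by blast
    have "orbit \<pi> b = orbit \<pi> a" by (rule orbit_eq) (simp add: b)
    then show "b \<notin> orbit \<pi> x" using that orbit_eq self_in_orbit by metis
  qed
  show "orbs ?p A = insert C (insert C' (orbs \<pi> A - {orbit \<pi> a}))"
  proof (intro equalityI subsetI)
    fix U assume "U \<in> orbs ?p A"
    then obtain x where x: "x \<in> A" "U = orbit ?p x" by (auto simp: orbs_def)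
    show "U \<in> insert C (insert C' (orbs \<pi> A - {orbit \<pi> a}))"
    proof (cases "x \<in> orbit \<pi> a")
      case True
      then have "x \<in> orbit ?p a \<or> x \<in> orbit ?p b" using un pa pb by auto
      then show ?thesis using p.orbit_eq x pa pb by blast
    next
      case False
      then have "U = orbit \<pi> x" "U \<noteq> orbit \<pi> a"
        using x other self_in_orbit[of x] by auto
      then show ?thesis using x by (auto simp: orbs_def)
    qed
  next
    fix U assume "U \<in> insert C (insert C' (orbs \<pi> A - {orbit \<pi> a}))"
    then consider "U = C" | "U = C'" | "U \<in> orbs \<pi> A" "U \<noteq> orbit \<pi> a" by auto
    then show "U \<in> orbs ?p A"
    proof cases
      case 1
      then show ?thesis using a pa by (auto simp: orbs_def)
    next
      case 2
      then show ?thesis using bA pb by (auto simp: orbs_def)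
    next
      case 3
      then obtain x where x: "x \<in> A" "U = orbit \<pi> x" by (auto simp: orbs_def)
      then have "x \<notin> orbit \<pi> a" using 3 orbit_eq by blast
      then have "U = orbit ?p x" using other x by simp
      then show ?thesis using x(1) unfolding orbs_def by blast
    qed
  qed
qed

lemma sum_over_orbs: "(\<Sum>a\<in>A. f a) = (\<Sum>U\<in>orbs \<pi> A. \<Sum>a\<in>U. f a)"
  using sum.Union_disjoint[of "orbs \<pi> A" f] finite_in_orbs orbs_disjoint Union_orbs by simp

lemma sum_orbit_fun:
  "(\<Sum>a\<in>A. f (orbit \<pi> a)) = (\<Sum>U\<in>orbs \<pi> A. of_nat (card U) * f U)"
  for f :: "'a set \<Rightarrow> 'r::comm_ring_1"
  unfolding sum_over_orbs by (intro sum.cong refl) (simp add: orbs_eq)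

end

text \<open>The pair \<open>(\<pi>, g)\<close> stands for the signed permutation \<open>x \<mapsto> g x * \<pi> x\<close>. Composing it with
  the reflection that exchanges \<open>a\<close> with \<open>\<epsilon> b\<close> gives
  \<open>(transpose a b \<circ> \<pi>, flip \<epsilon> {a, b} \<pi> g)\<close>.\<close>

definition flip :: "int \<Rightarrow> 'a set \<Rightarrow> ('a \<Rightarrow> 'a) \<Rightarrow> ('a \<Rightarrow> int) \<Rightarrow> 'a \<Rightarrow> int" where
  "flip \<epsilon> S \<pi> g x = (if \<pi> x \<in> S then \<epsilon> * g x else g x)"

text \<open>The weight function \<open>w\<close> stays abstract because it is used twice: for the
  variables \<open>p_var\<close>, \<open>q_var\<close> themselves and for their values
  \<open>psum N\<close>.\<close>

definition orbit_weight :: "(nat \<Rightarrow> int \<Rightarrow> 'r::comm_ring_1) \<Rightarrow> ('a \<Rightarrow> int) \<Rightarrow> 'a set \<Rightarrow> 'r" where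
  "orbit_weight w g U = w (card U) (prod g U)"

lemma prod_flip_other: "(\<And>x. x \<in> C \<Longrightarrow> \<pi> x \<notin> S) \<Longrightarrow> prod (flip \<epsilon> S \<pi> g) C = prod g C"
  by (rule prod.cong) (simp_all add: flip_def)

lemma prod_flip_once:
  assumes "finite C" "x \<in> C" "\<pi> x \<in> S" "\<And>y. y \<in> C \<Longrightarrow> y \<noteq> x \<Longrightarrow> \<pi> y \<notin> S"
  shows "prod (flip \<epsilon> S \<pi> g) C = \<epsilon> * prod g C"
proof -
  have "prod (flip \<epsilon> S \<pi> g) (C - {x}) = prod g (C - {x})"
    by (rule prod_flip_other) (use assms in auto)
  then show ?thesis using assms by (simp add: prod.remove flip_def)
qed

context finite_perm
begin

lemma inj_pi: "\<pi> x = \<pi> y \<longleftrightarrow> x = y"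
  using permutes_inj[OF perm] by (auto simp: inj_def)

text \<open>Only the predecessor of \<open>a\<close> in its orbit is mapped into \<open>S\<close>,
  so exactly one sign changes.\<close>

lemma prod_flip_orbit:
  assumes "S \<inter> orbit \<pi> a = {a}"
  shows "prod (flip \<epsilon> S \<pi> g) (orbit \<pi> a) = \<epsilon> * prod g (orbit \<pi> a)"
proof -
  obtain k where k: "card (orbit \<pi> a) = Suc k" using card_orbit_pos[of a] gr0_conv_Suc by metis
  have x: "\<pi> ((\<pi> ^^ k) a) = a" using funpow_card_orbit[of a] by (simp add: k)
  show ?thesis
  proof (rule prod_flip_once[where x = "(\<pi> ^^ k) a"])
    show "\<pi> ((\<pi> ^^ k) a) \<in> S" using assms x by auto
    fix y assume y: "y \<in> orbit \<pi> a" "y \<noteq> (\<pi> ^^ k) a"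
    then have "\<pi> y \<in> orbit \<pi> a" by (auto intro: orbit.step)
    moreover have "\<pi> y \<noteq> a" using y x inj_pi by metis
    ultimately show "\<pi> y \<notin> S" using assms by auto
  qed simp_all
qed

lemma orbit_weight_flip_other:
  assumes "U \<in> orbs \<pi> A" "S \<inter> U = {}"
  shows "orbit_weight w (flip \<epsilon> S \<pi> g) U = orbit_weight w g U"
proof -
  have "\<pi> x \<notin> S" if "x \<in> U" for x
    using assms that orbs_eq[OF assms(1) that] orbit.base[of \<pi> x] by auto
  then show ?thesis by (simp add: orbit_weight_def prod_flip_other)
qed

lemma prod_weight_flip:
  assumes "a \<in> A"
  shows "prod (orbit_weight w (flip \<epsilon> {a} \<pi> g)) (orbs \<pi> A) =
    w (card (orbit \<pi> a)) (\<epsilon> * prod g (orbit \<pi> a)) * prod (orbit_weight w g) (orbs \<pi> A - {orbit \<pi> a})"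
proof -
  have "orbit \<pi> a \<in> orbs \<pi> A" using assms by (auto simp: orbs_def)
  then have "prod (orbit_weight w (flip \<epsilon> {a} \<pi> g)) (orbs \<pi> A) =
     orbit_weight w (flip \<epsilon> {a} \<pi> g) (orbit \<pi> a) *
     prod (orbit_weight w (flip \<epsilon> {a} \<pi> g)) (orbs \<pi> A - {orbit \<pi> a})"
    by (simp add: prod.remove)
  also have "orbit_weight w (flip \<epsilon> {a} \<pi> g) (orbit \<pi> a) = w (card (orbit \<pi> a)) (\<epsilon> * prod g (orbit \<pi> a))"
    by (simp add: orbit_weight_def prod_flip_orbit)
  also have "prod (orbit_weight w (flip \<epsilon> {a} \<pi> g)) (orbs \<pi> A - {orbit \<pi> a}) =
      prod (orbit_weight w g) (orbs \<pi> A - {orbit \<pi> a})"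
    by (intro prod.cong refl orbit_weight_flip_other) (auto dest: orbs_eq)
  finally show ?thesis .
qed

text \<open>Each of the two old orbits is flipped once, and the two factors
  \<open>\<epsilon>\<close> cancel. A join thus has the same weight for both values of
  \<open>\<epsilon>\<close>, the source of its factor 2.\<close>

lemma prod_weight_join:
  assumes ab: "a \<in> A" "b \<in> A" "orbit \<pi> a \<noteq> orbit \<pi> b" and \<epsilon>: "\<epsilon> * \<epsilon> = 1"
  shows "prod (orbit_weight w (flip \<epsilon> {a, b} \<pi> g)) (orbs (transpose a b \<circ> \<pi>) A) =
    w (card (orbit \<pi> a) + card (orbit \<pi> b)) (prod g (orbit \<pi> a) * prod g (orbit \<pi> b)) *
    prod (orbit_weight w g) (orbs \<pi> A - {orbit \<pi> a} - {orbit \<pi> b})"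
proof -
  let ?g = "flip \<epsilon> {a, b} \<pi> g"
  have "orbit \<pi> a \<in> orbs \<pi> A" "orbit \<pi> b \<in> orbs \<pi> A" using ab by (auto simp: orbs_def)
  then have dj: "orbit \<pi> a \<inter> orbit \<pi> b = {}" using ab(3) orbs_disjoint by auto
  then have ba: "b \<notin> orbit \<pi> a" "a \<notin> orbit \<pi> b" using self_in_orbit by blast+
  have "prod ?g (orbit \<pi> a) = \<epsilon> * prod g (orbit \<pi> a)" by (rule prod_flip_orbit) (use ba in auto)
  moreover have "prod ?g (orbit \<pi> b) = \<epsilon> * prod g (orbit \<pi> b)" by (rule prod_flip_orbit) (use ba in auto)
  ultimately have "prod ?g (orbit \<pi> a \<union> orbit \<pi> b) =
      (\<epsilon> * \<epsilon>) * (prod g (orbit \<pi> a) * prod g (orbit \<pi> b))"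
    using dj by (simp add: prod.union_disjoint)
  then have "orbit_weight w ?g (orbit \<pi> a \<union> orbit \<pi> b) =
      w (card (orbit \<pi> a) + card (orbit \<pi> b)) (prod g (orbit \<pi> a) * prod g (orbit \<pi> b))"
    using dj \<epsilon> by (simp add: orbit_weight_def card_Un_disjoint)
  moreover have "prod (orbit_weight w ?g) (orbs \<pi> A - {orbit \<pi> a} - {orbit \<pi> b}) =
      prod (orbit_weight w g) (orbs \<pi> A - {orbit \<pi> a} - {orbit \<pi> b})"
    by (intro prod.cong refl orbit_weight_flip_other) (auto dest: orbs_eq)
  ultimately show ?thesis
    using orbs_join[OF ab] by simp
qed

text \<open>Each piece is flipped exactly once. As all signs are their own inverses, the sign of the
  second piece is the total sign times that of the first.\<close>

lemma prod_weight_cut: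
  assumes a: "a \<in> A" and d: "0 < d" "d < card (orbit \<pi> a)" and b: "b = (\<pi> ^^ d) a"
    and g: "\<And>x. g x * g x = 1" and \<epsilon>: "\<epsilon> * \<epsilon> = 1"
  defines "t \<equiv> prod g ((\<lambda>m. (\<pi> ^^ m) a) ` {..<d})"
  shows "prod (orbit_weight w (flip \<epsilon> {a, b} \<pi> g)) (orbs (transpose a b \<circ> \<pi>) A) =
    w d (\<epsilon> * t) * w (card (orbit \<pi> a) - d) (prod g (orbit \<pi> a) * (\<epsilon> * t)) *
    prod (orbit_weight w g) (orbs \<pi> A - {orbit \<pi> a})"
proof -
  let ?g = "flip \<epsilon> {a, b} \<pi> g" and ?k = "card (orbit \<pi> a)"
  define C where "C = (\<lambda>m. (\<pi> ^^ m) a) ` {..<d}"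
  define C' where "C' = (\<lambda>m. (\<pi> ^^ m) a) ` {d..<?k}"
  note cut = orbs_cut[OF a d b, folded C_def C'_def]
  have inj: "inj_on (\<lambda>m. (\<pi> ^^ m) a) {..<?k}" by (rule inj_on_funpow)
  obtain d' where d': "d = Suc d'" using d(1) gr0_conv_Suc by metis
  obtain k' where k': "?k = Suc k'" using d gr0_conv_Suc by (metis less_trans)
  have pd: "\<pi> ((\<pi> ^^ d') a) = b" by (simp add: b d')
  have pk: "\<pi> ((\<pi> ^^ k') a) = a" using funpow_card_orbit[of a] by (simp add: k')
  have k'C': "(\<pi> ^^ k') a \<in> C'" and d'C: "(\<pi> ^^ d') a \<in> C"
    using d by (auto simp: C_def C'_def k' d' less_Suc_eq_le)
  have 1: "prod ?g C = \<epsilon> * prod g C"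
  proof (rule prod_flip_once[OF _ d'C])
    fix y assume "y \<in> C" "y \<noteq> (\<pi> ^^ d') a"
    then have "y \<noteq> (\<pi> ^^ k') a" using cut(2) k'C' by auto
    then show "\<pi> y \<notin> {a, b}" using \<open>y \<noteq> (\<pi> ^^ d') a\<close> pd pk inj_pi by (metis insertE singletonD)
  qed (simp_all add: C_def pd)
  have 2: "prod ?g C' = \<epsilon> * prod g C'"
  proof (rule prod_flip_once[OF _ k'C'])
    fix y assume "y \<in> C'" "y \<noteq> (\<pi> ^^ k') a"
    then have "y \<noteq> (\<pi> ^^ d') a" using cut(2) d'C by auto
    then show "\<pi> y \<notin> {a, b}" using \<open>y \<noteq> (\<pi> ^^ k') a\<close> pd pk inj_pi by (metis insertE singletonD)
  qed (simp_all add: C'_def pk)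
  have "prod g (orbit \<pi> a) = prod g C * prod g C'"
    unfolding cut(3)[symmetric] by (rule prod.union_disjoint) (use cut(2) in \<open>auto simp: C_def C'_def\<close>)
  moreover have "prod g C * prod g C = 1"
    unfolding prod.distrib[symmetric] g by simp
  ultimately have 3: "prod g (orbit \<pi> a) * (\<epsilon> * prod g C) = \<epsilon> * prod g C'"
    by (simp add: mult_ac)
  have "prod (orbit_weight w ?g) (orbs \<pi> A - {orbit \<pi> a}) =
      prod (orbit_weight w g) (orbs \<pi> A - {orbit \<pi> a})"
  proof (rule prod.cong)
    fix U assume U: "U \<in> orbs \<pi> A - {orbit \<pi> a}"
    have "orbit \<pi> b = orbit \<pi> a" by (rule orbit_eq) (simp add: b)
    then have "{a, b} \<inter> U = {}" using U orbs_eq by blast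
    then show "orbit_weight w ?g U = orbit_weight w g U" using U orbit_weight_flip_other by blast
  qed simp
  moreover have "orbit_weight w ?g C = w d (\<epsilon> * prod g C)"
    unfolding orbit_weight_def cut(4) 1 ..
  moreover have "orbit_weight w ?g C' = w (?k - d) (prod g (orbit \<pi> a) * (\<epsilon> * prod g C))"
    unfolding orbit_weight_def cut(5) 2 3 ..
  ultimately show ?thesis
    unfolding cut(1) using cut(6,7) by (simp add: t_def C_def[symmetric] mult.assoc)
qed

text \<open>Summing over \<open>\<epsilon>\<close> removes the dependence of a cut on the sign \<open>t\<close> of the first piece.\<close>

lemma sum_weight_swaps:
  fixes w :: "nat \<Rightarrow> int \<Rightarrow> 'r::comm_ring_1"
  assumes g: "\<And>x. g x = 1 \<or> g x = - 1"
  shows "(\<Sum>a\<in>A. \<Sum>b\<in>A - {a}. \<Sum>\<epsilon>\<in>{1, - 1}.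
      prod (orbit_weight w (flip \<epsilon> {a, b} \<pi> g)) (orbs (transpose a b \<circ> \<pi>) A)) =
    (\<Sum>U\<in>orbs \<pi> A. \<Sum>U'\<in>orbs \<pi> A - {U}. 2 * of_nat (card U * card U') *
       w (card U + card U') (prod g U * prod g U') * prod (orbit_weight w g) (orbs \<pi> A - {U} - {U'})) +
    (\<Sum>U\<in>orbs \<pi> A. of_nat (card U) *
       (\<Sum>d\<in>{1..<card U}. \<Sum>t\<in>{1, - 1}. w d t * w (card U - d) (prod g U * t)) *
       prod (orbit_weight w g) (orbs \<pi> A - {U}))"
proof -
  have gg: "g x * g x = 1" for x using g[of x] by auto
  have prod_g: "prod g C = 1 \<or> prod g C = - 1" for C
  proof (induction C rule: infinite_finite_induct)
    case (insert x C)
    then show ?case using g[of x] by auto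
  qed auto
  define H where "H a b = (\<Sum>\<epsilon>\<in>{1, - 1}.
      prod (orbit_weight w (flip \<epsilon> {a, b} \<pi> g)) (orbs (transpose a b \<circ> \<pi>) A))" for a b
  define J where "J U = (\<Sum>U'\<in>orbs \<pi> A - {U}. 2 * of_nat (card U') * w (card U + card U') (prod g U * prod g U') *
      prod (orbit_weight w g) (orbs \<pi> A - {U} - {U'}))" for U
  define K where "K U = (\<Sum>d\<in>{1..<card U}. \<Sum>t\<in>{1, - 1}. w d t * w (card U - d) (prod g U * t)) *
       prod (orbit_weight w g) (orbs \<pi> A - {U})" for U
  \<comment> \<open>For fixed \<open>a\<close>, a point \<open>b\<close> outside its orbit gives a
    join and a point on it gives a cut. Both totals depend only on the orbit of \<open>a\<close>,
    hence the factors \<open>card U\<close> in the end.\<close>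
  have "(\<Sum>b\<in>A - {a}. H a b) = J (orbit \<pi> a) + K (orbit \<pi> a)" if a: "a \<in> A" for a
  proof -
    let ?U = "orbit \<pi> a"
    have U: "?U \<in> orbs \<pi> A" using a by (auto simp: orbs_def)
    have "(\<Sum>b\<in>A - {a}. H a b) = (\<Sum>b\<in>A - ?U. H a b) + (\<Sum>b\<in>?U - {a}. H a b)"
    proof -
      have "A - {a} = (A - ?U) \<union> (?U - {a})" using orbit_subset_A[OF a] by auto
      moreover have "sum (H a) ((A - ?U) \<union> (?U - {a})) = (\<Sum>b\<in>A - ?U. H a b) + (\<Sum>b\<in>?U - {a}. H a b)"
        by (rule sum.union_disjoint) (use fin in auto)
      ultimately show ?thesis by simp
    qed
    also have "(\<Sum>b\<in>A - ?U. H a b) = (\<Sum>U'\<in>orbs \<pi> A - {?U}. \<Sum>b\<in>U'. H a b)"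
    proof -
      have "A - ?U = \<Union> (orbs \<pi> A - {?U})" using Union_orbs orbs_disjoint[OF _ U] by blast
      then show ?thesis
        using sum.Union_disjoint[of "orbs \<pi> A - {?U}" "H a"] finite_in_orbs orbs_disjoint by simp
    qed
    also have "\<dots> = J ?U"
      unfolding J_def
    proof (rule sum.cong)
      fix U' assume U': "U' \<in> orbs \<pi> A - {?U}"
      have "H a b = 2 * (w (card ?U + card U') (prod g ?U * prod g U') *
          prod (orbit_weight w g) (orbs \<pi> A - {?U} - {U'}))" if "b \<in> U'" for b
      proof -
        have b: "orbit \<pi> b = U'" "b \<in> A" using U' that orbs_eq Union_orbs by auto
        then have ne: "?U \<noteq> orbit \<pi> b" using U' by auto
        show ?thesis by (simp add: H_def prod_weight_join[OF a b(2) ne] b(1))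
      qed
      then show "(\<Sum>b\<in>U'. H a b) = 2 * of_nat (card U') * w (card ?U + card U') (prod g ?U * prod g U') *
          prod (orbit_weight w g) (orbs \<pi> A - {?U} - {U'})"
        by (simp add: mult_ac)
    qed simp
    also have "(\<Sum>b\<in>?U - {a}. H a b) = (\<Sum>d\<in>{1..<card ?U}. H a ((\<pi> ^^ d) a))"
    proof -
      have eq: "{..<card ?U} = insert 0 {1..<card ?U}" using card_orbit_pos[of a] by auto
      have "?U = (\<lambda>m. (\<pi> ^^ m) a) ` insert 0 {1..<card ?U}"
        by (subst orbit_eq_funpow) (simp only: eq)
      then have "?U = insert a ((\<lambda>m. (\<pi> ^^ m) a) ` {1..<card ?U})"
        by (simp only: image_insert funpow_0)
      moreover have "a \<notin> (\<lambda>m. (\<pi> ^^ m) a) ` {1..<card ?U}"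
      proof
        assume "a \<in> (\<lambda>m. (\<pi> ^^ m) a) ` {1..<card ?U}"
        then obtain m where m: "a = (\<pi> ^^ m) a" "m \<in> {1..<card ?U}" by (rule imageE)
        then show False using funpow_neq_self[of m a] m(1)[symmetric] by simp
      qed
      ultimately have "?U - {a} = (\<lambda>m. (\<pi> ^^ m) a) ` {1..<card ?U}" by blast
      moreover have "inj_on (\<lambda>m. (\<pi> ^^ m) a) {1..<card ?U}"
        by (rule inj_on_subset[OF inj_on_funpow]) auto
      ultimately show ?thesis by (simp add: sum.reindex)
    qed
    also have "\<dots> = K ?U"
      unfolding K_def sum_distrib_right
    proof (rule sum.cong)
      fix d assume "d \<in> {1..<card ?U}"
      then have d: "0 < d" "d < card ?U" by auto
      define t where "t = prod g ((\<lambda>m. (\<pi> ^^ m) a) ` {..<d})"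
      have "H a ((\<pi> ^^ d) a) = (\<Sum>\<epsilon>\<in>{1, - 1}. w d (\<epsilon> * t) * w (card ?U - d) (prod g ?U * (\<epsilon> * t)) *
          prod (orbit_weight w g) (orbs \<pi> A - {?U}))"
        unfolding H_def t_def
        by (intro sum.cong refl prod_weight_cut[OF a d refl gg]) auto
      also have "\<dots> = (\<Sum>t\<in>{1, - 1}. w d t * w (card ?U - d) (prod g ?U * t) *
          prod (orbit_weight w g) (orbs \<pi> A - {?U}))"
        using prod_g[of "(\<lambda>m. (\<pi> ^^ m) a) ` {..<d}"] by (auto simp: t_def[symmetric] add.commute)
      finally show "H a ((\<pi> ^^ d) a) = (\<Sum>t\<in>{1, - 1}. w d t * w (card ?U - d) (prod g ?U * t) *
          prod (orbit_weight w g) (orbs \<pi> A - {?U}))" .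
    qed simp
    finally show ?thesis .
  qed
  then have "(\<Sum>a\<in>A. \<Sum>b\<in>A - {a}. H a b) = (\<Sum>a\<in>A. J (orbit \<pi> a) + K (orbit \<pi> a))" by simp
  also have "\<dots> = (\<Sum>U\<in>orbs \<pi> A. of_nat (card U) * J U) + (\<Sum>U\<in>orbs \<pi> A. of_nat (card U) * K U)"
    unfolding sum.distrib sum_orbit_fun ..
  finally show ?thesis
    unfolding H_def J_def K_def by (simp add: sum_distrib_left mult_ac)
qed

lemma sum_weight_flips:
  "(\<Sum>a\<in>A. prod (orbit_weight w (flip (- 1) {a} \<pi> g)) (orbs \<pi> A)) =
   (\<Sum>U\<in>orbs \<pi> A. of_nat (card U) * (w (card U) (- prod g U) * prod (orbit_weight w g) (orbs \<pi> A - {U})))"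
  for w :: "nat \<Rightarrow> int \<Rightarrow> 'r::comm_ring_1"
proof -
  have "(\<Sum>a\<in>A. prod (orbit_weight w (flip (- 1) {a} \<pi> g)) (orbs \<pi> A)) =
      (\<Sum>a\<in>A. w (card (orbit \<pi> a)) (- prod g (orbit \<pi> a)) * prod (orbit_weight w g) (orbs \<pi> A - {orbit \<pi> a}))"
    by (intro sum.cong refl) (simp add: prod_weight_flip)
  also have "\<dots> = (\<Sum>U\<in>orbs \<pi> A. of_nat (card U) * (w (card U) (- prod g U) * prod (orbit_weight w g) (orbs \<pi> A - {U})))"
    by (rule sum_orbit_fun)
  finally show ?thesis .
qed

end

section \<open>Elements of the hyperoctahedral group as signed permutations\<close>

declare One_nat_def [simp del]

text \<open>With \<open>i + n\<close> read as \<open>- i\<close>, \<open>ab\<close> is the absolute value, and \<open>\<sigma>\<close> is the signed permutation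
  \<open>x \<mapsto> ssgn n \<sigma> x * sperm n \<sigma> x\<close> of \<open>{1..n}\<close>.\<close>

definition ab :: "nat \<Rightarrow> nat \<Rightarrow> nat" where
  "ab n y = (if y > n then y - n else y)"

definition sperm :: "nat \<Rightarrow> (nat \<Rightarrow> nat) \<Rightarrow> nat \<Rightarrow> nat" where
  "sperm n \<sigma> x = (if x \<in> {1..n} then ab n (\<sigma> x) else x)"

definition ssgn :: "nat \<Rightarrow> (nat \<Rightarrow> nat) \<Rightarrow> nat \<Rightarrow> int" where
  "ssgn n \<sigma> x = (if \<sigma> x \<le> n then 1 else - 1)"

lemma tau_tau [simp]: "tau n (tau n x) = x"
  by (auto simp: tau_def)

lemma tau_in [simp]: "tau n x \<in> {1..2*n} \<longleftrightarrow> x \<in> {1..2*n}"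
  by (auto simp: tau_def)

lemma inj_tau: "inj (tau n)"
  by (rule injI) (metis tau_tau)

lemma ab_tau [simp]: "x \<in> {1..2*n} \<Longrightarrow> ab n (tau n x) = ab n x"
  by (auto simp: tau_def ab_def)

lemma ab_in: "x \<in> {1..2*n} \<Longrightarrow> ab n x \<in> {1..n}"
  by (auto simp: ab_def)

lemma ab_small [simp]: "x \<in> {1..n} \<Longrightarrow> ab n x = x"
  by (auto simp: ab_def)

lemma ab_cases: "x \<in> {1..2*n} \<Longrightarrow> x = ab n x \<or> x = tau n (ab n x)"
  by (auto simp: ab_def tau_def)

lemma ab_eq_iff: "x \<in> {1..2*n} \<Longrightarrow> y \<in> {1..2*n} \<Longrightarrow> ab n x = ab n y \<longleftrightarrow> x = y \<or> x = tau n y"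
  by (auto simp: ab_def tau_def split: if_splits)

lemma tau_neq: "x \<in> {1..2*n} \<Longrightarrow> tau n x \<noteq> x"
  by (auto simp: tau_def)

lemma tau_small_iff: "x \<in> {1..2*n} \<Longrightarrow> tau n x \<in> {1..n} \<longleftrightarrow> x \<notin> {1..n}"
  by (auto simp: tau_def)

lemma in_double: "x \<in> {1..n} \<Longrightarrow> x \<in> {1..2*n}" for x n :: nat by auto

definition cycle_weight :: "nat \<Rightarrow> (nat \<Rightarrow> int \<Rightarrow> 'r::comm_ring_1) \<Rightarrow> (nat \<Rightarrow> nat) \<Rightarrow> 'r" where
  "cycle_weight n w \<sigma> = prod (orbit_weight w (ssgn n \<sigma>)) (orbs (sperm n \<sigma>) {1..n})"

locale hyperoct_elem =
  fixes n :: nat and \<sigma> :: "nat \<Rightarrow> nat"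
  assumes in_hyperoct: "\<sigma> \<in> hyperoct n"
begin

abbreviation "\<pi> \<equiv> sperm n \<sigma>"
abbreviation "sg \<equiv> ssgn n \<sigma>"

lemma perm_sigma: "\<sigma> permutes {1..2*n}" and sigma_tau: "\<sigma> (tau n x) = tau n (\<sigma> x)"
  using in_hyperoct by (auto simp: hyperoct_def fun_eq_iff)

lemma sigma_in [simp]: "\<sigma> x \<in> {1..2*n} \<longleftrightarrow> x \<in> {1..2*n}"
  using permutes_in_image[OF perm_sigma] .

lemma sigma_inj: "\<sigma> x = \<sigma> y \<longleftrightarrow> x = y"
  using permutes_inj[OF perm_sigma] by (auto simp: inj_def)

lemma ab_sigma: "y \<in> {1..2*n} \<Longrightarrow> ab n (\<sigma> y) = \<pi> (ab n y)"
  using ab_cases[of y n] ab_in[of y n] sigma_tau[of "ab n y"] in_double[of "ab n y" n]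
  by (metis ab_tau sigma_in sperm_def)

text \<open>If \<open>\<sigma> x\<close> and \<open>\<sigma> y\<close> have the same absolute value,
  then \<open>x = y\<close> or \<open>x = tau n y\<close>, and the latter is impossible for two
  points of \<open>{1..n}\<close>.\<close>

lemma perm_sperm: "\<pi> permutes {1..n}"
proof (rule bij_imp_permutes)
  have "inj_on \<pi> {1..n}"
  proof (rule inj_onI)
    fix x y assume x: "x \<in> {1..n}" and y: "y \<in> {1..n}" and "\<pi> x = \<pi> y"
    moreover have "\<sigma> x \<in> {1..2*n}" "\<sigma> y \<in> {1..2*n}"
      unfolding sigma_in using x y in_double by blast+
    ultimately have "\<sigma> x = \<sigma> y \<or> \<sigma> x = \<sigma> (tau n y)"
      using ab_eq_iff[of "\<sigma> x" n "\<sigma> y"] x y unfolding sperm_def sigma_tau by simp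
    then have "x = y \<or> x = tau n y" by (simp add: sigma_inj)
    then show "x = y" using x y tau_small_iff[of y n] in_double by auto
  qed
  moreover have "\<pi> ` {1..n} \<subseteq> {1..n}"
    using ab_in in_double by (auto simp: sperm_def simp del: atLeastAtMost_iff)
  ultimately show "bij_betw \<pi> {1..n} {1..n}"
    by (simp add: bij_betw_def endo_inj_surj)
qed (auto simp: sperm_def)

sublocale pi: finite_perm "{1..n}" \<pi>
  by unfold_locales (simp, rule perm_sperm)

sublocale sigma: finite_perm "{1..2*n}" \<sigma>
  by unfold_locales (simp, rule perm_sigma)

lemma funpow_sigma_in: "x \<in> {1..2*n} \<Longrightarrow> (\<sigma> ^^ m) x \<in> {1..2*n}"
  by (induction m) (simp_all del: atLeastAtMost_iff)

lemma ab_funpow: "x \<in> {1..2*n} \<Longrightarrow> ab n ((\<sigma> ^^ m) x) = (\<pi> ^^ m) (ab n x)"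
  by (induction m) (simp_all add: ab_sigma funpow_sigma_in del: atLeastAtMost_iff)

lemma sg_cases: "sg x = 1 \<or> sg x = - 1"
  by (simp add: ssgn_def)

lemma prod_sg_cases: "prod sg C = 1 \<or> prod sg C = - 1"
proof (induction C rule: infinite_finite_induct)
  case (insert x C)
  then show ?case using sg_cases[of x] by auto
qed auto

lemma sigma_small: "x \<in> {1..n} \<Longrightarrow> \<sigma> x = (if sg x = 1 then \<pi> x else tau n (\<pi> x))"
proof -
  assume x: "x \<in> {1..n}"
  then have "\<sigma> x \<in> {1..2*n}" unfolding sigma_in by (rule in_double)
  then show ?thesis using x by (auto simp: ssgn_def sperm_def tau_def ab_def simp del: sigma_in)
qed

lemma funpow_sigma_small:
  assumes "x \<in> {1..n}"
  shows "(\<sigma> ^^ m) x = (if (\<Prod>i<m. sg ((\<pi> ^^ i) x)) = 1 then (\<pi> ^^ m) x else tau n ((\<pi> ^^ m) x))"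
proof (induction m)
  case (Suc m)
  let ?p = "\<Prod>i<m. sg ((\<pi> ^^ i) x)" and ?y = "(\<pi> ^^ m) x"
  have y: "?y \<in> {1..n}" using pi.orbit_subset_A[OF assms] pi.funpow_in_orbit by blast
  have p: "?p = 1 \<or> ?p = - 1"
  proof (induction m)
    case (Suc m)
    then show ?case using sg_cases[of "(\<pi> ^^ m) x"] by auto
  qed simp
  show ?case using Suc.IH sigma_small[OF y] p sg_cases[of ?y]
    by (auto simp: sigma_tau)
qed simp

text \<open>One turn around the orbit of absolute values collects all of its signs and ends at
  \<open>x\<close> or at \<open>tau n x\<close>. This is what separates alpha-pairs from
  beta-cycles.\<close>

lemma funpow_sigma_card:
  assumes "x \<in> {1..n}"
  shows "(\<sigma> ^^ card (orbit \<pi> x)) x = (if prod sg (orbit \<pi> x) = 1 then x else tau n x)"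
proof -
  have "prod sg (orbit \<pi> x) = prod sg ((\<lambda>i. (\<pi> ^^ i) x) ` {..<card (orbit \<pi> x)})"
    by (subst pi.orbit_eq_funpow[of x]) (rule refl)
  also have "\<dots> = (\<Prod>i<card (orbit \<pi> x). sg ((\<pi> ^^ i) x))"
    by (simp add: prod.reindex[OF pi.inj_on_funpow])
  finally show ?thesis
    using funpow_sigma_small[OF assms, of "card (orbit \<pi> x)"] pi.funpow_card_orbit[of x] by simp
qed

text \<open>For an orbit \<open>U\<close> of \<open>sperm n \<sigma>\<close>, \<open>full U\<close> is an alpha-pair if the signs on \<open>U\<close> multiply to
  1, and a beta-cycle otherwise.\<close>

definition full :: "nat set \<Rightarrow> nat set" where
  "full U = U \<union> tau n ` U"

lemma full_orbit:
  assumes y: "y \<in> {1..2*n}"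
  shows "orbit \<sigma> y \<union> tau n ` orbit \<sigma> y = full (orbit \<pi> (ab n y))"
proof (intro equalityI subsetI)
  have *: "(\<sigma> ^^ m) y \<in> full (orbit \<pi> (ab n y))" for m
    using ab_cases[OF funpow_sigma_in[OF y], of m] ab_funpow[OF y, of m] pi.funpow_in_orbit[of m "ab n y"]
    by (auto simp: full_def)
  have "tau n z \<in> full U" if "z \<in> full U" for z U
    using that by (auto simp: full_def)
  moreover fix z assume "z \<in> orbit \<sigma> y \<union> tau n ` orbit \<sigma> y"
  moreover have "orbit \<sigma> y \<subseteq> full (orbit \<pi> (ab n y))"
    using * unfolding orbit_altdef_permutation[OF sigma.permutation] by auto
  ultimately show "z \<in> full (orbit \<pi> (ab n y))" by blast
next
  fix z assume "z \<in> full (orbit \<pi> (ab n y))"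
  then obtain m where m: "z = (\<pi> ^^ m) (ab n y) \<or> z = tau n ((\<pi> ^^ m) (ab n y))"
    unfolding full_def orbit_altdef_permutation[OF pi.permutation] by blast
  have "(\<sigma> ^^ m) y = (\<pi> ^^ m) (ab n y) \<or> (\<sigma> ^^ m) y = tau n ((\<pi> ^^ m) (ab n y))"
    using ab_cases[OF funpow_sigma_in[OF y], of m] ab_funpow[OF y, of m] by auto
  then have "z = (\<sigma> ^^ m) y \<or> z = tau n ((\<sigma> ^^ m) y)" using m by auto
  then show "z \<in> orbit \<sigma> y \<union> tau n ` orbit \<sigma> y" using sigma.funpow_in_orbit by blast
qed

lemma tau_orbit: "tau n ` orbit \<sigma> y = orbit \<sigma> (tau n y)"
  by (rule orbit_inverse) (simp_all add: sigma_tau)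

text \<open>With sign product -1, one turn carries a point to its image under \<open>tau n\<close>.
  With sign product 1, the cycle closes after one turn and its points have distinct absolute values,
  so it cannot contain that image.\<close>

lemma tau_orbit_eq_iff:
  assumes y: "y \<in> {1..2*n}"
  shows "tau n ` orbit \<sigma> y = orbit \<sigma> y \<longleftrightarrow> prod sg (orbit \<pi> (ab n y)) = - 1"
proof -
  have *: "tau n ` orbit \<sigma> x = orbit \<sigma> x \<longleftrightarrow> prod sg (orbit \<pi> x) = - 1" if x: "x \<in> {1..n}" for x
  proof
    assume "prod sg (orbit \<pi> x) = - 1"
    then have "(\<sigma> ^^ card (orbit \<pi> x)) x = tau n x" using funpow_sigma_card[OF x] by simp
    then have "tau n x \<in> orbit \<sigma> x" using sigma.funpow_in_orbit by metis
    then show "tau n ` orbit \<sigma> x = orbit \<sigma> x" unfolding tau_orbit by (rule sigma.orbit_eq)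
  next
    assume eq: "tau n ` orbit \<sigma> x = orbit \<sigma> x"
    show "prod sg (orbit \<pi> x) = - 1"
    proof (rule ccontr)
      let ?k = "card (orbit \<pi> x)"
      assume "prod sg (orbit \<pi> x) \<noteq> - 1"
      then have "prod sg (orbit \<pi> x) = 1" using prod_sg_cases by metis
      then have "(\<sigma> ^^ ?k) x = x" using funpow_sigma_card[OF x] by simp
      then have "orbit \<sigma> x = {(\<sigma> ^^ m) x |m. m < ?k}"
        by (rule orbit_altdef_bounded) (rule pi.card_orbit_pos)
      moreover have "tau n x \<in> orbit \<sigma> x" using eq sigma.self_in_orbit[of x] by blast
      ultimately obtain m where m: "m < ?k" "tau n x = (\<sigma> ^^ m) x" by auto
      then have "(\<pi> ^^ m) x = x" using ab_funpow[of x m] ab_tau[of x n] in_double[OF x] x by simp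
      then have "m = 0" using pi.funpow_neq_self[of m x] m by blast
      then show False using m tau_neq[OF in_double[OF x]] by simp
    qed
  qed
  have "tau n ` tau n ` S = S" for S by (simp add: image_image)
  then have "tau n ` orbit \<sigma> y = orbit \<sigma> y \<longleftrightarrow> tau n ` orbit \<sigma> (ab n y) = orbit \<sigma> (ab n y)"
    using ab_cases[OF y] tau_orbit by metis
  then show ?thesis using *[OF ab_in[OF y]] by simp
qed

lemma full_Int: "U \<in> orbs \<pi> {1..n} \<Longrightarrow> full U \<inter> {1..n} = U"
  using pi.Union_orbs by (fastforce simp: full_def tau_def)

lemma card_full:
  assumes "U \<in> orbs \<pi> {1..n}"
  shows "card (full U) = 2 * card U"
proof -
  have sub: "U \<subseteq> {1..n}" using assms pi.Union_orbs by auto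
  then have "finite U" by (rule finite_subset) simp
  moreover have "U \<inter> tau n ` U = {}" using sub by (auto simp: tau_def)
  moreover have "card (tau n ` U) = card U" by (rule card_image) (rule inj_on_subset[OF inj_tau], simp)
  ultimately show ?thesis unfolding full_def by (simp add: card_Un_disjoint)
qed

definition base :: "nat set \<Rightarrow> nat" where
  "base U = (SOME x. x \<in> U)"

lemma base_in: "U \<in> orbs \<pi> {1..n} \<Longrightarrow> base U \<in> U"
  unfolding base_def orbs_def by (rule someI_ex) (use pi.self_in_orbit in blast)

lemma base_orbit: "U \<in> orbs \<pi> {1..n} \<Longrightarrow> orbit \<pi> (base U) = U"
  using base_in pi.orbs_eq by blast

lemma base_small: "U \<in> orbs \<pi> {1..n} \<Longrightarrow> base U \<in> {1..n}"
  using base_in pi.Union_orbs by blast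

lemma full_base:
  assumes "U \<in> orbs \<pi> {1..n}"
  shows "orbit \<sigma> (base U) \<union> tau n ` orbit \<sigma> (base U) = full U"
  using full_orbit[OF in_double[OF base_small[OF assms]]] base_small[OF assms] base_orbit[OF assms] by simp

section \<open>Cycle types in terms of signed orbits\<close>

definition signed_type :: "int \<Rightarrow> nat multiset" where
  "signed_type s = image_mset card (mset_set {U \<in> orbs \<pi> {1..n}. prod sg U = s})"

lemma orbs_abI: "y \<in> {1..2*n} \<Longrightarrow> orbit \<pi> (ab n y) \<in> orbs \<pi> {1..n}"
  unfolding orbs_def using ab_in by blast

text \<open>An orbit \<open>U\<close> corresponds to the pair of cycles covering
  \<open>full U\<close>; conversely \<open>U\<close> is the part of \<open>full U\<close> in
  \<open>{1..n}\<close>. Half the number of covered points is \<open>card U\<close>.\<close>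

lemma alpha_type:
  "image_mset (\<lambda>pr. card (\<Union>pr) div 2) (mset_set (alpha_pairs n \<sigma>)) = signed_type 1"
proof -
  let ?h = "\<lambda>U. {orbit \<sigma> (base U), tau n ` orbit \<sigma> (base U)}"
  let ?P = "{U \<in> orbs \<pi> {1..n}. prod sg U = 1}"
  have Un: "\<Union> (?h U) = full U" if "U \<in> orbs \<pi> {1..n}" for U using full_base[OF that] by simp
  have inj: "inj_on ?h ?P"
  proof (rule inj_onI)
    fix U V assume "U \<in> ?P" "V \<in> ?P" "?h U = ?h V"
    then have "full U = full V" using Un by (metis (no_types, lifting) mem_Collect_eq)
    then show "U = V" using full_Int \<open>U \<in> ?P\<close> \<open>V \<in> ?P\<close> by (metis (no_types, lifting) mem_Collect_eq)
  qed
  have img: "?h ` ?P = alpha_pairs n \<sigma>"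
  proof (intro equalityI subsetI)
    fix pr assume "pr \<in> ?h ` ?P"
    then obtain U where U: "U \<in> orbs \<pi> {1..n}" "prod sg U = 1" "pr = ?h U" by auto
    have "orbit \<sigma> (base U) \<in> cycles n \<sigma>"
      unfolding cycles_def using base_small[OF U(1)] in_double by blast
    moreover have "tau n ` orbit \<sigma> (base U) \<noteq> orbit \<sigma> (base U)"
      using tau_orbit_eq_iff[OF in_double[OF base_small[OF U(1)]]] base_small[OF U(1)] base_orbit[OF U(1)] U(2)
      by simp
    ultimately show "pr \<in> alpha_pairs n \<sigma>" unfolding alpha_pairs_def U(3) by blast
  next
    fix pr assume "pr \<in> alpha_pairs n \<sigma>"
    then obtain y where y: "y \<in> {1..2*n}" "pr = {orbit \<sigma> y, tau n ` orbit \<sigma> y}"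
      "tau n ` orbit \<sigma> y \<noteq> orbit \<sigma> y"
      unfolding alpha_pairs_def cycles_def by blast
    define U where "U = orbit \<pi> (ab n y)"
    have U: "U \<in> orbs \<pi> {1..n}" unfolding U_def by (rule orbs_abI[OF y(1)])
    have "prod sg U = 1"
      using tau_orbit_eq_iff[OF y(1)] y(3) prod_sg_cases unfolding U_def by metis
    moreover have "base U \<in> orbit \<sigma> y \<union> tau n ` orbit \<sigma> y"
      unfolding full_orbit[OF y(1)] U_def[symmetric] using base_in[OF U] by (simp add: full_def)
    then have "?h U = pr"
    proof
      assume "base U \<in> orbit \<sigma> y"
      then show ?thesis using sigma.orbit_eq y(2) by simp
    next
      assume "base U \<in> tau n ` orbit \<sigma> y"
      then have "orbit \<sigma> (base U) = tau n ` orbit \<sigma> y" unfolding tau_orbit by (rule sigma.orbit_eq)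
      then show ?thesis unfolding y(2) by (auto simp: image_image)
    qed
    ultimately show "pr \<in> ?h ` ?P" using U by blast
  qed
  have "mset_set (alpha_pairs n \<sigma>) = image_mset ?h (mset_set ?P)"
    unfolding img[symmetric] by (rule image_mset_mset_set[OF inj, symmetric])
  then have "image_mset (\<lambda>pr. card (\<Union>pr) div 2) (mset_set (alpha_pairs n \<sigma>)) =
      image_mset (\<lambda>U. card (\<Union>(?h U)) div 2) (mset_set ?P)"
    by (simp add: multiset.map_comp o_def)
  also have "\<dots> = signed_type 1"
    unfolding signed_type_def by (rule image_mset_cong) (simp add: full_base card_full)
  finally show ?thesis .
qed

lemma beta_type:
  "image_mset card (mset_set (beta_cycles n \<sigma>)) = image_mset (\<lambda>m. 2 * m) (signed_type (- 1))"
proof -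
  let ?P = "{U \<in> orbs \<pi> {1..n}. prod sg U = - 1}"
  have inj: "inj_on full ?P"
  proof (rule inj_onI)
    fix U V assume "U \<in> ?P" "V \<in> ?P" "full U = full V"
    then show "U = V" using full_Int by (metis (no_types, lifting) mem_Collect_eq)
  qed
  have img: "full ` ?P = beta_cycles n \<sigma>"
  proof (intro equalityI subsetI)
    fix c assume "c \<in> full ` ?P"
    then obtain U where U: "U \<in> orbs \<pi> {1..n}" "prod sg U = - 1" "c = full U" by auto
    have *: "tau n ` orbit \<sigma> (base U) = orbit \<sigma> (base U)"
      using tau_orbit_eq_iff[OF in_double[OF base_small[OF U(1)]]] base_small[OF U(1)] base_orbit[OF U(1)] U(2)
      by simp
    then have "c = orbit \<sigma> (base U)" using full_base[OF U(1)] U(3) by simp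
    moreover have "orbit \<sigma> (base U) \<in> cycles n \<sigma>"
      unfolding cycles_def using base_small[OF U(1)] in_double by blast
    ultimately show "c \<in> beta_cycles n \<sigma>" unfolding beta_cycles_def using * by simp
  next
    fix c assume "c \<in> beta_cycles n \<sigma>"
    then obtain y where y: "y \<in> {1..2*n}" "c = orbit \<sigma> y" "tau n ` orbit \<sigma> y = orbit \<sigma> y"
      unfolding beta_cycles_def cycles_def by blast
    then have "prod sg (orbit \<pi> (ab n y)) = - 1" using tau_orbit_eq_iff[OF y(1)] by simp
    moreover have "c = full (orbit \<pi> (ab n y))" using full_orbit[OF y(1)] y by simp
    ultimately show "c \<in> full ` ?P" using orbs_abI[OF y(1)] by blast
  qed
  have "mset_set (beta_cycles n \<sigma>) = image_mset full (mset_set ?P)"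
    unfolding img[symmetric] by (rule image_mset_mset_set[OF inj, symmetric])
  then have "image_mset card (mset_set (beta_cycles n \<sigma>)) = image_mset (\<lambda>U. card (full U)) (mset_set ?P)"
    by (simp add: multiset.map_comp o_def)
  also have "\<dots> = image_mset (\<lambda>U. 2 * card U) (mset_set ?P)"
    by (rule image_mset_cong) (simp add: card_full)
  finally show ?thesis by (simp add: signed_type_def multiset.map_comp o_def)
qed

lemma bip_class_iff:
  "\<sigma> \<in> bip_class n lam mu \<longleftrightarrow> signed_type 1 = mset lam \<and> signed_type (- 1) = mset mu"
proof -
  have "inj (image_mset (\<lambda>m::nat. 2 * m))"
    by (rule multiset.inj_map) (simp add: inj_def)
  then have "image_mset (\<lambda>m. 2 * m) M = image_mset (\<lambda>m. 2 * m) M' \<longleftrightarrow> M = M'" for M M' :: "nat multiset"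
    by (auto simp: inj_def)
  then show ?thesis
    using in_hyperoct by (simp add: bip_class_def alpha_type beta_type)
qed

lemma cycle_weight_eq:
  "cycle_weight n w \<sigma> = (\<Prod>k\<in>#signed_type 1. w k 1) * (\<Prod>k\<in>#signed_type (- 1). w k (- 1))"
proof -
  let ?P = "\<lambda>s. {U \<in> orbs \<pi> {1..n}. prod sg U = s}"
  have *: "prod (orbit_weight w sg) (?P s) = (\<Prod>k\<in>#signed_type s. w k s)" for s
  proof -
    have "prod (orbit_weight w sg) (?P s) = prod (\<lambda>U. w (card U) s) (?P s)"
      by (rule prod.cong) (simp_all add: orbit_weight_def)
    also have "\<dots> = (\<Prod>k\<in>#signed_type s. w k s)"
      by (simp only: prod_unfold_prod_mset[of "\<lambda>U. w (card U) s"] signed_type_def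
          multiset.map_comp o_def)
    finally show ?thesis .
  qed
  have "orbs \<pi> {1..n} = ?P 1 \<union> ?P (- 1)" using prod_sg_cases by auto
  then have "cycle_weight n w \<sigma> = prod (orbit_weight w sg) (?P 1 \<union> ?P (- 1))" by (simp add: cycle_weight_def)
  also have "\<dots> = prod (orbit_weight w sg) (?P 1) * prod (orbit_weight w sg) (?P (- 1))"
    by (rule prod.union_disjoint) auto
  finally show ?thesis by (simp only: *)
qed

lemma sum_signed_type: "\<Sum>\<^sub># (signed_type 1) + \<Sum>\<^sub># (signed_type (- 1)) = n"
proof -
  let ?P = "\<lambda>s. {U \<in> orbs \<pi> {1..n}. prod sg U = s}"
  have "n = (\<Sum>a\<in>{1..n}. 1)" by simp
  also have "\<dots> = (\<Sum>U\<in>orbs \<pi> {1..n}. card U)" unfolding pi.sum_over_orbs by simp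
  also have "orbs \<pi> {1..n} = ?P 1 \<union> ?P (- 1)" using prod_sg_cases by auto
  also have "(\<Sum>U\<in>?P 1 \<union> ?P (- 1). card U) = (\<Sum>U\<in>?P 1. card U) + (\<Sum>U\<in>?P (- 1). card U)"
    by (rule sum.union_disjoint) auto
  finally show ?thesis by (simp add: signed_type_def sum_unfold_sum_mset)
qed

lemma zero_not_in_signed_type: "0 \<notin># signed_type s"
proof
  assume "0 \<in># signed_type s"
  then obtain U where "U \<in> orbs \<pi> {1..n}" "card U = 0"
    unfolding signed_type_def by (auto simp del: card_0_eq card_eq_0_iff)
  then show False using pi.card_orbit_pos unfolding orbs_def by (metis imageE less_irrefl)
qed

lemma in_some_bip_class:
  obtains lam mu where "is_partition lam" "is_partition mu" "sum_list lam + sum_list mu = n"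
    "\<sigma> \<in> bip_class n lam mu"
proof -
  define sh where "sh s = rev (sorted_list_of_multiset (signed_type s))" for s
  have mset: "mset (sh s) = signed_type s" for s by (simp add: sh_def)
  have "is_partition (sh s)" for s
    using zero_not_in_signed_type[of s] sorted_sorted_list_of_multiset[of "signed_type s"]
    by (simp add: is_partition_def sh_def sorted_wrt_rev)
  moreover have "sum_list (sh 1) + sum_list (sh (- 1)) = n"
    using sum_signed_type by (simp flip: mset sum_mset_sum_list)
  moreover have "\<sigma> \<in> bip_class n (sh 1) (sh (- 1))"
    by (simp add: bip_class_iff mset)
  ultimately show ?thesis using that by blast
qed

end

section \<open>Multiplication by reflections\<close>

lemma tau_eq_iff [simp]: "tau n a = tau n b \<longleftrightarrow> a = b"
  using tau_tau by metis

lemma tau_eq_swap: "tau n a = b \<longleftrightarrow> a = tau n b"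
  using tau_tau by metis

lemma tau_small:
  assumes "a \<in> {1..n}"
  shows "\<not> tau n a \<le> n" "a \<le> n" "ab n (tau n a) = a" "ab n a = a"
  using assms by (auto simp: tau_def ab_def)

lemma tau_small_neq:
  assumes "a \<in> {1..n}" "b \<in> {1..n}"
  shows "tau n a \<noteq> b" "b \<noteq> tau n a" "tau n b \<noteq> a" "a \<noteq> tau n b"
  using assms by (auto simp: tau_def)

lemma r_refl_apply:
  assumes "i \<in> {1..2*n}" "j \<in> {1..2*n}" "i \<noteq> j" "j \<noteq> tau n i"
  shows "r_refl n i j x = (if x = i then j else if x = j then i else if x = tau n i then tau n j
    else if x = tau n j then tau n i else x)"
proof -
  have "tau n i \<noteq> i" "tau n j \<noteq> j" using assms(1,2) tau_neq by blast+
  moreover have "i \<noteq> tau n j" using assms(4) tau_tau by metis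
  ultimately show ?thesis
    using assms(3,4) by (simp add: r_refl_def transpose_def tau_eq_iff)
qed

lemma l_refl_apply: "l_refl n i x = (if x = i then tau n i else if x = tau n i then i else x)"
  by (simp add: l_refl_def transpose_def)

lemma r_refl_hyperoct:
  assumes "i \<in> {1..2*n}" "j \<in> {1..2*n}" "i \<noteq> j" "j \<noteq> tau n i"
  shows "r_refl n i j \<in> hyperoct n"
proof -
  have "r_refl n i j permutes {1..2*n}"
    unfolding r_refl_def
    by (intro permutes_compose permutes_swap_id) (use assms tau_in in blast)+
  moreover have "r_refl n i j (tau n x) = tau n (r_refl n i j x)" for x
    unfolding r_refl_apply[OF assms]
    using assms(3,4) tau_neq[OF assms(1)] tau_neq[OF assms(2)]
      tau_neq[OF assms(1), symmetric] tau_neq[OF assms(2), symmetric]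
    by (simp add: tau_eq_swap)
  ultimately show ?thesis by (auto simp: hyperoct_def fun_eq_iff)
qed

lemma l_refl_hyperoct:
  assumes "i \<in> {1..2*n}"
  shows "l_refl n i \<in> hyperoct n"
proof -
  have "l_refl n i permutes {1..2*n}"
    unfolding l_refl_def by (intro permutes_swap_id) (use assms tau_in in blast)+
  moreover have "l_refl n i (tau n x) = tau n (l_refl n i x)" for x
    unfolding l_refl_apply by (simp add: tau_eq_swap)
  ultimately show ?thesis by (auto simp: hyperoct_def fun_eq_iff)
qed

lemma hyperoct_comp: "\<sigma> \<in> hyperoct n \<Longrightarrow> \<rho> \<in> hyperoct n \<Longrightarrow> \<sigma> \<circ> \<rho> \<in> hyperoct n"
  by (auto simp: hyperoct_def fun_eq_iff intro: permutes_compose)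

lemma hyperoct_id: "id \<in> hyperoct n"
  by (simp add: hyperoct_def permutes_id)

lemma hyperoct_bij: "\<sigma> \<in> hyperoct n \<Longrightarrow> bij \<sigma>"
  by (auto simp: hyperoct_def permutes_bij)

lemma hyperoct_inv:
  assumes "\<sigma> \<in> hyperoct n"
  shows "inv_into UNIV \<sigma> \<in> hyperoct n"
proof -
  have p: "\<sigma> permutes {1..2*n}" and c: "\<sigma> (tau n x) = tau n (\<sigma> x)" for x
    using assms by (auto simp: hyperoct_def fun_eq_iff)
  have "inv_into UNIV \<sigma> (tau n x) = tau n (inv_into UNIV \<sigma> x)" for x
    using c[of "inv_into UNIV \<sigma> x"] permutes_inverses[OF p] by metis
  then show ?thesis using permutes_inv[OF p] by (auto simp: hyperoct_def fun_eq_iff)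
qed

lemma finite_hyperoct: "finite (hyperoct n)"
  by (rule finite_subset[of _ "{p. p permutes {1..2*n}}"]) (auto simp: hyperoct_def finite_permutations)

text \<open>Exchanges \<open>i\<close> with \<open>\<epsilon> j\<close>, for absolute values
  \<open>i\<close>, \<open>j\<close> and a sign \<open>\<epsilon>\<close>.\<close>

definition srefl :: "nat \<Rightarrow> nat \<Rightarrow> nat \<Rightarrow> int \<Rightarrow> nat \<Rightarrow> nat" where
  "srefl n i j \<epsilon> = r_refl n i (if \<epsilon> = 1 then j else tau n j)"

lemma srefl_cond:
  assumes "i \<in> {1..n}" "j \<in> {1..n}" "i \<noteq> j"
  shows "i \<in> {1..2*n}" "(if \<epsilon> = 1 then j else tau n j) \<in> {1..2*n}"
    "i \<noteq> (if \<epsilon> = 1 then j else tau n j)" "(if \<epsilon> = 1 then j else tau n j) \<noteq> tau n i"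
  using assms by (auto simp: tau_def)

lemma srefl_apply:
  assumes "i \<in> {1..n}" "j \<in> {1..n}" "i \<noteq> j"
  shows "srefl n i j \<epsilon> x = (if \<epsilon> = 1 then
      (if x = i then j else if x = j then i else if x = tau n i then tau n j else if x = tau n j then tau n i else x)
    else (if x = i then tau n j else if x = tau n j then i else if x = tau n i then j else if x = j then tau n i else x))"
  unfolding srefl_def r_refl_apply[OF srefl_cond[OF assms]] by (simp split: if_split)

lemma srefl_hyperoct:
  assumes "i \<in> {1..n}" "j \<in> {1..n}" "i \<noteq> j"
  shows "srefl n i j \<epsilon> \<in> hyperoct n"
  unfolding srefl_def by (rule r_refl_hyperoct[OF srefl_cond[OF assms]])

lemma srefl_commute:
  assumes "i \<in> {1..n}" "j \<in> {1..n}" "i \<noteq> j"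
  shows "srefl n i j \<epsilon> = srefl n j i \<epsilon>"
  unfolding fun_eq_iff srefl_apply[OF assms] srefl_apply[OF assms(2,1) assms(3)[symmetric]]
  using assms by (auto simp: tau_def)

lemma srefl_small:
  assumes "i \<in> {1..n}" "j \<in> {1..n}" "i \<noteq> j" "a \<in> {1..n}"
  shows "srefl n i j \<epsilon> a = (if a \<in> {i, j} \<and> \<epsilon> \<noteq> 1 then tau n (transpose i j a) else transpose i j a)"
  using tau_small_neq[OF assms(4,1)] tau_small_neq[OF assms(4,2)]
  unfolding srefl_apply[OF assms(1-3)] transpose_def by (simp del: atLeastAtMost_iff)

lemma srefl_tau:
  assumes "i \<in> {1..n}" "j \<in> {1..n}" "i \<noteq> j"
  shows "srefl n i j \<epsilon> (tau n a) = tau n (srefl n i j \<epsilon> a)"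
  using srefl_hyperoct[OF assms] by (auto simp: hyperoct_def fun_eq_iff)

text \<open>Signs are compared only on \<open>{1..n}\<close>, where the orbits live: for arguments
  above \<open>n\<close> the functions \<open>ssgn\<close> and \<open>flip\<close> can
  differ.\<close>

lemma (in hyperoct_elem) cycle_weight_cong:
  assumes "\<And>x. x \<in> {1..n} \<Longrightarrow> ssgn n \<rho> x = g x" "sperm n \<rho> = \<pi>'" "\<rho> \<in> hyperoct n"
  shows "cycle_weight n w \<rho> = prod (orbit_weight w g) (orbs \<pi>' {1..n})"
proof -
  interpret r: hyperoct_elem n \<rho> by unfold_locales fact
  have "prod (ssgn n \<rho>) U = prod g U" if "U \<in> orbs \<pi>' {1..n}" for U
  proof (rule prod.cong)
    fix x assume "x \<in> U"
    then show "ssgn n \<rho> x = g x" using that assms(1,2) r.pi.Union_orbs by blast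
  qed simp
  then show ?thesis
    unfolding cycle_weight_def assms(2) by (intro prod.cong) (simp_all add: orbit_weight_def)
qed

context hyperoct_elem
begin

lemma sperm_srefl:
  assumes "i \<in> {1..n}" "j \<in> {1..n}" "i \<noteq> j"
  shows "sperm n (srefl n i j \<epsilon> \<circ> \<sigma>) = transpose i j \<circ> \<pi>"
proof
  fix x
  show "sperm n (srefl n i j \<epsilon> \<circ> \<sigma>) x = (transpose i j \<circ> \<pi>) x"
  proof (cases "x \<in> {1..n}")
    case True
    then have y: "\<sigma> x \<in> {1..2*n}" unfolding sigma_in by (rule in_double)
    have "ab n (srefl n i j \<epsilon> y) = transpose i j (ab n y)" if "y = a \<or> y = tau n a" "a \<in> {1..n}" for y a
    proof -
      have "transpose i j a \<in> {1..n}" using that(2) assms by (simp add: transpose_def del: atLeastAtMost_iff)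
      from tau_small(3,4)[OF this] show ?thesis
        using that(1) tau_small(3,4)[OF that(2)]
        by (elim disjE) (simp_all add: srefl_tau[OF assms] srefl_small[OF assms that(2)])
    qed
    from this[OF ab_cases[OF y] ab_in[OF y]] show ?thesis using True by (simp add: sperm_def)
  next
    case False
    then have "x \<noteq> i" "x \<noteq> j" using assms by auto
    then show ?thesis using False by (auto simp: sperm_def)
  qed
qed

lemma ssgn_srefl:
  assumes "i \<in> {1..n}" "j \<in> {1..n}" "i \<noteq> j" "\<epsilon> = 1 \<or> \<epsilon> = - 1" "x \<in> {1..n}"
  shows "ssgn n (srefl n i j \<epsilon> \<circ> \<sigma>) x = flip \<epsilon> {i, j} \<pi> sg x"
proof -
  have y: "\<sigma> x \<in> {1..2*n}" unfolding sigma_in using assms(5) by (rule in_double)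
  have "(if srefl n i j \<epsilon> y \<le> n then 1 else - 1 :: int) =
      (if ab n y \<in> {i, j} then \<epsilon> * (if y \<le> n then 1 else - 1) else (if y \<le> n then 1 else - 1))"
    if "y = a \<or> y = tau n a" "a \<in> {1..n}" for y a
  proof -
    have "transpose i j a \<in> {1..n}" using that(2) assms by (simp add: transpose_def del: atLeastAtMost_iff)
    from tau_small[OF this] show ?thesis
      using that(1) tau_small[OF that(2)] assms(4)
      by (elim disjE) (simp_all add: srefl_tau[OF assms(1-3)] srefl_small[OF assms(1-3) that(2)])
  qed
  from this[OF ab_cases[OF y] ab_in[OF y]] show ?thesis using assms(5) by (simp add: ssgn_def flip_def sperm_def)
qed

lemma cycle_weight_srefl:
  assumes "i \<in> {1..n}" "j \<in> {1..n}" "i \<noteq> j" "\<epsilon> = 1 \<or> \<epsilon> = - 1"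
  shows "cycle_weight n w (srefl n i j \<epsilon> \<circ> \<sigma>) =
    prod (orbit_weight w (flip \<epsilon> {i, j} \<pi> sg)) (orbs (transpose i j \<circ> \<pi>) {1..n})"
  by (rule cycle_weight_cong[OF ssgn_srefl[OF assms] sperm_srefl[OF assms(1-3)]
        hyperoct_comp[OF srefl_hyperoct[OF assms(1-3)] in_hyperoct]])

lemma sperm_l_refl: "i \<in> {1..n} \<Longrightarrow> sperm n (l_refl n i \<circ> \<sigma>) = \<pi>"
  using in_double sigma_in by (auto simp: fun_eq_iff sperm_def l_refl_apply)

lemma ssgn_l_refl:
  assumes "i \<in> {1..n}" "x \<in> {1..n}"
  shows "ssgn n (l_refl n i \<circ> \<sigma>) x = flip (- 1) {i} \<pi> sg x"
proof -
  have y: "\<sigma> x \<in> {1..2*n}" unfolding sigma_in using assms(2) by (rule in_double)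
  have "(if l_refl n i y \<le> n then 1 else - 1 :: int) =
      (if ab n y \<in> {i} then - 1 * (if y \<le> n then 1 else - 1) else (if y \<le> n then 1 else - 1))"
    if "y \<in> {1..2*n}" for y
    unfolding l_refl_apply using assms that by (auto simp: tau_def ab_def)
  from this[OF y] show ?thesis using assms(2) by (simp add: ssgn_def flip_def sperm_def)
qed

lemma cycle_weight_l_refl:
  assumes "i \<in> {1..n}"
  shows "cycle_weight n w (l_refl n i \<circ> \<sigma>) =
    prod (orbit_weight w (flip (- 1) {i} \<pi> sg)) (orbs \<pi> {1..n})"
  by (rule cycle_weight_cong[OF ssgn_l_refl[OF assms] sperm_l_refl[OF assms]
        hyperoct_comp[OF l_refl_hyperoct[OF in_double[OF assms]] in_hyperoct]])

end

section \<open>Enumeration of the two kinds of reflections\<close>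

definition r_refls :: "nat \<Rightarrow> (nat \<Rightarrow> nat) set" where
  "r_refls n = {r_refl n i j |i j. i \<in> {1..2*n} \<and> j \<in> {1..2*n} \<and> i \<noteq> j \<and> j \<noteq> tau n i}"

definition l_refls :: "nat \<Rightarrow> (nat \<Rightarrow> nat) set" where
  "l_refls n = {l_refl n i |i. i \<in> {1..2*n}}"

lemma r_refls_subset: "r_refls n \<subseteq> hyperoct n"
  by (auto simp: r_refls_def simp del: atLeastAtMost_iff intro: r_refl_hyperoct)

lemma l_refls_subset: "l_refls n \<subseteq> hyperoct n"
  by (auto simp: l_refls_def simp del: atLeastAtMost_iff intro: l_refl_hyperoct)

lemma sum_l_refls: "(\<Sum>h\<in>l_refls n. f h) = (\<Sum>i\<in>{1..n}. f (l_refl n i))"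
proof -
  have "l_refl n i = l_refl n (tau n i)" for i
    by (simp add: l_refl_def transpose_commute)
  then have "l_refl n i = l_refl n (ab n i)" if "i \<in> {1..2*n}" for i
    using ab_cases[OF that] by metis
  then have "l_refls n = l_refl n ` {1..n}"
    unfolding l_refls_def using ab_in in_double by blast
  moreover have "inj_on (l_refl n) {1..n}"
  proof (rule inj_onI)
    fix i j assume ij: "i \<in> {1..n}" "j \<in> {1..n}" "l_refl n i = l_refl n j"
    then have "l_refl n j i = tau n i" by (metis l_refl_apply)
    then show "i = j" using ij by (auto simp: l_refl_apply tau_def split: if_splits)
  qed
  ultimately show ?thesis by (simp add: sum.reindex)
qed

text \<open>A reflection is normalised by passing to the absolute values of its indices, recording
  in \<open>\<epsilon>\<close> whether both were replaced or only one, and sorting.\<close>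

lemma r_refls_eq:
  "r_refls n = (\<lambda>(i, j, \<epsilon>). srefl n i j \<epsilon>) ` {(i, j, \<epsilon>). i \<in> {1..n} \<and> j \<in> {1..n} \<and> i < j \<and> \<epsilon> \<in> {1, - 1}}"
  (is "_ = ?f ` ?T")
proof (intro equalityI subsetI)
  fix h assume "h \<in> r_refls n"
  then obtain i j where ij: "i \<in> {1..2*n}" "j \<in> {1..2*n}" "i \<noteq> j" "j \<noteq> tau n i" "h = r_refl n i j"
    by (auto simp: r_refls_def simp del: atLeastAtMost_iff)
  define a b where "a = ab n i" and "b = ab n j"
  have ab: "a \<in> {1..n}" "b \<in> {1..n}" unfolding a_def b_def using ij ab_in by blast+
  have neq: "a \<noteq> b" using ij ab_eq_iff[of i n j] unfolding a_def b_def by (metis tau_tau)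
  have i: "i = a \<or> i = tau n a" and j: "j = b \<or> j = tau n b"
    unfolding a_def b_def using ij ab_cases by blast+
  have "\<exists>\<epsilon>\<in>{1, - 1}. h = srefl n a b \<epsilon>"
  proof (cases "(i = a) = (j = b)")
    case True
    then have "(i = a \<and> j = b) \<or> (i = tau n a \<and> j = tau n b)" using i j by auto
    then have "h = srefl n a b 1"
      unfolding fun_eq_iff ij(5) srefl_apply[OF ab neq] r_refl_apply[OF ij(1-4)]
      using neq tau_small_neq[OF ab(1,2)] tau_small_neq[OF ab(1,1)] tau_small_neq[OF ab(2,2)]
      by (elim disjE conjE) (simp_all del: atLeastAtMost_iff)
    then show ?thesis by blast
  next
    case False
    then have "(i = a \<and> j = tau n b) \<or> (i = tau n a \<and> j = b)" using i j by auto
    then have "h = srefl n a b (- 1)"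
      unfolding fun_eq_iff ij(5) srefl_apply[OF ab neq] r_refl_apply[OF ij(1-4)]
      using neq tau_small_neq[OF ab(1,2)] tau_small_neq[OF ab(1,1)] tau_small_neq[OF ab(2,2)]
      by (elim disjE conjE) (simp_all del: atLeastAtMost_iff)
    then show ?thesis by blast
  qed
  then obtain \<epsilon> where \<epsilon>: "\<epsilon> \<in> {1, - 1}" "h = srefl n a b \<epsilon>" "h = srefl n b a \<epsilon>"
    using srefl_commute[OF ab neq] by auto
  show "h \<in> ?f ` ?T"
  proof (cases "a < b")
    case True
    then have "(a, b, \<epsilon>) \<in> ?T" "h = ?f (a, b, \<epsilon>)" using ab \<epsilon> by auto
    then show ?thesis by blast
  next
    case False
    then have "(b, a, \<epsilon>) \<in> ?T" "h = ?f (b, a, \<epsilon>)" using ab \<epsilon> neq by auto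
    then show ?thesis by blast
  qed
next
  fix h assume "h \<in> ?f ` ?T"
  then obtain i j \<epsilon> where h: "i \<in> {1..n}" "j \<in> {1..n}" "i < j" "h = srefl n i j \<epsilon>" by auto
  then have ne: "i \<noteq> j" by simp
  show "h \<in> r_refls n"
    unfolding r_refls_def h(4) srefl_def
    using srefl_cond(1)[OF h(1,2) ne] srefl_cond(2-4)[OF h(1,2) ne, of \<epsilon>] by blast
qed

text \<open>The set \<open>{i, j}\<close> is recovered as the points of \<open>{1..n}\<close> that
  are moved, and \<open>\<epsilon>\<close> from the image of \<open>i\<close>.\<close>

lemma inj_on_srefl:
  "inj_on (\<lambda>(i, j, \<epsilon>). srefl n i j \<epsilon>) {(i, j, \<epsilon>). i \<in> {1..n} \<and> j \<in> {1..n} \<and> i < j \<and> \<epsilon> \<in> {1, - 1}}"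
proof -
  have moved: "{x \<in> {1..n}. srefl n i j \<epsilon> x \<noteq> x} = {i, j}" if "i \<in> {1..n}" "j \<in> {1..n}" "i < j" for i j \<epsilon>
  proof -
    have "i \<noteq> j" using that by simp
    from srefl_apply[OF that(1,2) this] show ?thesis using that by (auto simp: tau_def)
  qed
  show ?thesis
  proof (rule inj_onI)
    fix p q
    assume p: "p \<in> {(i, j, \<epsilon>). i \<in> {1..n} \<and> j \<in> {1..n} \<and> i < j \<and> \<epsilon> \<in> {1, - 1 :: int}}"
      and q: "q \<in> {(i, j, \<epsilon>). i \<in> {1..n} \<and> j \<in> {1..n} \<and> i < j \<and> \<epsilon> \<in> {1, - 1 :: int}}"
      and pq: "(case p of (i, j, \<epsilon>) \<Rightarrow> srefl n i j \<epsilon>) = (case q of (i, j, \<epsilon>) \<Rightarrow> srefl n i j \<epsilon>)"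
    obtain i j \<epsilon> i' j' \<epsilon>' where pq_eq: "p = (i, j, \<epsilon>)" "q = (i', j', \<epsilon>')" by (metis prod.collapse)
    have *: "i \<in> {1..n}" "j \<in> {1..n}" "i < j" "\<epsilon> \<in> {1, - 1}"
      "i' \<in> {1..n}" "j' \<in> {1..n}" "i' < j'" "\<epsilon>' \<in> {1, - 1}"
      using p q unfolding pq_eq by auto
    have eq: "srefl n i j \<epsilon> = srefl n i' j' \<epsilon>'" using pq unfolding pq_eq by simp
    have "{i, j} = {i', j'}" using moved[OF *(1-3), of \<epsilon>] moved[OF *(5-7), of \<epsilon>'] eq by simp
    then have "i = i'" "j = j'" using *(3,7) by (auto simp: doubleton_eq_iff)
    moreover have "i \<noteq> j" using * by simp
    then have "srefl n i j \<epsilon> i = srefl n i j \<epsilon>' i \<longleftrightarrow> \<epsilon> = \<epsilon>'"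
      unfolding srefl_apply[OF *(1,2) \<open>i \<noteq> j\<close>] using * by (auto simp: tau_def)
    ultimately show "p = q" using eq unfolding pq_eq by simp
  qed
qed

text \<open>Each reflection is counted for both orders of its two absolute values; ordered pairs are
  the form in which cuts and joins were summed.\<close>

lemma sum_r_refls:
  fixes f :: "(nat \<Rightarrow> nat) \<Rightarrow> 'r::comm_ring_1"
  shows "2 * (\<Sum>h\<in>r_refls n. f h) = (\<Sum>i\<in>{1..n}. \<Sum>j\<in>{1..n} - {i}. \<Sum>\<epsilon>\<in>{1, - 1}. f (srefl n i j \<epsilon>))"
proof -
  define g where "g i j = (\<Sum>\<epsilon>\<in>{1, - 1}. f (srefl n i j \<epsilon>))" for i j
  let ?L = "{(i, j). i \<in> {1..n} \<and> j \<in> {1..n} \<and> i < j}"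
  let ?T = "{(i, j, \<epsilon>). i \<in> {1..n} \<and> j \<in> {1..n} \<and> i < j \<and> \<epsilon> \<in> {1, - 1 :: int}}"
  have finL: "finite ?L" by (rule finite_subset[of _ "{1..n} \<times> {1..n}"]) auto
  have "(\<Sum>h\<in>r_refls n. f h) = (\<Sum>(i, j, \<epsilon>)\<in>?T. f (srefl n i j \<epsilon>))"
    unfolding r_refls_eq by (subst sum.reindex[OF inj_on_srefl]) (simp add: case_prod_unfold)
  also have "\<dots> = (\<Sum>((i, j), \<epsilon>)\<in>?L \<times> {1, - 1}. f (srefl n i j \<epsilon>))"
    by (rule sum.reindex_bij_witness[where i = "\<lambda>((i, j), \<epsilon>). (i, j, \<epsilon>)" and j = "\<lambda>(i, j, \<epsilon>). ((i, j), \<epsilon>)"]) auto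
  also have "\<dots> = (\<Sum>(i, j)\<in>?L. g i j)"
    using sum.cartesian_product[of "\<lambda>p \<epsilon>. f (srefl n (fst p) (snd p) \<epsilon>)" "{1, - 1}" ?L]
    by (simp only: g_def case_prod_unfold)
  finally have 1: "(\<Sum>h\<in>r_refls n. f h) = (\<Sum>(i, j)\<in>?L. g i j)" .
  have g: "g i j = g j i" if "(i, j) \<in> ?L" for i j
    using that srefl_commute[of i n j] by (simp add: g_def del: atLeastAtMost_iff)
  have "(\<Sum>i\<in>{1..n}. \<Sum>j\<in>{1..n} - {i}. g i j) = (\<Sum>(i, j)\<in>(SIGMA i:{1..n}. {1..n} - {i}). g i j)"
    by (rule sum.Sigma) auto
  also have "(SIGMA i:{1..n}. {1..n} - {i}) = ?L \<union> prod.swap ` ?L"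
    by (auto simp: image_iff)
  also have "(\<Sum>(i, j)\<in>?L \<union> prod.swap ` ?L. g i j) = (\<Sum>(i, j)\<in>?L. g i j) + (\<Sum>(i, j)\<in>prod.swap ` ?L. g i j)"
    by (rule sum.union_disjoint) (use finL in auto)
  also have "(\<Sum>(i, j)\<in>prod.swap ` ?L. g i j) = (\<Sum>(i, j)\<in>?L. g j i)"
    by (subst sum.reindex) (auto simp: case_prod_unfold)
  also have "\<dots> = (\<Sum>(i, j)\<in>?L. g i j)"
  proof (rule sum.cong)
    fix p assume "p \<in> ?L"
    then have "g (fst p) (snd p) = g (snd p) (fst p)" by (intro g) simp
    then show "(case p of (i, j) \<Rightarrow> g j i) = (case p of (i, j) \<Rightarrow> g i j)"
      by (simp only: case_prod_unfold)
  qed simp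
  finally show ?thesis unfolding 1 g_def by simp
qed

section \<open>Conjugacy classes\<close>

text \<open>Keeps both kinds of cycles in one multiset, since joins and sign reversals can turn one
  kind into the other.\<close>

definition full_type :: "nat \<Rightarrow> (nat \<Rightarrow> nat) \<Rightarrow> (nat \<times> int) multiset" where
  "full_type n \<sigma> = image_mset (\<lambda>U. (card U, prod (ssgn n \<sigma>) U)) (mset_set (orbs (sperm n \<sigma>) {1..n}))"

lemma image_mset_set_add_msetE:
  assumes "finite S" "image_mset f (mset_set S) = add_mset p R"
  obtains U where "U \<in> S" "f U = p" "image_mset f (mset_set (S - {U})) = R"
proof -
  have "p \<in># image_mset f (mset_set S)" using assms(2) by simp
  then obtain U where U: "U \<in> S" "f U = p" using assms(1) by auto
  then have "mset_set S = add_mset U (mset_set (S - {U}))" using assms(1) by (simp add: mset_set.remove)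
  then show ?thesis using that U assms(2) by simp
qed

lemma image_mset_set_eq_imp_bij:
  assumes "finite A" "finite B" "image_mset f (mset_set A) = image_mset g (mset_set B)"
  shows "\<exists>\<phi>. bij_betw \<phi> A B \<and> (\<forall>a\<in>A. g (\<phi> a) = f a)"
  using assms
proof (induction A arbitrary: B rule: finite_induct)
  case empty
  then have "B = {}" by (metis image_mset_is_empty_iff mset_set.empty mset_set_empty_iff)
  then show ?case by (auto simp: bij_betw_def)
next
  case (insert a A)
  have "image_mset g (mset_set B) = add_mset (f a) (image_mset f (mset_set A))"
    using insert by simp
  from image_mset_set_add_msetE[OF insert.prems(1) this] obtain b where
    b: "b \<in> B" "g b = f a" "image_mset g (mset_set (B - {b})) = image_mset f (mset_set A)" .
  from insert.IH[OF _ b(3)[symmetric]] insert.prems(1) obtain \<phi> where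
    \<phi>: "bij_betw \<phi> A (B - {b})" "\<forall>a\<in>A. g (\<phi> a) = f a" by auto
  have "bij_betw (\<phi>(a := b)) A (B - {b})"
    using \<phi>(1) by (rule bij_betw_cong[THEN iffD1, rotated]) (use insert.hyps in auto)
  then have "bij_betw (\<phi>(a := b)) (A \<union> {a}) ((B - {b}) \<union> {(\<phi>(a := b)) a})"
    by (subst notIn_Un_bij_betw3[symmetric]) (use insert.hyps in auto)
  moreover have "(B - {b}) \<union> {(\<phi>(a := b)) a} = B" using b by auto
  ultimately have "bij_betw (\<phi>(a := b)) (insert a A) B" by simp
  moreover have "\<forall>c\<in>insert a A. g ((\<phi>(a := b)) c) = f c" using \<phi>(2) b(2) insert.hyps by auto
  ultimately show ?case by blast
qed

context hyperoct_elem
begin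

lemma signed_type_eq_full_type:
  "signed_type s = image_mset fst (filter_mset (\<lambda>p. snd p = s) (full_type n \<sigma>))"
  unfolding full_type_def signed_type_def
  by (simp add: filter_mset_image_mset multiset.map_comp o_def)

lemma full_type_eq_signed_type:
  "full_type n \<sigma> = image_mset (\<lambda>k. (k, 1)) (signed_type 1) + image_mset (\<lambda>k. (k, - 1)) (signed_type (- 1))"
proof -
  let ?f = "\<lambda>U. (card U, prod sg U)"
  let ?P = "\<lambda>s. {U \<in> orbs \<pi> {1..n}. prod sg U = s}"
  have *: "image_mset ?f (mset_set (?P s)) = image_mset (\<lambda>k. (k, s)) (signed_type s)" for s
    unfolding signed_type_def multiset.map_comp o_def
    by (rule image_mset_cong) simp
  have "orbs \<pi> {1..n} = ?P 1 \<union> ?P (- 1)" using prod_sg_cases by auto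
  then have "full_type n \<sigma> = image_mset ?f (mset_set (?P 1 \<union> ?P (- 1)))" by (simp add: full_type_def)
  also have "mset_set (?P 1 \<union> ?P (- 1)) = mset_set (?P 1) + mset_set (?P (- 1))"
    by (rule mset_set_Union) auto
  finally show ?thesis by (simp only: image_mset_union *)
qed

lemma full_type_cong:
  assumes "\<And>x. x \<in> {1..n} \<Longrightarrow> ssgn n \<rho> x = g x" "sperm n \<rho> = \<pi>'" "\<rho> \<in> hyperoct n"
  shows "full_type n \<rho> = image_mset (\<lambda>U. (card U, prod g U)) (mset_set (orbs \<pi>' {1..n}))"
proof -
  interpret r: hyperoct_elem n \<rho> by unfold_locales fact
  have "prod (ssgn n \<rho>) U = prod g U" if "U \<in> orbs \<pi>' {1..n}" for U
  proof (rule prod.cong)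
    fix x assume "x \<in> U"
    then show "ssgn n \<rho> x = g x" using that assms(1,2) r.pi.Union_orbs by blast
  qed simp
  then show ?thesis
    unfolding full_type_def assms(2) by (intro image_mset_cong) (use r.pi.finite_orbs assms(2) in auto)
qed

text \<open>The reflection with \<open>\<epsilon> = 1\<close> through one point of each orbit joins
  them and changes no sign.\<close>

lemma full_type_join:
  assumes "full_type n \<sigma> = add_mset (k, s) (add_mset (l, t) M)"
  shows "\<exists>\<rho>\<in>hyperoct n. full_type n \<rho> = add_mset (k + l, s * t) M"
proof -
  let ?f = "\<lambda>U. (card U, prod sg U)"
  from image_mset_set_add_msetE[OF pi.finite_orbs assms[unfolded full_type_def]]
  obtain U where U: "U \<in> orbs \<pi> {1..n}" "?f U = (k, s)"
    "image_mset ?f (mset_set (orbs \<pi> {1..n} - {U})) = add_mset (l, t) M" by blast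
  from image_mset_set_add_msetE[OF _ U(3)]
  obtain V where V: "V \<in> orbs \<pi> {1..n} - {U}" "?f V = (l, t)"
    "image_mset ?f (mset_set (orbs \<pi> {1..n} - {U} - {V})) = M" using pi.finite_orbs by auto
  define a where "a = base U" define b where "b = base V"
  have a: "a \<in> {1..n}" "orbit \<pi> a = U" unfolding a_def using U(1) base_small base_orbit by blast+
  have b: "b \<in> {1..n}" "orbit \<pi> b = V" unfolding b_def using V(1) base_small base_orbit by blast+
  have ne: "orbit \<pi> a \<noteq> orbit \<pi> b" using a b V(1) by auto
  then have "a \<noteq> b" by auto
  have \<rho>: "srefl n a b 1 \<circ> \<sigma> \<in> hyperoct n"
    using srefl_hyperoct[OF a(1) b(1) \<open>a \<noteq> b\<close>] in_hyperoct by (rule hyperoct_comp)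
  have flip1: "flip 1 S p g = g" for S :: "nat set" and p g by (auto simp: flip_def)
  have "full_type n (srefl n a b 1 \<circ> \<sigma>) =
      image_mset ?f (mset_set (orbs (transpose a b \<circ> \<pi>) {1..n}))"
    by (rule full_type_cong)
       (use \<rho> ssgn_srefl[OF a(1) b(1) \<open>a \<noteq> b\<close>, of 1] sperm_srefl[OF a(1) b(1) \<open>a \<noteq> b\<close>] in
         \<open>simp_all add: flip1\<close>)
  also have "\<dots> = add_mset (?f (U \<union> V)) M"
    using pi.orbs_join[OF a(1) b(1) ne] V(3) unfolding a(2) b(2) by simp
  also have "?f (U \<union> V) = (k + l, s * t)"
  proof -
    have "U \<inter> V = {}" using pi.orbs_disjoint[OF U(1), of V] V(1) by auto
    moreover have "finite U" "finite V" using U(1) V(1) pi.finite_in_orbs by auto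
    ultimately show ?thesis using U(2) V(2) by (simp add: card_Un_disjoint prod.union_disjoint)
  qed
  finally show ?thesis using \<rho> by blast
qed

lemma full_type_flip:
  assumes "full_type n \<sigma> = add_mset (k, s) M"
  shows "\<exists>\<rho>\<in>hyperoct n. full_type n \<rho> = add_mset (k, - s) M"
proof -
  let ?f = "\<lambda>U. (card U, prod sg U)"
  from image_mset_set_add_msetE[OF pi.finite_orbs assms[unfolded full_type_def]]
  obtain U where U: "U \<in> orbs \<pi> {1..n}" "?f U = (k, s)"
    "image_mset ?f (mset_set (orbs \<pi> {1..n} - {U})) = M" by blast
  define a where "a = base U"
  have a: "a \<in> {1..n}" "orbit \<pi> a = U" unfolding a_def using U(1) base_small base_orbit by blast+
  have \<rho>: "l_refl n a \<circ> \<sigma> \<in> hyperoct n"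
    using l_refl_hyperoct[OF in_double[OF a(1)]] in_hyperoct by (rule hyperoct_comp)
  let ?g = "flip (- 1) {a} \<pi> sg"
  have "full_type n (l_refl n a \<circ> \<sigma>) =
      image_mset (\<lambda>U. (card U, prod ?g U)) (mset_set (orbs \<pi> {1..n}))"
    by (rule full_type_cong) (use \<rho> ssgn_l_refl[OF a(1)] sperm_l_refl[OF a(1)] in simp_all)
  also have "mset_set (orbs \<pi> {1..n}) = add_mset U (mset_set (orbs \<pi> {1..n} - {U}))"
    using U(1) by (intro mset_set.remove) auto
  also have "image_mset (\<lambda>U. (card U, prod ?g U)) (mset_set (orbs \<pi> {1..n} - {U})) =
      image_mset ?f (mset_set (orbs \<pi> {1..n} - {U}))"
  proof (rule image_mset_cong)
    fix V assume "V \<in># mset_set (orbs \<pi> {1..n} - {U})"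
    then have V: "V \<in> orbs \<pi> {1..n}" "V \<noteq> U" by auto
    have "\<pi> x \<notin> {a}" if "x \<in> V" for x
      using V that a pi.orbs_eq[of V x] pi.orbit_eq[of "\<pi> x" x] orbit.base[of \<pi> x] by auto
    then show "(card V, prod ?g V) = (card V, prod sg V)" by (simp add: prod_flip_other)
  qed
  then have "image_mset (\<lambda>U. (card U, prod ?g U)) (add_mset U (mset_set (orbs \<pi> {1..n} - {U}))) =
      add_mset (card U, prod ?g U) M" using U(3) by simp
  also have "prod ?g U = - 1 * prod sg U"
    using pi.prod_flip_orbit[of "{a}" a "- 1" sg] a(2) pi.self_in_orbit[of a] by auto
  finally have "full_type n (l_refl n a \<circ> \<sigma>) = add_mset (card U, - 1 * prod sg U) M" .
  moreover have "add_mset (card U, - 1 * prod sg U) M = add_mset (k, - s) M" using U(2) by simp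
  ultimately have "full_type n (l_refl n a \<circ> \<sigma>) = add_mset (k, - s) M" by (rule trans)
  then show ?thesis using \<rho> by blast
qed

end

lemma full_type_id: "full_type n id = replicate_mset n (1, 1)"
proof -
  have s: "sperm n id = id" by (auto simp: fun_eq_iff sperm_def)
  have "orbs (id :: nat \<Rightarrow> nat) {1..n} = (\<lambda>x. {x}) ` {1..n}"
    unfolding orbs_def by (rule image_cong) (simp_all add: orbit_eq_singleton_iff)
  then have "full_type n id = image_mset (\<lambda>U. (card U, prod (ssgn n id) U)) (image_mset (\<lambda>x. {x}) (mset_set {1..n}))"
    unfolding full_type_def s by (simp add: image_mset_mset_set)
  also have "\<dots> = image_mset (\<lambda>x. (1, 1)) (mset_set {1..n})"
    unfolding multiset.map_comp by (rule image_mset_cong) (simp add: ssgn_def)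
  finally show ?thesis by (simp add: image_mset_const_eq)
qed

text \<open>Every type arises from that of the identity by reversing signs of cycles and by joining
  a cycle with a fixed point of sign 1.\<close>

lemma full_type_realizable:
  assumes "\<forall>p\<in>#M. 0 < fst p \<and> (snd p = 1 \<or> snd p = - 1)" "\<Sum>\<^sub># (image_mset fst M) = n"
  shows "\<exists>\<sigma>\<in>hyperoct n. full_type n \<sigma> = M"
  using assms
\<comment> \<open>Splitting off a part \<open>(1, 1)\<close> lowers this measure by 2, turning a
  sign -1 into 1 lowers it by 1.\<close>
proof (induction "\<Sum>\<^sub># (image_mset (\<lambda>p. 2 * (fst p - 1) + (if snd p = 1 then 0 else 1)) M)"
    arbitrary: M rule: less_induct)
  case less
  show ?case
  proof (cases "\<exists>p\<in>#M. 1 < fst p")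
    case True
    then obtain k s M' where M: "M = add_mset (k, s) M'" "1 < k"
      by (metis multi_member_split prod.collapse)
    define M2 where "M2 = add_mset (1, 1) (add_mset (k - 1, s) M')"
    have "\<exists>\<sigma>\<in>hyperoct n. full_type n \<sigma> = M2"
      by (rule less.hyps) (use M less.prems in \<open>auto simp: M2_def\<close>)
    then obtain \<sigma> where \<sigma>: "\<sigma> \<in> hyperoct n" "full_type n \<sigma> = M2" by blast
    interpret hyperoct_elem n \<sigma> by unfold_locales fact
    from full_type_join[OF \<sigma>(2)[unfolded M2_def]] show ?thesis using M by simp
  next
    case False
    then have one: "fst p = 1" if "p \<in># M" for p
      using less.prems(1) that by (metis linorder_neqE_nat less_one not_less_zero)
    show ?thesis
    proof (cases "\<exists>p\<in>#M. snd p = - 1")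
      case True
      then obtain k M' where M: "M = add_mset (k, - 1) M'"
        by (metis multi_member_split prod.collapse)
      have "\<exists>\<sigma>\<in>hyperoct n. full_type n \<sigma> = add_mset (k, 1) M'"
        by (rule less.hyps) (use M less.prems in auto)
      then obtain \<sigma> where \<sigma>: "\<sigma> \<in> hyperoct n" "full_type n \<sigma> = add_mset (k, 1) M'" by blast
      interpret hyperoct_elem n \<sigma> by unfold_locales fact
      from full_type_flip[OF \<sigma>(2)] show ?thesis using M by simp
    next
      case False
      then have "set_mset M \<subseteq> {(1, 1)}" using one less.prems(1) by (metis prod.collapse singletonI subsetI)
      then have M: "M = replicate_mset (size M) (1, 1)" by (rule set_mset_subset_singletonD)
      have "\<Sum>\<^sub># (image_mset fst (replicate_mset (size M) (1::nat, 1::int))) = size M"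
        by (simp add: sum_mset_replicate_mset)
      then have "size M = n" using less.prems(2) M by metis
      then show ?thesis using M full_type_id[of n] hyperoct_id by metis
    qed
  qed
qed

text \<open>Ensures that the division by the class size in \<open>class_average\<close> is not a
  division by 0.\<close>

lemma bip_class_nonempty:
  assumes "is_partition lam" "is_partition mu" "sum_list lam + sum_list mu = n"
  shows "bip_class n lam mu \<noteq> {}"
proof -
  let ?M = "image_mset (\<lambda>k. (k, 1)) (mset lam) + image_mset (\<lambda>k. (k, - 1)) (mset mu) :: (nat \<times> int) multiset"
  have "\<exists>\<sigma>\<in>hyperoct n. full_type n \<sigma> = ?M"
  proof (rule full_type_realizable)
    show "\<forall>p\<in>#?M. 0 < fst p \<and> (snd p = 1 \<or> snd p = - 1)"
      using assms(1,2) by (auto simp: is_partition_def intro: gr0I)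
    show "\<Sum>\<^sub># (image_mset fst ?M) = n"
      using assms(3) by (simp add: multiset.map_comp o_def sum_mset_sum_list)
  qed
  then obtain \<sigma> where \<sigma>: "\<sigma> \<in> hyperoct n" "full_type n \<sigma> = ?M" by blast
  interpret hyperoct_elem n \<sigma> by unfold_locales fact
  have "\<sigma> \<in> bip_class n lam mu"
    unfolding bip_class_iff signed_type_eq_full_type \<sigma>(2)
    by (simp add: filter_mset_image_mset multiset.map_comp o_def)
  then show ?thesis by blast
qed

section \<open>Coordinates on the orbits and conjugating elements\<close>

context hyperoct_elem
begin

definition move :: "nat \<Rightarrow> nat \<Rightarrow> nat \<Rightarrow> nat" where
  "move m e x = (tau n ^^ e) ((\<sigma> ^^ m) x)"

lemma tau_funpow: "(tau n ^^ e) x = (if even e then x else tau n x)"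
  by (induction e) auto

lemma funpow_sigma_tau: "(\<sigma> ^^ m) ((tau n ^^ e) x) = (tau n ^^ e) ((\<sigma> ^^ m) x)"
proof -
  have "(\<sigma> ^^ m) (tau n x) = tau n ((\<sigma> ^^ m) x)" for x
    by (induction m) (simp_all add: sigma_tau)
  then show ?thesis by (simp add: tau_funpow)
qed

text \<open>A full turn around \<open>U\<close> acts on the base point as a power of
  \<open>tau n\<close>, so whole turns can be shifted from the exponent of \<open>\<sigma>\<close>
  into that of \<open>tau n\<close>.\<close>

lemma move_mod:
  assumes "U \<in> orbs \<pi> {1..n}"
  defines "\<delta> \<equiv> if prod sg U = 1 then 0 else 1 :: nat"
  shows "move m e (base U) = move (m mod card U) (e + \<delta> * (m div card U)) (base U)"
proof -
  let ?x = "base U" and ?k = "card U"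
  have 1: "(\<sigma> ^^ ?k) ?x = (tau n ^^ \<delta>) ?x"
    using funpow_sigma_card[OF base_small[OF assms(1)]] base_orbit[OF assms(1)] by (simp add: \<delta>_def One_nat_def)
  have 2: "(\<sigma> ^^ (?k * q)) ?x = (tau n ^^ (\<delta> * q)) ?x" for q
  proof (induction q)
    case (Suc q)
    have "(\<sigma> ^^ (?k * Suc q)) ?x = (\<sigma> ^^ ?k) ((\<sigma> ^^ (?k * q)) ?x)" by (simp add: funpow_add)
    then show ?case using Suc by (simp add: funpow_sigma_tau 1 funpow_add)
       (metis comp_apply funpow_add add.commute)
  qed simp
  have "(\<sigma> ^^ m) ?x = (\<sigma> ^^ (m mod ?k)) ((\<sigma> ^^ (?k * (m div ?k))) ?x)"
    by (metis comp_apply funpow_add mod_mult_div_eq)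
  then show ?thesis unfolding move_def 2 funpow_sigma_tau by (simp add: funpow_add)
qed

text \<open>For exponents reduced below \<open>card U\<close>, the absolute value of a point
  determines the exponent of \<open>\<sigma>\<close>; the parity of the other exponent is then
  determined because \<open>tau n\<close> has no fixed points.\<close>

lemma move_eq_iff:
  assumes U: "U \<in> orbs \<pi> {1..n}"
  defines "\<delta> \<equiv> if prod sg U = 1 then 0 else 1 :: nat"
  shows "move m e (base U) = move m' e' (base U) \<longleftrightarrow>
    m mod card U = m' mod card U \<and> even (e + \<delta> * (m div card U) + (e' + \<delta> * (m' div card U)))"
proof -
  let ?x = "base U" and ?k = "card U"
  have x: "?x \<in> {1..2*n}" by (rule in_double[OF base_small[OF U]])
  have k: "?k = card (orbit \<pi> ?x)" using base_orbit[OF U] by simp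
  have k0: "0 < ?k" unfolding k by (rule pi.card_orbit_pos)
  have *: "move r f ?x = move r' f' ?x \<longleftrightarrow> r = r' \<and> even (f + f')" if r: "r < ?k" "r' < ?k" for r r' f f'
  proof
    assume eq: "move r f ?x = move r' f' ?x"
    have "ab n (move r f ?x) = (\<pi> ^^ r) ?x" for r f
      using ab_funpow[OF x, of r] ab_tau[OF funpow_sigma_in[OF x], of r] base_small[OF U]
      by (simp add: move_def tau_funpow)
    then have "(\<pi> ^^ r) ?x = (\<pi> ^^ r') ?x" using eq by metis
    then have "r = r'" using pi.inj_on_funpow[of ?x] r unfolding k inj_on_def by auto
    then show "r = r' \<and> even (f + f')"
      using eq tau_neq[OF funpow_sigma_in[OF x], of r] by (auto simp: move_def tau_funpow split: if_splits)
  qed (auto simp: move_def tau_funpow)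
  show ?thesis
    unfolding move_mod[OF U, of m e] move_mod[OF U, of m' e'] \<delta>_def[symmetric]
    using *[of "m mod ?k" "m' mod ?k"] k0 by simp
qed

lemma ex_move:
  assumes "y \<in> {1..2*n}"
  shows "\<exists>m e. y = move m e (base (orbit \<pi> (ab n y)))"
proof -
  let ?U = "orbit \<pi> (ab n y)"
  have U: "?U \<in> orbs \<pi> {1..n}" by (rule orbs_abI[OF assms])
  have "y \<in> full ?U" using full_orbit[OF assms] sigma.self_in_orbit by blast
  then have "y \<in> orbit \<sigma> (base ?U) \<union> tau n ` orbit \<sigma> (base ?U)" using full_base[OF U] by simp
  then have "\<exists>m. y = (\<sigma> ^^ m) (base ?U) \<or> y = tau n ((\<sigma> ^^ m) (base ?U))"
    unfolding orbit_altdef_permutation[OF sigma.permutation, of "base ?U"] by auto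
  then obtain m where "y = (\<sigma> ^^ m) (base ?U) \<or> y = tau n ((\<sigma> ^^ m) (base ?U))" ..
  then have "y = move m 0 (base ?U) \<or> y = move m 1 (base ?U)" by (simp add: move_def One_nat_def)
  then show ?thesis by blast
qed

lemma move_in: "U \<in> orbs \<pi> {1..n} \<Longrightarrow> move m e (base U) \<in> {1..2*n}"
  using funpow_sigma_in[OF in_double[OF base_small]] tau_in by (simp add: move_def tau_funpow del: atLeastAtMost_iff)

lemma orbit_ab_move: "U \<in> orbs \<pi> {1..n} \<Longrightarrow> orbit \<pi> (ab n (move m e (base U))) = U"
proof -
  assume U: "U \<in> orbs \<pi> {1..n}"
  have x: "base U \<in> {1..2*n}" by (rule in_double[OF base_small[OF U]])
  have "ab n (move m e (base U)) = (\<pi> ^^ m) (base U)"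
    using ab_funpow[OF x, of m] ab_tau[OF funpow_sigma_in[OF x], of m] base_small[OF U]
    by (simp add: move_def tau_funpow)
  then show ?thesis using pi.orbit_eq[OF pi.funpow_in_orbit] base_orbit[OF U] by simp
qed

end

text \<open>Each orbit of \<open>\<langle>\<sigma>, \<tau>\<rangle>\<close> consists of the points \<open>\<tau>\<^sup>e \<sigma>\<^sup>m b\<close>, where \<open>b\<close> is a base point, and
  the coincidences between these points depend only on the length and the sign of the orbit.\<close>

lemma hyperoct_conjugate:
  assumes \<sigma>: "\<sigma> \<in> hyperoct n" and \<rho>: "\<rho> \<in> hyperoct n" and type: "full_type n \<sigma> = full_type n \<rho>"
  shows "\<exists>\<theta>\<in>hyperoct n. \<theta> \<circ> \<sigma> = \<rho> \<circ> \<theta>"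
proof -
  interpret s: hyperoct_elem n \<sigma> by unfold_locales fact
  interpret r: hyperoct_elem n \<rho> by unfold_locales fact
  let ?S = "orbs (sperm n \<sigma>) {1..n}" and ?R = "orbs (sperm n \<rho>) {1..n}"
  obtain \<phi> where bij: "bij_betw \<phi> ?S ?R"
    and \<phi>: "\<forall>U\<in>?S. (card (\<phi> U), prod (ssgn n \<rho>) (\<phi> U)) = (card U, prod (ssgn n \<sigma>) U)"
    using image_mset_set_eq_imp_bij[OF s.pi.finite_orbs r.pi.finite_orbs type[unfolded full_type_def]] by blast
  have \<phi>R: "\<phi> U \<in> ?R" if "U \<in> ?S" for U using bij that by (auto simp: bij_betw_def)
  have move_iff: "s.move m e (s.base U) = s.move m' e' (s.base U) \<longleftrightarrow>
      r.move m e (r.base (\<phi> U)) = r.move m' e' (r.base (\<phi> U))" if "U \<in> ?S" for U m e m' e'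
    using \<phi> that s.move_eq_iff[OF that] r.move_eq_iff[OF \<phi>R[OF that]] by simp
  define orb where "orb y = orbit (sperm n \<sigma>) (ab n y)" for y
  have orb: "orb y \<in> ?S" if "y \<in> {1..2*n}" for y unfolding orb_def by (rule s.orbs_abI[OF that])
  \<comment> \<open>The coordinates \<open>(m, e)\<close> of a point are not unique; by
    \<open>move_iff\<close> the value does not depend on the choice.\<close>
  define \<theta> where "\<theta> y = (if y \<in> {1..2*n} then
      (let (m, e) = SOME (m, e). y = s.move m e (s.base (orb y)) in r.move m e (r.base (\<phi> (orb y)))) else y)" for y
  have \<theta>: "\<theta> (s.move m e (s.base U)) = r.move m e (r.base (\<phi> U))" if U: "U \<in> ?S" for U m e
  proof -
    let ?y = "s.move m e (s.base U)"
    have y: "?y \<in> {1..2*n}" and o: "orb ?y = U"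
      using s.move_in[OF U] s.orbit_ab_move[OF U] by (simp_all add: orb_def del: atLeastAtMost_iff)
    obtain m' e' where me: "(SOME (m', e'). ?y = s.move m' e' (s.base (orb ?y))) = (m', e')" by fastforce
    have "case (SOME (m', e'). ?y = s.move m' e' (s.base (orb ?y))) of (m', e') \<Rightarrow> ?y = s.move m' e' (s.base (orb ?y))"
      by (rule someI[where x = "(m, e)"]) (simp add: o)
    then have "?y = s.move m' e' (s.base U)" unfolding me by (simp add: o)
    then have "r.move m e (r.base (\<phi> U)) = r.move m' e' (r.base (\<phi> U))" using move_iff[OF U] by simp
    then show ?thesis unfolding \<theta>_def me using y by (simp add: o del: atLeastAtMost_iff)
  qed
  have ex: "\<exists>U\<in>?S. \<exists>m e. y = s.move m e (s.base U)" if "y \<in> {1..2*n}" for y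
    using s.ex_move[OF that] orb[OF that] unfolding orb_def by blast
  have out: "\<theta> y = y" if "y \<notin> {1..2*n}" for y using that by (simp add: \<theta>_def del: atLeastAtMost_iff)
  have \<theta>_in: "\<theta> y \<in> {1..2*n}" if "y \<in> {1..2*n}" for y
    using ex[OF that] \<theta> r.move_in \<phi>R by metis
  have surj: "{1..2*n} \<subseteq> \<theta> ` {1..2*n}"
  proof
    fix y assume y: "y \<in> {1..2*n}"
    from r.ex_move[OF this] r.orbs_abI[OF this] obtain V m e where V: "V \<in> ?R" "y = r.move m e (r.base V)" by blast
    then have "V \<in> \<phi> ` ?S" using bij by (simp add: bij_betw_def)
    then obtain U where U: "U \<in> ?S" "\<phi> U = V" by blast
    then have "y = \<theta> (s.move m e (s.base U))" using \<theta> V by simp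
    then show "y \<in> \<theta> ` {1..2*n}" using s.move_in[OF U(1)] by blast
  qed
  have img: "\<theta> ` {1..2*n} = {1..2*n}" using surj \<theta>_in by blast
  have "inj_on \<theta> {1..2*n}" by (rule eq_card_imp_inj_on) (simp_all only: img finite_atLeastAtMost)
  then have "bij_betw \<theta> {1..2*n} {1..2*n}" using img by (rule bij_betw_imageI)
  then have perm: "\<theta> permutes {1..2*n}" using out by (intro bij_imp_permutes) auto
  have comm: "\<theta> (tau n y) = tau n (\<theta> y)" for y
  proof (cases "y \<in> {1..2*n}")
    case True
    then obtain U m e where U: "U \<in> ?S" "y = s.move m e (s.base U)" using ex by blast
    then have "tau n y = s.move m (Suc e) (s.base U)" by (simp add: s.move_def)
    then show ?thesis using \<theta>[OF U(1)] U(2) by (simp add: r.move_def)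
  next
    case False
    then have "tau n y = y" by (auto simp: tau_def)
    then show ?thesis using out[OF False] by simp
  qed
  have "\<theta> (\<sigma> y) = \<rho> (\<theta> y)" for y
  proof (cases "y \<in> {1..2*n}")
    case True
    then obtain U m e where U: "U \<in> ?S" "y = s.move m e (s.base U)" using ex by blast
    have "\<sigma> y = s.move (Suc m) e (s.base U)" unfolding U(2) by (simp add: s.move_def s.tau_funpow s.sigma_tau)
    then show ?thesis using \<theta>[OF U(1)] U(2) by (simp add: r.move_def r.tau_funpow r.sigma_tau)
  next
    case False
    then show ?thesis using out permutes_not_in[OF s.perm_sigma] permutes_not_in[OF r.perm_sigma] by metis
  qed
  then show ?thesis using perm comm by (intro bexI[of _ \<theta>]) (auto simp: hyperoct_def fun_eq_iff)
qed

lemma bip_class_conjugate: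
  assumes "\<sigma> \<in> bip_class n lam mu" "\<rho> \<in> bip_class n lam mu"
  shows "\<exists>\<theta>\<in>hyperoct n. \<theta> \<circ> \<sigma> = \<rho> \<circ> \<theta>"
proof -
  have h: "\<sigma> \<in> hyperoct n" "\<rho> \<in> hyperoct n" using assms by (auto simp: bip_class_def)
  interpret s: hyperoct_elem n \<sigma> by unfold_locales fact
  interpret r: hyperoct_elem n \<rho> by unfold_locales fact
  have "full_type n \<sigma> = full_type n \<rho>"
    using assms unfolding s.bip_class_iff r.bip_class_iff
    by (simp add: s.full_type_eq_signed_type r.full_type_eq_signed_type)
  then show ?thesis by (rule hyperoct_conjugate[OF h])
qed

declare One_nat_def [simp]

section \<open>The centre of the group algebra\<close>

abbreviation hinv :: "(nat \<Rightarrow> nat) \<Rightarrow> nat \<Rightarrow> nat" where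
  "hinv h \<equiv> inv_into UNIV h"

lemma hinv_simps:
  assumes "h \<in> hyperoct n"
  shows "h \<circ> hinv h = id" "hinv h \<circ> h = id" "h (hinv h x) = x" "hinv h (h x) = x" "hinv (hinv h) = h"
  using hyperoct_bij[OF assms]
  by (auto simp: fun_eq_iff bij_is_surj surj_f_inv_f bij_is_inj inv_inv_eq)

lemma hinv_comp: "h \<in> hyperoct n \<Longrightarrow> k \<in> hyperoct n \<Longrightarrow> hinv (h \<circ> k) = hinv k \<circ> hinv h"
  by (rule o_inv_distrib) (auto intro: hyperoct_bij)

lemma hinv_comp_in_iff: "h \<in> hyperoct n \<Longrightarrow> hinv h \<circ> g \<in> hyperoct n \<longleftrightarrow> g \<in> hyperoct n"
  using hyperoct_comp[of h n "hinv h \<circ> g"] hyperoct_comp[of "hinv h" n g] hyperoct_inv[of h n]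
  by (auto simp: o_assoc hinv_simps)

lemma sum_hyperoct_left:
  assumes "h \<in> hyperoct n"
  shows "(\<Sum>g\<in>hyperoct n. F g) = (\<Sum>g\<in>hyperoct n. F (h \<circ> g))"
  by (rule sum.reindex_bij_witness[where j = "\<lambda>g. hinv h \<circ> g" and i = "\<lambda>g. h \<circ> g"])
     (use assms in \<open>auto simp: o_assoc hinv_simps hinv_comp_in_iff intro: hyperoct_comp\<close>)

lemma sum_hyperoct_inv:
  assumes "g \<in> hyperoct n"
  shows "(\<Sum>k\<in>hyperoct n. F k) = (\<Sum>h\<in>hyperoct n. F (g \<circ> hinv h))"
proof (rule sum.reindex_bij_witness[where j = "\<lambda>k. hinv k \<circ> g" and i = "\<lambda>h. g \<circ> hinv h"])
  fix k assume k: "k \<in> hyperoct n"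
  show "g \<circ> hinv (hinv k \<circ> g) = k"
    unfolding hinv_comp[OF hyperoct_inv[OF k] assms] hinv_simps(5)[OF k]
    by (simp add: o_assoc hinv_simps[OF assms])
  then show "F (g \<circ> hinv (hinv k \<circ> g)) = F k" by simp
  show "hinv k \<circ> g \<in> hyperoct n" using k assms hyperoct_inv hyperoct_comp by blast
next
  fix h assume h: "h \<in> hyperoct n"
  show "hinv (g \<circ> hinv h) \<circ> g = h"
    unfolding hinv_comp[OF assms hyperoct_inv[OF h]] hinv_simps(5)[OF h]
    by (simp add: o_assoc[symmetric] hinv_simps[OF assms])
  show "g \<circ> hinv h \<in> hyperoct n" using h assms hyperoct_inv hyperoct_comp by blast
qed

lemma sum_hyperoct_conj:
  assumes "h \<in> hyperoct n"
  shows "(\<Sum>k\<in>hyperoct n. F k) = (\<Sum>k\<in>hyperoct n. F (h \<circ> k \<circ> hinv h))"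
  by (rule sum.reindex_bij_witness[where j = "\<lambda>k. hinv h \<circ> k \<circ> h" and i = "\<lambda>k. h \<circ> k \<circ> hinv h"])
     (use assms hyperoct_inv[OF assms] in
       \<open>auto simp: fun_eq_iff hinv_simps intro!: hyperoct_comp arg_cong[where f = F]\<close>)

text \<open>Commuting with the indicator of \<open>h\<close>, compared at
  \<open>h \<circ> \<sigma>\<close>, is invariance under conjugation by \<open>h\<close>.
  Conversely, the substitution \<open>k = g \<circ> hinv h\<close> turns one convolution into the
  other.\<close>

lemma centre_iff:
  "z \<in> centre n \<longleftrightarrow> z \<in> group_algebra n \<and>
     (\<forall>h\<in>hyperoct n. \<forall>\<sigma>\<in>hyperoct n. z (h \<circ> \<sigma> \<circ> hinv h) = z \<sigma>)"
proof (intro iffI conjI ballI)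
  assume z: "z \<in> centre n"
  then show "z \<in> group_algebra n" by (simp add: centre_def)
  fix h \<sigma> assume h: "h \<in> hyperoct n" and \<sigma>: "\<sigma> \<in> hyperoct n"
  define x :: galg where "x = (\<lambda>k. if k = h then 1 else 0)"
  have g: "h \<circ> \<sigma> \<in> hyperoct n" by (rule hyperoct_comp[OF h \<sigma>])
  have "x \<in> group_algebra n" using h by (auto simp: x_def group_algebra_def)
  then have eq: "conv n x z (h \<circ> \<sigma>) = conv n z x (h \<circ> \<sigma>)" using z by (simp add: centre_def)
  have "conv n x z (h \<circ> \<sigma>) = (\<Sum>k\<in>hyperoct n. if k = h then z (hinv k \<circ> (h \<circ> \<sigma>)) else 0)"
    unfolding conv_def x_def by (rule sum.cong) auto
  then have "conv n x z (h \<circ> \<sigma>) = z (hinv h \<circ> (h \<circ> \<sigma>))"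
    using h finite_hyperoct by simp
  then have eq': "conv n x z (h \<circ> \<sigma>) = z \<sigma>" using h by (simp add: o_assoc hinv_simps)
  have "conv n z x (h \<circ> \<sigma>) = (\<Sum>k\<in>hyperoct n. z (h \<circ> \<sigma> \<circ> hinv k) * x (hinv (h \<circ> \<sigma> \<circ> hinv k) \<circ> (h \<circ> \<sigma>)))"
    unfolding conv_def by (rule sum_hyperoct_inv[OF g])
  also have "\<dots> = (\<Sum>k\<in>hyperoct n. if k = h then z (h \<circ> \<sigma> \<circ> hinv k) else 0)"
  proof (rule sum.cong)
    fix k assume k: "k \<in> hyperoct n"
    have "hinv (h \<circ> \<sigma> \<circ> hinv k) \<circ> (h \<circ> \<sigma>) = k"
      unfolding hinv_comp[OF g hyperoct_inv[OF k]] hinv_simps(5)[OF k]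
      by (simp only: comp_assoc hinv_simps[OF g] comp_id)
    then show "z (h \<circ> \<sigma> \<circ> hinv k) * x (hinv (h \<circ> \<sigma> \<circ> hinv k) \<circ> (h \<circ> \<sigma>)) =
        (if k = h then z (h \<circ> \<sigma> \<circ> hinv k) else 0)" by (simp add: x_def)
  qed simp
  also have "\<dots> = z (h \<circ> \<sigma> \<circ> hinv h)" using h finite_hyperoct by simp
  finally show "z (h \<circ> \<sigma> \<circ> hinv h) = z \<sigma>" using eq eq' by simp
next
  assume *: "z \<in> group_algebra n \<and> (\<forall>h\<in>hyperoct n. \<forall>\<sigma>\<in>hyperoct n. z (h \<circ> \<sigma> \<circ> hinv h) = z \<sigma>)"
  have "conv n x z = conv n z x" if x: "x \<in> group_algebra n" for x
  proof
    fix g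
    show "conv n x z g = conv n z x g"
    proof (cases "g \<in> hyperoct n")
      case g: True
      have "conv n z x g = (\<Sum>h\<in>hyperoct n. z (g \<circ> hinv h) * x (hinv (g \<circ> hinv h) \<circ> g))"
        unfolding conv_def by (rule sum_hyperoct_inv[OF g])
      also have "\<dots> = (\<Sum>h\<in>hyperoct n. x h * z (hinv h \<circ> g))"
      proof (rule sum.cong)
        fix h assume h: "h \<in> hyperoct n"
        have "hinv (g \<circ> hinv h) \<circ> g = h"
          unfolding hinv_comp[OF g hyperoct_inv[OF h]] hinv_simps(5)[OF h]
          by (simp only: comp_assoc hinv_simps[OF g] comp_id)
        moreover have "z (g \<circ> hinv h) = z (hinv h \<circ> g)"
        proof -
          have "hinv h \<circ> g \<in> hyperoct n" using g h by (simp add: hinv_comp_in_iff)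
          then have "z (h \<circ> (hinv h \<circ> g) \<circ> hinv h) = z (hinv h \<circ> g)" using * h by blast
          then show ?thesis by (simp add: o_assoc hinv_simps[OF h])
        qed
        ultimately show "z (g \<circ> hinv h) * x (hinv (g \<circ> hinv h) \<circ> g) = x h * z (hinv h \<circ> g)" by simp
      qed simp
      finally show ?thesis by (simp add: conv_def)
    next
      case False
      then show ?thesis using * x by (simp add: conv_def group_algebra_def hinv_comp_in_iff)
    qed
  qed
  then show "z \<in> centre n" using * by (simp add: centre_def)
qed

lemma centreD: "z \<in> centre n \<Longrightarrow> h \<in> hyperoct n \<Longrightarrow> \<sigma> \<in> hyperoct n \<Longrightarrow> z (h \<circ> \<sigma> \<circ> hinv h) = z \<sigma>"
  by (simp add: centre_iff)

lemma conv_in_centre: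
  assumes "x \<in> centre n" "z \<in> centre n"
  shows "conv n x z \<in> centre n"
  unfolding centre_iff
proof (intro conjI ballI)
  show "conv n x z \<in> group_algebra n"
    using assms by (auto simp: centre_iff group_algebra_def conv_def hinv_comp_in_iff)
  fix h \<sigma> assume h: "h \<in> hyperoct n" and \<sigma>: "\<sigma> \<in> hyperoct n"
  have "conv n x z (h \<circ> \<sigma> \<circ> hinv h) =
      (\<Sum>k\<in>hyperoct n. x (h \<circ> k \<circ> hinv h) * z (hinv (h \<circ> k \<circ> hinv h) \<circ> (h \<circ> \<sigma> \<circ> hinv h)))"
    unfolding conv_def by (rule sum_hyperoct_conj[OF h])
  also have "\<dots> = (\<Sum>k\<in>hyperoct n. x k * z (hinv k \<circ> \<sigma>))"
  proof (rule sum.cong)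
    fix k assume k: "k \<in> hyperoct n"
    have "hinv (h \<circ> k \<circ> hinv h) = h \<circ> hinv k \<circ> hinv h"
      unfolding hinv_comp[OF hyperoct_comp[OF h k] hyperoct_inv[OF h]] hinv_comp[OF h k] hinv_simps(5)[OF h]
      by (simp add: o_assoc)
    then have "hinv (h \<circ> k \<circ> hinv h) \<circ> (h \<circ> \<sigma> \<circ> hinv h) = h \<circ> (hinv k \<circ> \<sigma>) \<circ> hinv h"
      by (simp add: fun_eq_iff hinv_simps[OF h])
    moreover have "hinv k \<circ> \<sigma> \<in> hyperoct n" using k \<sigma> by (simp add: hinv_comp_in_iff)
    ultimately show "x (h \<circ> k \<circ> hinv h) * z (hinv (h \<circ> k \<circ> hinv h) \<circ> (h \<circ> \<sigma> \<circ> hinv h)) = x k * z (hinv k \<circ> \<sigma>)"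
      using centreD[OF assms(1) h k] centreD[OF assms(2) h] by simp
  qed simp
  finally show "conv n x z (h \<circ> \<sigma> \<circ> hinv h) = conv n x z \<sigma>" by (simp add: conv_def)
qed

lemma indicator_in_centre:
  assumes "S \<subseteq> hyperoct n" "\<And>h \<sigma>. h \<in> hyperoct n \<Longrightarrow> \<sigma> \<in> S \<Longrightarrow> h \<circ> \<sigma> \<circ> hinv h \<in> S"
  shows "indicator S \<in> centre n"
  unfolding centre_iff
proof (intro conjI ballI)
  show "indicator S \<in> group_algebra n" using assms(1) by (auto simp: group_algebra_def indicator_def)
  fix h \<sigma> assume h: "h \<in> hyperoct n" and \<sigma>: "\<sigma> \<in> hyperoct n"
  have "hinv h \<circ> (h \<circ> \<sigma> \<circ> hinv h) \<circ> hinv (hinv h) = \<sigma>"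
    unfolding hinv_simps(5)[OF h] by (simp add: fun_eq_iff hinv_simps[OF h])
  then have "h \<circ> \<sigma> \<circ> hinv h \<in> S \<longleftrightarrow> \<sigma> \<in> S"
    using assms(2)[OF h, of \<sigma>] assms(2)[OF hyperoct_inv[OF h], of "h \<circ> \<sigma> \<circ> hinv h"] by auto
  then show "indicator S (h \<circ> \<sigma> \<circ> hinv h) = (indicator S \<sigma> :: complex)" by (simp add: indicator_def)
qed

lemma conj_transpose:
  assumes "h \<in> hyperoct n"
  shows "h (transpose i j (hinv h x)) = transpose (h i) (h j) x"
  using transpose_apply_commute[OF hyperoct_bij[OF assms], of "h i" "h j" "hinv h x"]
  by (simp add: hinv_simps[OF assms])

lemma hyperoct_tau: "h \<in> hyperoct n \<Longrightarrow> h (tau n x) = tau n (h x)"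
  by (auto simp: hyperoct_def fun_eq_iff)

lemma hyperoct_in: "h \<in> hyperoct n \<Longrightarrow> h x \<in> {1..2*n} \<longleftrightarrow> x \<in> {1..2*n}"
  using permutes_in_image[of h "{1..2*n}" x] by (auto simp: hyperoct_def)

lemma hyperoct_inj: "h \<in> hyperoct n \<Longrightarrow> h x = h y \<longleftrightarrow> x = y"
  using hyperoct_bij[of h n] by (auto simp: bij_def inj_def)

lemma T1_in_centre: "T1 n \<in> centre n"
proof -
  have "indicator (r_refls n) \<in> centre n"
  proof (rule indicator_in_centre[OF r_refls_subset])
    fix h \<sigma> assume h: "h \<in> hyperoct n" and "\<sigma> \<in> r_refls n"
    then obtain i j where ij: "i \<in> {1..2*n}" "j \<in> {1..2*n}" "i \<noteq> j" "j \<noteq> tau n i" "\<sigma> = r_refl n i j"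
      unfolding r_refls_def by blast
    have "h \<circ> \<sigma> \<circ> hinv h = r_refl n (h i) (h j)"
    proof
      fix x
      have "h (transpose i j (transpose (tau n i) (tau n j) (hinv h x))) =
          h (transpose i j (hinv h (h (transpose (tau n i) (tau n j) (hinv h x)))))"
        by (simp add: hinv_simps[OF h])
      also have "\<dots> = transpose (h i) (h j) (transpose (h (tau n i)) (h (tau n j)) x)"
        by (simp only: conj_transpose[OF h])
      finally show "(h \<circ> \<sigma> \<circ> hinv h) x = r_refl n (h i) (h j) x"
        by (simp add: ij(5) r_refl_def hyperoct_tau[OF h])
    qed
    moreover have "h i \<in> {1..2*n}" "h j \<in> {1..2*n}" using ij hyperoct_in[OF h] by blast+
    moreover have "h i \<noteq> h j" "h j \<noteq> tau n (h i)"
      using ij by (simp_all add: hyperoct_inj[OF h] flip: hyperoct_tau[OF h])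
    ultimately show "h \<circ> \<sigma> \<circ> hinv h \<in> r_refls n" unfolding r_refls_def by blast
  qed
  then show ?thesis by (simp add: T1_def r_refls_def)
qed

lemma T2_in_centre: "T2 n \<in> centre n"
proof -
  have "indicator (l_refls n) \<in> centre n"
  proof (rule indicator_in_centre[OF l_refls_subset])
    fix h \<sigma> assume h: "h \<in> hyperoct n" and "\<sigma> \<in> l_refls n"
    then obtain i where i: "i \<in> {1..2*n}" "\<sigma> = l_refl n i"
      unfolding l_refls_def by blast
    have "h \<circ> \<sigma> \<circ> hinv h = l_refl n (h i)"
      by (simp add: fun_eq_iff i l_refl_def conj_transpose[OF h] hyperoct_tau[OF h])
    moreover have "h i \<in> {1..2*n}" using i hyperoct_in[OF h] by blast
    ultimately show "h \<circ> \<sigma> \<circ> hinv h \<in> l_refls n" unfolding l_refls_def by blast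
  qed
  then show ?thesis by (simp add: T2_def l_refls_def)
qed

lemma bip_class_subset: "bip_class n lam mu \<subseteq> hyperoct n"
  by (auto simp: bip_class_def)

lemma inj_on_image_fun: "inj f \<Longrightarrow> inj_on (image f) S"
  by (rule inj_onI) (simp add: inj_image_eq_iff)

text \<open>The map \<open>h\<close> carries cycles of \<open>\<sigma>\<close> to cycles of the
  conjugate and commutes with \<open>tau n\<close>, so both kinds and all lengths are
  preserved.\<close>

lemma bip_class_conj:
  assumes h: "h \<in> hyperoct n" and \<sigma>: "\<sigma> \<in> bip_class n lam mu"
  shows "h \<circ> \<sigma> \<circ> hinv h \<in> bip_class n lam mu"
proof -
  let ?\<rho> = "h \<circ> \<sigma> \<circ> hinv h"
  have \<sigma>H: "\<sigma> \<in> hyperoct n" using \<sigma> bip_class_subset by blast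
  interpret s: hyperoct_elem n \<sigma> by unfold_locales (rule \<sigma>H)
  have inj: "inj h" using hyperoct_bij[OF h] by (rule bij_is_inj)
  have inj1: "inj_on (image h) S" for S by (rule inj_on_image_fun[OF inj])
  have inj2: "inj_on (image (image h)) S" for S by (rule inj_on_image_fun[OF inj1])
  have orb: "h ` orbit \<sigma> x = orbit ?\<rho> (h x)" for x
    by (rule orbit_inverse) (simp_all add: hinv_simps[OF h])
  have "h ` {1..2*n} = {1..2*n}" using h by (auto simp: hyperoct_def permutes_image)
  then have "cycles n ?\<rho> = orbit ?\<rho> ` h ` {1..2*n}" unfolding cycles_def by simp
  also have "\<dots> = image h ` cycles n \<sigma>" unfolding cycles_def by (simp add: image_image orb)
  finally have cyc: "cycles n ?\<rho> = image h ` cycles n \<sigma>" .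
  have tau: "tau n ` h ` c = h ` tau n ` c" for c by (simp add: image_image hyperoct_tau[OF h])
  have P: "tau n ` h ` c = h ` c \<longleftrightarrow> tau n ` c = c" for c
    unfolding tau by (rule inj_image_eq_iff[OF inj])
  have Col: "{c \<in> image h ` C. Q c} = image h ` {c \<in> C. Q (h ` c)}" for C Q by blast
  have alpha: "alpha_pairs n \<sigma>' = (\<lambda>c. {c, tau n ` c}) ` {c \<in> cycles n \<sigma>'. tau n ` c \<noteq> c}" for \<sigma>'
    unfolding alpha_pairs_def by blast
  have "{c \<in> cycles n ?\<rho>. tau n ` c \<noteq> c} = image h ` {c \<in> cycles n \<sigma>. tau n ` c \<noteq> c}"
    unfolding cyc Col P ..
  then have "alpha_pairs n ?\<rho> = (\<lambda>c. {c, tau n ` c}) ` image h ` {c \<in> cycles n \<sigma>. tau n ` c \<noteq> c}"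
    by (simp only: alpha)
  also have "\<dots> = (\<lambda>c. {h ` c, tau n ` h ` c}) ` {c \<in> cycles n \<sigma>. tau n ` c \<noteq> c}"
    by (rule image_image)
  also have "\<dots> = (\<lambda>c. image h ` {c, tau n ` c}) ` {c \<in> cycles n \<sigma>. tau n ` c \<noteq> c}"
    by (simp only: tau image_insert image_empty)
  also have "\<dots> = image (image h) ` (\<lambda>c. {c, tau n ` c}) ` {c \<in> cycles n \<sigma>. tau n ` c \<noteq> c}"
    by (rule image_image[symmetric])
  also have "\<dots> = image (image h) ` alpha_pairs n \<sigma>" by (simp only: alpha)
  finally have "alpha_pairs n ?\<rho> = image (image h) ` alpha_pairs n \<sigma>" .
  then have a: "image_mset (\<lambda>pr. card (\<Union>pr) div 2) (mset_set (alpha_pairs n ?\<rho>)) =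
      image_mset (\<lambda>pr. card (\<Union>(image h ` pr)) div 2) (mset_set (alpha_pairs n \<sigma>))"
    by (simp add: image_mset_mset_set[OF inj2, symmetric] multiset.map_comp o_def)
  have a': "card (\<Union>(image h ` pr)) = card (\<Union>pr)" for pr
    unfolding image_Union[symmetric] by (rule card_image) (rule inj_on_subset[OF inj subset_UNIV])
  have "beta_cycles n ?\<rho> = image h ` beta_cycles n \<sigma>"
    unfolding beta_cycles_def cyc Col P ..
  then have b: "image_mset card (mset_set (beta_cycles n ?\<rho>)) =
      image_mset (\<lambda>c. card (h ` c)) (mset_set (beta_cycles n \<sigma>))"
    by (simp add: image_mset_mset_set[OF inj1, symmetric] multiset.map_comp o_def)
  have b': "card (h ` c) = card c" for c
    by (rule card_image) (rule inj_on_subset[OF inj subset_UNIV])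
  have "?\<rho> \<in> hyperoct n" using h \<sigma>H hyperoct_inv hyperoct_comp by blast
  then show ?thesis using \<sigma> unfolding bip_class_def by (simp add: a[unfolded a'] b[unfolded b'])
qed

lemma centre_lin:
  assumes "x \<in> centre n" "y \<in> centre n"
  shows "(\<lambda>\<sigma>. a * x \<sigma> + b * y \<sigma>) \<in> centre n"
  using assms by (simp add: centre_iff group_algebra_def)

lemma zero_in_centre: "(\<lambda>\<sigma>. 0) \<in> centre n"
  by (simp add: centre_iff group_algebra_def)

lemma class_average_in_centre: "class_average n lam mu \<in> centre n"
  using centre_lin[OF indicator_in_centre[OF bip_class_subset bip_class_conj] zero_in_centre,
      of n lam mu "1 / of_nat (card (bip_class n lam mu))" 0]
  by (simp add: class_average_def)

section \<open>The isomorphism to polynomials\<close>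

definition class_monomial :: "nat \<Rightarrow> (nat \<Rightarrow> nat) \<Rightarrow> pq_poly" where
  "class_monomial n = cycle_weight n (\<lambda>k s. if s = 1 then p_var k else q_var k)"

lemma class_monomial_eq:
  assumes "\<sigma> \<in> bip_class n lam mu"
  shows "class_monomial n \<sigma> = prod_list (map p_var lam) * prod_list (map q_var mu)"
proof -
  interpret hyperoct_elem n \<sigma> by unfold_locales (use assms bip_class_subset in blast)
  show ?thesis
    using assms unfolding bip_class_iff class_monomial_def cycle_weight_eq
    by (simp flip: mset_map add: prod_mset_prod_list)
qed

lemma bip_class_eq:
  assumes "\<rho> \<in> bip_class n lam mu"
  shows "bip_class n lam mu = {\<sigma> \<in> hyperoct n. full_type n \<sigma> = full_type n \<rho>}"
proof (intro equalityI subsetI)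
  have \<rho>: "\<rho> \<in> hyperoct n" using assms bip_class_subset by blast
  interpret r: hyperoct_elem n \<rho> by unfold_locales fact
  fix \<sigma>
  {
    assume \<sigma>: "\<sigma> \<in> bip_class n lam mu"
    then have "\<sigma> \<in> hyperoct n" using bip_class_subset by blast
    then interpret s: hyperoct_elem n \<sigma> by unfold_locales
    show "\<sigma> \<in> {\<sigma> \<in> hyperoct n. full_type n \<sigma> = full_type n \<rho>}"
      using \<sigma> assms \<open>\<sigma> \<in> hyperoct n\<close> unfolding s.bip_class_iff r.bip_class_iff
      by (simp add: s.full_type_eq_signed_type r.full_type_eq_signed_type)
  }
  assume \<sigma>: "\<sigma> \<in> {\<sigma> \<in> hyperoct n. full_type n \<sigma> = full_type n \<rho>}"
  then interpret s: hyperoct_elem n \<sigma> by unfold_locales simp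
  show "\<sigma> \<in> bip_class n lam mu"
    using \<sigma> assms unfolding s.bip_class_iff r.bip_class_iff
    by (simp add: s.signed_type_eq_full_type r.signed_type_eq_full_type)
qed

lemma finite_bip_class: "finite (bip_class n lam mu)"
  using bip_class_subset finite_hyperoct by (rule finite_subset)

definition Psi_sum :: "nat \<Rightarrow> galg \<Rightarrow> pq_poly" where
  "Psi_sum n z = (\<Sum>\<sigma>\<in>hyperoct n. Const (z \<sigma>) * class_monomial n \<sigma>)"

lemma Psi_sum_lin:
  "Psi_sum n (\<lambda>\<sigma>. a * x \<sigma> + b * y \<sigma>) = Const a * Psi_sum n x + Const b * Psi_sum n y"
  by (simp add: Psi_sum_def Const_add Const_mult distrib_right sum.distrib sum_distrib_left mult.assoc)

lemma Psi_sum_class_average: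
  assumes "is_partition lam" "is_partition mu" "sum_list lam + sum_list mu = n"
  shows "Psi_sum n (class_average n lam mu) = prod_list (map p_var lam) * prod_list (map q_var mu)"
proof -
  let ?B = "bip_class n lam mu" and ?m = "prod_list (map p_var lam) * prod_list (map q_var mu)"
  have "Psi_sum n (class_average n lam mu) = (\<Sum>\<sigma>\<in>?B. Const (1 / of_nat (card ?B)) * ?m)"
    unfolding Psi_sum_def
    by (rule sum.mono_neutral_cong_right)
       (use finite_hyperoct bip_class_subset in \<open>auto simp: class_average_def indicator_def class_monomial_eq\<close>)
  also have "\<dots> = (Const (of_nat (card ?B)) * Const (1 / of_nat (card ?B))) * ?m"
    by (simp add: mult.assoc)
  also have "\<dots> = ?m"
    using bip_class_nonempty[OF assms] finite_bip_class[of n lam mu]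
    by (subst Const_mult_inverse) auto
  finally show ?thesis .
qed

lemma linear_on_centre_sum:
  assumes F: "\<forall>x\<in>centre n. \<forall>y\<in>centre n. \<forall>a b. F (\<lambda>\<sigma>. a * x \<sigma> + b * y \<sigma>) = Const a * F x + Const b * F y"
    and "finite S" and y: "\<And>i. i \<in> S \<Longrightarrow> y i \<in> centre n"
  shows "(\<lambda>\<sigma>. \<Sum>i\<in>S. c i * y i \<sigma>) \<in> centre n \<and>
    F (\<lambda>\<sigma>. \<Sum>i\<in>S. c i * y i \<sigma>) = (\<Sum>i\<in>S. Const (c i) * F (y i))"
  using assms(2) y
proof (induction S rule: finite_induct)
  case empty
  have "F (\<lambda>\<sigma>. 0 * 0 + 0 * 0) = Const 0 * F (\<lambda>\<sigma>. 0) + Const 0 * F (\<lambda>\<sigma>. 0)"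
    by (rule F[THEN bspec, OF zero_in_centre, THEN bspec, OF zero_in_centre, THEN spec, THEN spec])
  then show ?case using zero_in_centre by simp
next
  case (insert i S)
  let ?x = "\<lambda>\<sigma>. \<Sum>i\<in>S. c i * y i \<sigma>"
  have x: "?x \<in> centre n" "F ?x = (\<Sum>i\<in>S. Const (c i) * F (y i))" using insert by simp_all
  have yi: "y i \<in> centre n" using insert.prems by simp
  have eq: "(\<lambda>\<sigma>. \<Sum>j\<in>insert i S. c j * y j \<sigma>) = (\<lambda>\<sigma>. c i * y i \<sigma> + 1 * ?x \<sigma>)"
    using insert.hyps by simp
  have "F (\<lambda>\<sigma>. c i * y i \<sigma> + 1 * ?x \<sigma>) = Const (c i) * F (y i) + Const 1 * F ?x"
    by (rule F[THEN bspec, OF yi, THEN bspec, OF x(1), THEN spec, THEN spec])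
  then show ?case unfolding eq
    using centre_lin[OF yi x(1), of "c i" 1] x(2) insert.hyps by simp
qed

text \<open>A central \<open>z\<close> is the sum over all group elements \<open>\<rho>\<close> of
  \<open>z \<rho>\<close> times the average of the class of \<open>\<rho>\<close>: each class
  average is used as often as its class has elements, so no representatives of classes are needed.
  That \<open>z\<close> is constant on a class rests on \<open>bip_class_conjugate\<close>.\<close>

lemma linear_on_centre_eq_Psi_sum:
  assumes F: "\<forall>x\<in>centre n. \<forall>y\<in>centre n. \<forall>a b. F (\<lambda>\<sigma>. a * x \<sigma> + b * y \<sigma>) = Const a * F x + Const b * F y"
    and avg: "\<forall>lam mu. is_partition lam \<and> is_partition mu \<and> sum_list lam + sum_list mu = n \<longrightarrow>
        F (class_average n lam mu) = prod_list (map p_var lam) * prod_list (map q_var mu)"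
    and z: "z \<in> centre n"
  shows "F z = Psi_sum n z"
proof -
  have "\<exists>lam mu. is_partition lam \<and> is_partition mu \<and> sum_list lam + sum_list mu = n \<and> \<rho> \<in> bip_class n lam mu"
    if "\<rho> \<in> hyperoct n" for \<rho>
  proof -
    interpret hyperoct_elem n \<rho> by unfold_locales fact
    show ?thesis using in_some_bip_class by metis
  qed
  then obtain lam mu where part: "\<And>\<rho>. \<rho> \<in> hyperoct n \<Longrightarrow> is_partition (lam \<rho>) \<and> is_partition (mu \<rho>) \<and>
      sum_list (lam \<rho>) + sum_list (mu \<rho>) = n \<and> \<rho> \<in> bip_class n (lam \<rho>) (mu \<rho>)" by metis
  define B where "B \<rho> = bip_class n (lam \<rho>) (mu \<rho>)" for \<rho>
  have B: "B \<rho> = {\<sigma> \<in> hyperoct n. full_type n \<sigma> = full_type n \<rho>}" if "\<rho> \<in> hyperoct n" for \<rho>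
    unfolding B_def using bip_class_eq part[OF that] by blast
  let ?y = "\<lambda>\<rho>. class_average n (lam \<rho>) (mu \<rho>)"
  have "z = (\<lambda>\<sigma>. \<Sum>\<rho>\<in>hyperoct n. z \<rho> * ?y \<rho> \<sigma>)"
  proof
    fix \<sigma>
    show "z \<sigma> = (\<Sum>\<rho>\<in>hyperoct n. z \<rho> * ?y \<rho> \<sigma>)"
    proof (cases "\<sigma> \<in> hyperoct n")
      case True
      have z_eq: "z \<rho> = z \<sigma>" if "\<rho> \<in> B \<sigma>" for \<rho>
      proof -
        have "\<sigma> \<in> bip_class n (lam \<sigma>) (mu \<sigma>)" "\<rho> \<in> bip_class n (lam \<sigma>) (mu \<sigma>)"
          using that part[OF True] unfolding B_def by blast+
        from bip_class_conjugate[OF this] obtain \<theta> where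
          \<theta>: "\<theta> \<in> hyperoct n" "\<theta> \<circ> \<sigma> = \<rho> \<circ> \<theta>" by blast
        have "\<theta> \<circ> \<sigma> \<circ> hinv \<theta> = \<rho>" unfolding \<theta>(2) by (simp only: comp_assoc hinv_simps[OF \<theta>(1)] comp_id)
        then show ?thesis using centreD[OF z \<theta>(1) True] by simp
      qed
      have "(\<Sum>\<rho>\<in>hyperoct n. z \<rho> * ?y \<rho> \<sigma>) = (\<Sum>\<rho>\<in>B \<sigma>. z \<sigma> / of_nat (card (B \<sigma>)))"
      proof (rule sum.mono_neutral_cong_right)
        show "finite (hyperoct n)" by (rule finite_hyperoct)
        show "B \<sigma> \<subseteq> hyperoct n" unfolding B_def by (rule bip_class_subset)
        show "\<forall>\<rho>\<in>hyperoct n - B \<sigma>. z \<rho> * ?y \<rho> \<sigma> = 0"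
        proof
          fix \<rho> assume "\<rho> \<in> hyperoct n - B \<sigma>"
          then have "\<sigma> \<notin> B \<rho>" using B True by auto
          then show "z \<rho> * ?y \<rho> \<sigma> = 0" by (simp add: class_average_def B_def)
        qed
        fix \<rho> assume \<rho>: "\<rho> \<in> B \<sigma>"
        then have "\<rho> \<in> hyperoct n" using B[OF True] by simp
        then have "B \<rho> = B \<sigma>" "\<sigma> \<in> B \<rho>" using \<rho> B True by auto
        then show "z \<rho> * ?y \<rho> \<sigma> = z \<sigma> / of_nat (card (B \<sigma>))"
          using z_eq[OF \<rho>] by (simp add: class_average_def B_def)
      qed
      moreover have "B \<sigma> \<noteq> {}" "finite (B \<sigma>)"
        using part[OF True] finite_bip_class unfolding B_def by auto
      ultimately show ?thesis by simp
    next
      case False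
      then have "\<sigma> \<notin> bip_class n (lam \<rho>) (mu \<rho>)" for \<rho> using bip_class_subset by blast
      then have "?y \<rho> \<sigma> = 0" for \<rho> by (simp add: class_average_def)
      moreover have "z \<sigma> = 0" using z False by (simp add: centre_def group_algebra_def)
      ultimately show ?thesis by simp
    qed
  qed
  then have "F z = (\<Sum>\<rho>\<in>hyperoct n. Const (z \<rho>) * F (?y \<rho>))"
    using linear_on_centre_sum[OF F finite_hyperoct, of n ?y z] class_average_in_centre by metis
  also have "\<dots> = Psi_sum n z"
    unfolding Psi_sum_def
  proof (rule sum.cong)
    fix \<rho> assume "\<rho> \<in> hyperoct n"
    then have "F (?y \<rho>) = class_monomial n \<rho>" using avg part class_monomial_eq by metis
    then show "Const (z \<rho>) * F (?y \<rho>) = Const (z \<rho>) * class_monomial n \<rho>" by simp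
  qed simp
  finally show ?thesis .
qed

text \<open>Existence is the restriction of \<open>Psi_sum\<close>. Linearity and the class averages
  fix the values on the centre, extensionality those outside it.\<close>

lemma Psi_eq_Psi_sum:
  assumes "z \<in> centre n"
  shows "Psi n z = Psi_sum n z"
proof -
  have "Psi n = restrict (Psi_sum n) (centre n)"
    unfolding Psi_def
  proof (rule the_equality)
    show "restrict (Psi_sum n) (centre n) \<in> extensional (centre n) \<and>
     (\<forall>x\<in>centre n. \<forall>y\<in>centre n. \<forall>a b.
        restrict (Psi_sum n) (centre n) (\<lambda>\<sigma>. a * x \<sigma> + b * y \<sigma>) =
        Const a * restrict (Psi_sum n) (centre n) x + Const b * restrict (Psi_sum n) (centre n) y) \<and>
     (\<forall>lam mu. is_partition lam \<and> is_partition mu \<and> sum_list lam + sum_list mu = n \<longrightarrow>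
        restrict (Psi_sum n) (centre n) (class_average n lam mu) = prod_list (map p_var lam) * prod_list (map q_var mu))"
      by (simp add: Psi_sum_lin Psi_sum_class_average centre_lin class_average_in_centre)
  next
    fix F
    assume F: "F \<in> extensional (centre n) \<and>
     (\<forall>x\<in>centre n. \<forall>y\<in>centre n. \<forall>a b.
        F (\<lambda>\<sigma>. a * x \<sigma> + b * y \<sigma>) = Const a * F x + Const b * F y) \<and>
     (\<forall>lam mu. is_partition lam \<and> is_partition mu \<and> sum_list lam + sum_list mu = n \<longrightarrow>
        F (class_average n lam mu) = prod_list (map p_var lam) * prod_list (map q_var mu))"
    then have "F z = restrict (Psi_sum n) (centre n) z" if "z \<in> centre n" for z
      using linear_on_centre_eq_Psi_sum[of n F z] that by simp
    then show "F = restrict (Psi_sum n) (centre n)"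
      using F by (intro extensionalityI[of _ "centre n"]) auto
  qed
  then show ?thesis using assms by simp
qed

section \<open>Surjectivity of the isomorphism and homogeneous components\<close>

lemma mono_deg_superset:
  "finite S \<Longrightarrow> keys m \<subseteq> S \<Longrightarrow> mono_deg m = (\<Sum>v\<in>S. lookup m v * var_deg v)"
  unfolding mono_deg_def by (rule sum.mono_neutral_left) (auto simp: in_keys_iff)

lemma mono_deg_add: "mono_deg (m + m') = mono_deg m + mono_deg m'"
proof -
  have "keys (m + m') \<subseteq> keys m \<union> keys m'" by (rule keys_add)
  then show ?thesis
    by (simp add: mono_deg_superset[of "keys m \<union> keys m'"] lookup_add distrib_right sum.distrib)
qed

lemma mono_deg_single: "mono_deg (single v k) = k * var_deg v"
  by (simp add: mono_deg_def)

lemma monomial_eq_prod_mset: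
  "\<exists>P Q. 0 \<notin># P \<and> 0 \<notin># Q \<and> \<Sum>\<^sub># P + \<Sum>\<^sub># Q = mono_deg m \<and>
     (single m 1 :: pq_poly) = (\<Prod>k\<in>#P. p_var k) * (\<Prod>k\<in>#Q. q_var k)"
proof (induction "mono_deg m" arbitrary: m rule: less_induct)
  case less
  show ?case
  proof (cases "keys m = {}")
    case True
    then have "m = 0" by simp
    then show ?thesis by (intro exI[of _ "{#}"]) (simp add: mono_deg_def)
  next
    case False
    then obtain v where v: "v \<in> keys m" by blast
    define m' where "m' = m - single v 1"
    have m: "m = m' + single v 1"
      using v by (auto simp: m'_def poly_mapping_eq_iff fun_eq_iff lookup_minus lookup_add
          lookup_single when_def in_keys_iff)
    have deg: "mono_deg m = mono_deg m' + var_deg v" by (simp add: m mono_deg_add mono_deg_single)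
    have "0 < var_deg v" by (cases v) auto
    then obtain P Q where PQ: "0 \<notin># P" "0 \<notin># Q" "\<Sum>\<^sub># P + \<Sum>\<^sub># Q = mono_deg m'"
      "(single m' 1 :: pq_poly) = (\<Prod>k\<in>#P. p_var k) * (\<Prod>k\<in>#Q. q_var k)"
      using less[of m'] deg by auto
    have s: "(single m 1 :: pq_poly) = single m' 1 * Var v"
      by (simp add: m Var_def mult_single)
    show ?thesis
    proof (cases v)
      case (PVar i)
      then have "p_var (i + 1) = Var v" by (simp add: p_var_def)
      with PVar show ?thesis using PQ s deg
        by - (rule exI[of _ "add_mset (i + 1) P"], rule exI[of _ Q], auto simp: mult_ac)
    next
      case (QVar i)
      then have "q_var (i + 1) = Var v" by (simp add: q_var_def)
      with QVar show ?thesis using PQ s deg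
        by - (rule exI[of _ P], rule exI[of _ "add_mset (i + 1) Q"], auto simp: mult_ac)
    qed
  qed
qed

lemma monomial_in_Psi_image:
  assumes "mono_deg m = n"
  shows "\<exists>z\<in>centre n. Psi n z = single m 1"
proof -
  obtain P Q where PQ: "0 \<notin># P" "0 \<notin># Q" "\<Sum>\<^sub># P + \<Sum>\<^sub># Q = mono_deg m"
    "(single m 1 :: pq_poly) = (\<Prod>k\<in>#P. p_var k) * (\<Prod>k\<in>#Q. q_var k)"
    using monomial_eq_prod_mset by metis
  define lam mu where "lam = rev (sorted_list_of_multiset P)" and "mu = rev (sorted_list_of_multiset Q)"
  have mset: "mset lam = P" "mset mu = Q" by (simp_all add: lam_def mu_def)
  have part: "is_partition lam" "is_partition mu"
    using PQ(1,2) by (simp_all add: is_partition_def lam_def mu_def sorted_wrt_rev)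
  have sum: "sum_list lam + sum_list mu = n"
    using PQ(3) assms by (simp flip: mset sum_mset_sum_list)
  have "Psi n (class_average n lam mu) = prod_list (map p_var lam) * prod_list (map q_var mu)"
    using Psi_sum_class_average[OF part sum] Psi_eq_Psi_sum[OF class_average_in_centre] by simp
  also have "\<dots> = single m 1"
    unfolding PQ(4) mset[symmetric] by (simp flip: mset_map add: prod_mset_prod_list)
  finally show ?thesis using class_average_in_centre by blast
qed

text \<open>Surjectivity onto degree \<open>n\<close>; hence \<open>inv_into\<close> in
  \<open>transported\<close> yields a genuine central preimage.\<close>

lemma hom_component_in_Psi_image: "hom_component n f \<in> Psi n ` centre n"
proof -
  let ?S = "{m \<in> keys f. mono_deg m = n}"
  have "\<forall>m\<in>?S. \<exists>z\<in>centre n. Psi n z = single m 1" using monomial_in_Psi_image by blast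
  then obtain y where y: "\<And>m. m \<in> ?S \<Longrightarrow> y m \<in> centre n \<and> Psi n (y m) = single m 1" by metis
  have lin: "\<forall>x\<in>centre n. \<forall>y\<in>centre n. \<forall>a b. Psi n (\<lambda>\<sigma>. a * x \<sigma> + b * y \<sigma>) = Const a * Psi n x + Const b * Psi n y"
    by (simp add: Psi_eq_Psi_sum centre_lin Psi_sum_lin)
  have fin: "finite ?S" by simp
  define z where "z = (\<lambda>\<sigma>. \<Sum>i\<in>?S. lookup f i * y i \<sigma>)"
  have z: "z \<in> centre n" "Psi n z = (\<Sum>m\<in>?S. Const (lookup f m) * Psi n (y m))"
    unfolding z_def using linear_on_centre_sum[OF lin fin, of y "lookup f"] y by blast+
  note z(2)
  also have "(\<Sum>m\<in>?S. Const (lookup f m) * Psi n (y m)) = hom_component n f"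
    unfolding hom_component_def
  proof (rule sum.cong)
    fix m assume "m \<in> ?S"
    then have "Psi n (y m) = single m 1" using y by blast
    then show "Const (lookup f m) * Psi n (y m) = single m (lookup f m)"
      by (simp only: single_conv_Const[of m "lookup f m", symmetric])
  qed simp
  finally show ?thesis using z(1) by (metis imageI)
qed

lemma sum_hom_components: "(\<Sum>n\<in>mono_deg ` keys f. hom_component n f) = f"
  using sum.image_gen[of "keys f" "\<lambda>m. single m (lookup f m)" mono_deg]
  unfolding hom_component_def cpoly_sum_monomials by simp

lemma mono_deg_eq_0_iff: "mono_deg m = 0 \<longleftrightarrow> m = 0"
proof
  assume *: "mono_deg m = 0"
  have "lookup m v = 0" for v
  proof (rule ccontr)
    assume "lookup m v \<noteq> 0"
    then have "v \<in> keys m" by (simp add: in_keys_iff)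
    moreover have "0 < var_deg v" by (cases v) auto
    ultimately show False using * \<open>lookup m v \<noteq> 0\<close> by (auto simp: mono_deg_def)
  qed
  then show "m = 0" by (intro poly_mapping_eqI) simp
qed (simp add: mono_deg_def)

lemma hom_component_0: "hom_component 0 f = Const (lookup f 0)"
proof -
  have "{m \<in> keys f. mono_deg m = 0} = (if 0 \<in> keys f then {0} else {})"
    by (auto simp: mono_deg_eq_0_iff)
  then show ?thesis by (simp add: hom_component_def Const_def in_keys_iff)
qed

definition clinear_map :: "('v cpoly \<Rightarrow> 'w cpoly) \<Rightarrow> bool" where
  "clinear_map F \<longleftrightarrow> (\<forall>f g. F (f + g) = F f + F g) \<and> (\<forall>c f. F (Const c * f) = Const c * F f)"

lemma clinear_map_sum:
  assumes "clinear_map F"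
  shows "F (sum f A) = (\<Sum>x\<in>A. F (f x))"
proof -
  have "F (Const 0 * 0) = Const 0 * F 0" using assms unfolding clinear_map_def by blast
  then have "F 0 = 0" by simp
  then show ?thesis
    by (induction A rule: infinite_finite_induct) (use assms in \<open>simp_all add: clinear_map_def\<close>)
qed

text \<open>Reindexing \<open>g = h \<circ> \<sigma>\<close> moves the multiplication by
  \<open>h\<close> from the coefficient function to the group element in the monomial.\<close>

lemma Psi_conv_indicator:
  assumes S: "S \<subseteq> hyperoct n" "indicator S \<in> centre n" and z: "z \<in> centre n"
  shows "Psi n (conv n (indicator S) z) =
    (\<Sum>\<sigma>\<in>hyperoct n. Const (z \<sigma>) * (\<Sum>h\<in>S. class_monomial n (h \<circ> \<sigma>)))"
proof -
  have conv: "conv n (indicator S) z g = (\<Sum>h\<in>S. z (hinv h \<circ> g))" for g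
    unfolding conv_def
    by (rule sum.mono_neutral_cong_right) (use S finite_hyperoct in \<open>auto simp: indicator_def\<close>)
  have "Psi n (conv n (indicator S) z) = Psi_sum n (conv n (indicator S) z)"
    by (rule Psi_eq_Psi_sum[OF conv_in_centre[OF S(2) z]])
  also have "\<dots> = (\<Sum>h\<in>S. \<Sum>g\<in>hyperoct n. Const (z (hinv h \<circ> g)) * class_monomial n g)"
    unfolding Psi_sum_def conv Const_sum sum_distrib_right by (rule sum.swap)
  also have "\<dots> = (\<Sum>h\<in>S. \<Sum>\<sigma>\<in>hyperoct n. Const (z \<sigma>) * class_monomial n (h \<circ> \<sigma>))"
  proof (rule sum.cong)
    fix h assume "h \<in> S"
    then have h: "h \<in> hyperoct n" using S by blast
    show "(\<Sum>g\<in>hyperoct n. Const (z (hinv h \<circ> g)) * class_monomial n g) =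
        (\<Sum>\<sigma>\<in>hyperoct n. Const (z \<sigma>) * class_monomial n (h \<circ> \<sigma>))"
      by (subst sum_hyperoct_left[OF h]) (simp add: o_assoc hinv_simps[OF h])
  qed simp
  also have "\<dots> = (\<Sum>\<sigma>\<in>hyperoct n. Const (z \<sigma>) * (\<Sum>h\<in>S. class_monomial n (h \<circ> \<sigma>)))"
    unfolding sum_distrib_left by (rule sum.swap)
  finally show ?thesis .
qed

text \<open>By \<open>Psi_conv_indicator\<close> it suffices to know the operator on the monomials attached to
  single group elements, although these elements are not central.\<close>

lemma transported_eqI:
  assumes S: "\<And>n. S n \<subseteq> hyperoct n" "\<And>n. T n = indicator (S n)" "\<And>n. T n \<in> centre n"
    and lin: "clinear_map E" "clinear_map \<Lambda>"
    and key: "\<And>n \<sigma>. \<sigma> \<in> hyperoct n \<Longrightarrow> E (\<Sum>h\<in>S n. class_monomial n (h \<circ> \<sigma>)) = \<Lambda> (class_monomial n \<sigma>)"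
    and const: "\<And>c. \<Lambda> (Const c) = 0"
  shows "E (transported T f) = \<Lambda> f"
proof -
  have Econst: "E (Const c * g) = Const c * E g" and \<Lambda>const: "\<Lambda> (Const c * h) = Const c * \<Lambda> h" for c g h
    using lin by (simp_all add: clinear_map_def)
  have *: "E (Psi n (conv n (T n) (inv_into (centre n) (Psi n) (hom_component n f)))) = \<Lambda> (hom_component n f)" for n
  proof -
    define z where "z = inv_into (centre n) (Psi n) (hom_component n f)"
    have z: "z \<in> centre n" "Psi n z = hom_component n f"
      unfolding z_def
      by (rule inv_into_into[OF hom_component_in_Psi_image], rule f_inv_into_f[OF hom_component_in_Psi_image])
    have "E (Psi n (conv n (T n) z)) =
        (\<Sum>\<sigma>\<in>hyperoct n. Const (z \<sigma>) * E (\<Sum>h\<in>S n. class_monomial n (h \<circ> \<sigma>)))"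
      using Psi_conv_indicator[OF S(1) S(3)[unfolded S(2)] z(1)]
      by (simp add: S(2) clinear_map_sum[OF lin(1), of _ "hyperoct n"] Econst)
    also have "\<dots> = (\<Sum>\<sigma>\<in>hyperoct n. Const (z \<sigma>) * \<Lambda> (class_monomial n \<sigma>))"
      by (rule sum.cong) (simp_all add: key)
    also have "\<dots> = \<Lambda> (Psi n z)"
      unfolding Psi_eq_Psi_sum[OF z(1)] Psi_sum_def clinear_map_sum[OF lin(2)] \<Lambda>const ..
    finally have "E (Psi n (conv n (T n) z)) = \<Lambda> (hom_component n f)" by (simp only: z(2))
    then show ?thesis unfolding z_def .
  qed
  have "E (transported T f) = (\<Sum>n\<in>mono_deg ` keys f - {0}. \<Lambda> (hom_component n f))"
    unfolding transported_def clinear_map_sum[OF lin(1)] * ..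
  \<comment> \<open>The degree 0 left out by \<open>transported\<close> contributes a constant,
    which \<open>\<Lambda>\<close> annihilates.\<close>
  also have "\<dots> = (\<Sum>n\<in>mono_deg ` keys f. \<Lambda> (hom_component n f))"
    by (rule sum.mono_neutral_left) (auto simp: hom_component_0 const)
  also have "\<dots> = \<Lambda> f"
    unfolding clinear_map_sum[OF lin(2), symmetric] sum_hom_components ..
  finally show ?thesis .
qed

section \<open>Schur polynomials as eigenvectors\<close>

lemma (in hyperoct_elem) ev_class_monomial:
  "poly_subst (ev_var N) (class_monomial n \<sigma>) = cycle_weight n (psum N) \<sigma>"
  unfolding class_monomial_def cycle_weight_def poly_subst_prod
proof (rule prod.cong)
  fix U assume "U \<in> orbs \<pi> {1..n}"
  then have "0 < card U" using pi.card_orbit_pos by (auto simp: orbs_def)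
  then show "poly_subst (ev_var N) (orbit_weight (\<lambda>k s. if s = 1 then p_var k else q_var k) sg U) =
      orbit_weight (psum N) sg U"
    using prod_sg_cases[of U] by (auto simp: orbit_weight_def p_var_def q_var_def ev_var_def)
qed simp

text \<open>Summation over the sign of the first piece cancels the products of an \<open>x\<close>
  with a \<open>y\<close> power sum, so the two sets of variables do not mix under cuts.\<close>

lemma psum_mult_signs:
  assumes "s = 1 \<or> s = - 1"
  shows "(\<Sum>t\<in>{1, - 1}. psum N d t * psum N e (s * t)) =
    2 * (psum_x N d * psum_x N e + of_int s * (psum_y N d * psum_y N e))"
  using assms by (auto simp: psum_def algebra_simps)

lemma cs_op_class_monomial:
  assumes "\<sigma> \<in> hyperoct n"
  shows "alt2 N [] [] * poly_subst (ev_var N) (\<Sum>h\<in>r_refls n. class_monomial n (h \<circ> \<sigma>)) =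
    cs_op N (alt2 N [] [] * poly_subst (ev_var N) (class_monomial n \<sigma>))"
proof -
  interpret hyperoct_elem n \<sigma> by unfold_locales fact
  let ?a = "alt2 N [] []" and ?S = "orbs \<pi> {1..n}"
  define F where "F = orbit_weight (psum N) sg"
  have F: "F = (\<lambda>U. psum N (card U) (prod sg U))" by (simp add: F_def fun_eq_iff orbit_weight_def)
  have "poly_subst (ev_var N) (class_monomial n (h \<circ> \<sigma>)) = cycle_weight n (psum N) (h \<circ> \<sigma>)"
    if "h \<in> r_refls n" for h
  proof -
    interpret h: hyperoct_elem n "h \<circ> \<sigma>"
      by unfold_locales (use that r_refls_subset hyperoct_comp assms in blast)
    show ?thesis by (rule h.ev_class_monomial)
  qed
  then have "2 * poly_subst (ev_var N) (\<Sum>h\<in>r_refls n. class_monomial n (h \<circ> \<sigma>)) =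
      2 * (\<Sum>h\<in>r_refls n. cycle_weight n (psum N) (h \<circ> \<sigma>))"
    by (simp add: poly_subst_sum)
  also have "\<dots> = (\<Sum>i\<in>{1..n}. \<Sum>j\<in>{1..n} - {i}. \<Sum>\<epsilon>\<in>{1, - 1}. cycle_weight n (psum N) (srefl n i j \<epsilon> \<circ> \<sigma>))"
    by (rule sum_r_refls)
  also have "\<dots> = (\<Sum>i\<in>{1..n}. \<Sum>j\<in>{1..n} - {i}. \<Sum>\<epsilon>\<in>{1, - 1}.
      prod (orbit_weight (psum N) (flip \<epsilon> {i, j} \<pi> sg)) (orbs (transpose i j \<circ> \<pi>) {1..n}))"
    by (intro sum.cong refl cycle_weight_srefl) auto
  also have "\<dots> = (\<Sum>U\<in>?S. \<Sum>V\<in>?S - {U}. 2 * of_nat (card U * card V) *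
       psum N (card U + card V) (prod sg U * prod sg V) * prod F (?S - {U} - {V})) +
    (\<Sum>U\<in>?S. of_nat (card U) *
       (\<Sum>d\<in>{1..<card U}. \<Sum>t\<in>{1, - 1}. psum N d t * psum N (card U - d) (prod sg U * t)) *
       prod F (?S - {U}))"
    unfolding F_def by (rule pi.sum_weight_swaps[OF sg_cases])
  \<comment> \<open>Joins carry their 2 from the two values of \<open>\<epsilon>\<close>, cuts
    theirs from \<open>psum_mult_signs\<close>; both cancel against the count by ordered
    pairs.\<close>
  also have "\<dots> = 2 * ((\<Sum>U\<in>?S. \<Sum>V\<in>?S - {U}. of_nat (card U * card V) *
       psum N (card U + card V) (prod sg U * prod sg V) * prod F (?S - {U} - {V})) +
    (\<Sum>U\<in>?S. of_nat (card U) * (\<Sum>d\<in>{1..<card U}. psum_x N d * psum_x N (card U - d) +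
        of_int (prod sg U) * (psum_y N d * psum_y N (card U - d))) * prod F (?S - {U})))"
    unfolding psum_mult_signs[OF prod_sg_cases]
    by (simp add: sum_distrib_left distrib_left mult_ac del: of_nat_mult)
  finally have "poly_subst (ev_var N) (\<Sum>h\<in>r_refls n. class_monomial n (h \<circ> \<sigma>)) =
    (\<Sum>U\<in>?S. \<Sum>V\<in>?S - {U}. of_nat (card U * card V) *
       psum N (card U + card V) (prod sg U * prod sg V) * prod F (?S - {U} - {V})) +
    (\<Sum>U\<in>?S. of_nat (card U) * (\<Sum>d\<in>{1..<card U}. psum_x N d * psum_x N (card U - d) +
        of_int (prod sg U) * (psum_y N d * psum_y N (card U - d))) * prod F (?S - {U}))"
    by (rule mult_left_cancel[THEN iffD1, rotated]) simp
  moreover have "poly_subst (ev_var N) (class_monomial n \<sigma>) = prod F ?S"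
    unfolding ev_class_monomial cycle_weight_def F_def ..
  moreover have "0 < card U" if "U \<in> ?S" for U
    using that pi.card_orbit_pos by (auto simp: orbs_def)
  ultimately show ?thesis
    unfolding F by (simp only: cs_op_mult_alt2[OF pi.finite_orbs])
qed

lemma signed_euler_class_monomial:
  assumes "\<sigma> \<in> hyperoct n"
  shows "poly_subst (ev_var N) (\<Sum>h\<in>l_refls n. class_monomial n (h \<circ> \<sigma>)) =
    signed_euler N (poly_subst (ev_var N) (class_monomial n \<sigma>))"
proof -
  interpret hyperoct_elem n \<sigma> by unfold_locales fact
  let ?S = "orbs \<pi> {1..n}"
  define F where "F = orbit_weight (psum N) sg"
  have F: "F = (\<lambda>U. psum N (card U) (prod sg U))" by (simp add: F_def fun_eq_iff orbit_weight_def)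
  have "poly_subst (ev_var N) (class_monomial n (h \<circ> \<sigma>)) = cycle_weight n (psum N) (h \<circ> \<sigma>)"
    if "h \<in> l_refls n" for h
  proof -
    interpret h: hyperoct_elem n "h \<circ> \<sigma>"
      by unfold_locales (use that l_refls_subset hyperoct_comp assms in blast)
    show ?thesis by (rule h.ev_class_monomial)
  qed
  then have "poly_subst (ev_var N) (\<Sum>h\<in>l_refls n. class_monomial n (h \<circ> \<sigma>)) =
      (\<Sum>h\<in>l_refls n. cycle_weight n (psum N) (h \<circ> \<sigma>))"
    by (simp add: poly_subst_sum)
  also have "\<dots> = (\<Sum>i\<in>{1..n}. prod (orbit_weight (psum N) (flip (- 1) {i} \<pi> sg)) ?S)"
    unfolding sum_l_refls by (intro sum.cong refl cycle_weight_l_refl)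
  also have "\<dots> = (\<Sum>U\<in>?S. of_nat (card U) * (psum N (card U) (- prod sg U) * prod F (?S - {U})))"
    unfolding F_def by (rule pi.sum_weight_flips)
  also have "\<dots> = signed_euler N (prod F ?S)"
    unfolding F by (subst signed_euler_prod_psum[OF pi.finite_orbs]) (simp_all add: prod_sg_cases mult.assoc)
  also have "prod F ?S = poly_subst (ev_var N) (class_monomial n \<sigma>)"
    unfolding ev_class_monomial cycle_weight_def F_def ..
  finally show ?thesis .
qed

lemma clinear_cs_op: "clinear_map (cs_op N)"
  unfolding clinear_map_def
proof (intro conjI allI)
  show "cs_op N (f + g) = cs_op N f + cs_op N g" for f g
    by (simp add: cs_op_def euler.add sum.distrib algebra_simps)
  show "cs_op N (Const c * f) = Const c * cs_op N f" for c f
    unfolding cs_op_def euler.scale sum_distrib_left[symmetric]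
    by (simp add: right_diff_distrib mult.left_commute)
qed

lemma ev_CJ1:
  "alt2 N [] [] * poly_subst (ev_var N) (CJ1 f) = cs_op N (alt2 N [] [] * poly_subst (ev_var N) f)"
  unfolding CJ1_def
proof (rule transported_eqI[where S = r_refls])
  show "r_refls n \<subseteq> hyperoct n" for n by (rule r_refls_subset)
  show "T1 n = indicator (r_refls n)" for n by (simp add: T1_def r_refls_def)
  show "T1 n \<in> centre n" for n by (rule T1_in_centre)
  show "clinear_map (\<lambda>f. alt2 N [] [] * poly_subst (ev_var N) f)"
    by (simp add: clinear_map_def poly_subst_add poly_subst_mult algebra_simps)
  show "clinear_map (\<lambda>f. cs_op N (alt2 N [] [] * poly_subst (ev_var N) f))"
    using clinear_cs_op[of N]
    by (simp add: clinear_map_def poly_subst_add poly_subst_mult distrib_left mult.left_commute)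
  show "alt2 N [] [] * poly_subst (ev_var N) (\<Sum>h\<in>r_refls n. class_monomial n (h \<circ> \<sigma>)) =
      cs_op N (alt2 N [] [] * poly_subst (ev_var N) (class_monomial n \<sigma>))" if "\<sigma> \<in> hyperoct n" for n \<sigma>
    by (rule cs_op_class_monomial[OF that])
  \<comment> \<open>The operator \<open>CJ1\<close> is 0 on constants; subtracting
    \<open>cs_const N\<close> makes the other side vanish there as well.\<close>
  show "cs_op N (alt2 N [] [] * poly_subst (ev_var N) (Const c)) = 0" for c
  proof -
    have "cs_op N (alt2 N [] []) = 0" unfolding cs_op_alt2 by (simp add: part_def)
    moreover have "cs_op N (Const c * alt2 N [] []) = Const c * cs_op N (alt2 N [] [])"
      using clinear_cs_op[of N] by (simp add: clinear_map_def)
    ultimately show ?thesis by (simp add: mult.commute)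
  qed
qed

lemma ev_CJ2: "poly_subst (ev_var N) (CJ2 f) = signed_euler N (poly_subst (ev_var N) f)"
  unfolding CJ2_def
proof (rule transported_eqI[where S = l_refls])
  interpret derivation "signed_euler N" by (rule signed_euler_derivation)
  show "l_refls n \<subseteq> hyperoct n" for n by (rule l_refls_subset)
  show "T2 n = indicator (l_refls n)" for n by (simp add: T2_def l_refls_def)
  show "T2 n \<in> centre n" for n by (rule T2_in_centre)
  show "clinear_map (poly_subst (ev_var N))"
    by (simp add: clinear_map_def poly_subst_add poly_subst_mult)
  show "clinear_map (\<lambda>f. signed_euler N (poly_subst (ev_var N) f))"
    by (simp add: clinear_map_def poly_subst_add poly_subst_mult add scale)
  show "poly_subst (ev_var N) (\<Sum>h\<in>l_refls n. class_monomial n (h \<circ> \<sigma>)) =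
      signed_euler N (poly_subst (ev_var N) (class_monomial n \<sigma>))" if "\<sigma> \<in> hyperoct n" for n \<sigma>
    by (rule signed_euler_class_monomial[OF that])
  show "signed_euler N (poly_subst (ev_var N) (Const c)) = 0" for c by simp
qed

text \<open>The two halved arguments evaluate to the power sums of the \<open>x\<close> and of the
  \<open>y\<close> variables, so the bialternant formula applies to each factor with its own
  Vandermonde determinant.\<close>

lemma ev_schur_pq_mult_alt2:
  assumes "length lam \<le> N" "length mu \<le> N"
  shows "alt2 N [] [] * poly_subst (ev_var N) (schur_pq lam mu) = alt2 N lam mu"
proof -
  have "Const 2 * Const (1 / 2) = (1 :: nat cpoly)" by (rule Const_mult_inverse) simp
  then have half: "Const (1 / 2) * (2 * g) = g" for g :: "nat cpoly"
    by (simp add: mult.assoc[symmetric] mult.commute[of "Const (1 / 2)"])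
  have p: "poly_subst (ev_var N) (p_var (i + 1)) = psum N (i + 1) 1"
    and q: "poly_subst (ev_var N) (q_var (i + 1)) = psum N (i + 1) (- 1)" for i
    by (simp_all add: p_var_def q_var_def ev_var_def)
  have x: "poly_subst (ev_var N) (Const (1/2) * (p_var (i + 1) + q_var (i + 1))) = (\<Sum>j<N. Var j ^ (i + 1))" for i
    using half[of "psum_x N (i + 1)"]
    unfolding poly_subst_mult poly_subst_add p q poly_subst_Const by (simp add: psum_def psum_x_def)
  have y: "poly_subst (ev_var N) (Const (1/2) * (p_var (i + 1) - q_var (i + 1))) = (\<Sum>j<N. Var (N + j) ^ (i + 1))" for i
    using half[of "psum_y N (i + 1)"]
    unfolding poly_subst_mult poly_subst_diff p q poly_subst_Const by (simp add: psum_def psum_y_def)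
  have "alt2 N [] [] * poly_subst (ev_var N) (schur_pq lam mu) =
     (poly_subst (\<lambda>i. \<Sum>j<N. Var j ^ (i + 1)) (schur lam) * alt Var N []) *
     (poly_subst (\<lambda>i. \<Sum>j<N. Var (N + j) ^ (i + 1)) (schur mu) * alt (\<lambda>i. Var (N + i)) N [])"
    unfolding schur_pq_def poly_subst_mult[of "ev_var N" "poly_subst _ _"] poly_subst_poly_subst x y alt2_def
    by (simp only: mult_ac)
  also have "\<dots> = alt2 N lam mu"
    using poly_subst_schur_mult_alt[OF assms(1), of Var]
      poly_subst_schur_mult_alt[OF assms(2), of "\<lambda>i. Var (N + i)"]
    by (simp only: alt2_def)
  finally show ?thesis .
qed

lemma alt2_neq_0: "is_partition lam \<Longrightarrow> is_partition mu \<Longrightarrow> alt2 N lam mu \<noteq> 0"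
  using alt_Var_neq_0[of lam "\<lambda>i. i" N] alt_Var_neq_0[of mu "(+) N" N] by (simp add: alt2_def)

lemma ex_large_index:
  "\<exists>N\<ge>M. \<forall>m\<in>keys f. keys m \<subseteq> PVar ` {..<N} \<union> QVar ` {..<N}" for f :: pq_poly
proof -
  define idx where "idx v = (case v of PVar i \<Rightarrow> i | QVar i \<Rightarrow> i)" for v
  have "finite (idx ` (\<Union>m\<in>keys f. keys m))" by simp
  then obtain N where N: "idx ` (\<Union>m\<in>keys f. keys m) \<subseteq> {..<N}" by (meson finite_nat_bounded)
  have "v \<in> PVar ` {..<max M N} \<union> QVar ` {..<max M N}" if "m \<in> keys f" "v \<in> keys m" for m v
  proof -
    have "idx v < max M N" using N that by force
    then show ?thesis by (cases v) (auto simp: idx_def)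
  qed
  then show ?thesis by (intro exI[of _ "max M N"]) auto
qed

lemma sum_parts_lessThan:
  fixes f :: "nat \<Rightarrow> 'a::comm_monoid_add"
  assumes "L \<le> N" "\<And>i. L < i \<Longrightarrow> f i = 0"
  shows "(\<Sum>j<N. f (j + 1)) = (\<Sum>i = 1..L. f i)"
proof -
  have "(\<Sum>j<N. f (j + 1)) = (\<Sum>i = 1..N. f i)"
    by (rule sum.reindex_bij_witness[where i = "\<lambda>i. i - 1" and j = Suc]) auto
  also have "\<dots> = (\<Sum>i = 1..L. f i)"
    by (rule sum.mono_neutral_right) (use assms in auto)
  finally show ?thesis .
qed

theorem theorem3p2:
  fixes lam mu :: "nat list"
  assumes "is_partition lam" and "is_partition mu"
  shows "eigenvector CJ1 (schur_pq lam mu)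
           (of_int (\<Sum>i = 1..max (length lam) (length mu).
              int (part lam i) * (int (part lam i) - 2 * int i + 1) +
              int (part mu i) * (int (part mu i) - 2 * int i + 1)))
       \<and> eigenvector CJ2 (schur_pq lam mu)
           (of_int (\<Sum>i = 1..max (length lam) (length mu). int (part lam i) - int (part mu i)))"
proof -
  let ?L = "max (length lam) (length mu)" and ?f = "schur_pq lam mu"
  define c1 where "c1 = (\<Sum>i = 1..?L.
      int (part lam i) * (int (part lam i) - 2 * int i + 1) +
      int (part mu i) * (int (part mu i) - 2 * int i + 1))"
  define c2 where "c2 = (\<Sum>i = 1..?L. int (part lam i) - int (part mu i))"
  have a0: "alt2 N [] [] \<noteq> 0" for N by (rule alt2_neq_0) simp_all
  have sf: "alt2 N [] [] * poly_subst (ev_var N) ?f = alt2 N lam mu" if "?L \<le> N" for N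
    by (rule ev_schur_pq_mult_alt2) (use that in auto)
  have "alt2 ?L lam mu \<noteq> 0" by (rule alt2_neq_0[OF assms])
  then have "?f \<noteq> 0" using sf[of ?L] by auto
  \<comment> \<open>An identity may be tested after evaluation in \<open>N + N\<close> variables for
    all large \<open>N\<close>; how large depends on the variables that occur in
    \<open>g\<close>.\<close>
  have zero: "g = 0" if "\<And>N. ?L \<le> N \<Longrightarrow> poly_subst (ev_var N) g = 0" for g
  proof -
    obtain N where "?L \<le> N" "\<forall>m\<in>keys g. keys m \<subseteq> PVar ` {..<N} \<union> QVar ` {..<N}"
      using ex_large_index[of ?L g] by blast
    then show ?thesis using poly_subst_ev_var_inj that by blast
  qed
  have "CJ1 ?f - Const (of_int c1) * ?f = 0"
  proof (rule zero)
    fix N assume N: "?L \<le> N"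
    \<comment> \<open>The zero parts beyond both lengths contribute nothing, so the eigenvalue is
      the same for every such \<open>N\<close>.\<close>
    have "(\<Sum>j<N. int (part lam (j + 1)) * (int (part lam (j + 1)) - 2 * int (j + 1) + 1) +
        int (part mu (j + 1)) * (int (part mu (j + 1)) - 2 * int (j + 1) + 1)) = c1"
      unfolding c1_def by (rule sum_parts_lessThan[OF N]) (simp add: part_def)
    then have "alt2 N [] [] * poly_subst (ev_var N) (CJ1 ?f) = of_int c1 * alt2 N lam mu"
      unfolding ev_CJ1 sf[OF N] cs_op_alt2 by simp
    also have "\<dots> = alt2 N [] [] * poly_subst (ev_var N) (Const (of_int c1) * ?f)"
      unfolding sf[OF N, symmetric] by (simp add: poly_subst_mult mult_ac)
    finally show "poly_subst (ev_var N) (CJ1 ?f - Const (of_int c1) * ?f) = 0"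
      using a0[of N] by (simp add: poly_subst_diff)
  qed
  moreover have "CJ2 ?f - Const (of_int c2) * ?f = 0"
  proof (rule zero)
    fix N assume N: "?L \<le> N"
    interpret D: derivation "signed_euler N" by (rule signed_euler_derivation)
    let ?a = "alt2 N [] []"
    have "(\<Sum>j<N. int (part lam (j + 1)) - int (part mu (j + 1))) = c2"
      unfolding c2_def by (rule sum_parts_lessThan[OF N]) (simp add: part_def)
    then have "signed_euler N (alt2 N lam mu) = of_int c2 * alt2 N lam mu"
      unfolding signed_euler_alt2 by simp
    \<comment> \<open>A derivation that kills \<open>?a\<close> commutes with multiplication by
      \<open>?a\<close>, so here the plain evaluation of \<open>CJ2\<close> can be multiplied by
      \<open>?a\<close> afterwards.\<close>
    moreover have "signed_euler N ?a = 0" unfolding signed_euler_alt2 by (simp add: part_def)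
    ultimately have "?a * poly_subst (ev_var N) (CJ2 ?f) = of_int c2 * alt2 N lam mu"
      unfolding ev_CJ2 using D.mult[of ?a "poly_subst (ev_var N) ?f"] unfolding sf[OF N] by simp
    also have "\<dots> = ?a * poly_subst (ev_var N) (Const (of_int c2) * ?f)"
      unfolding sf[OF N, symmetric] by (simp add: poly_subst_mult mult_ac)
    finally show "poly_subst (ev_var N) (CJ2 ?f - Const (of_int c2) * ?f) = 0"
      using a0[of N] by (simp add: poly_subst_diff)
  qed
  ultimately show ?thesis
    using \<open>?f \<noteq> 0\<close> unfolding eigenvector_def c1_def c2_def by simp
qed

end
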